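(* Let $n\ge 2$, $M\ge 1$, let $\Omega\subset\mathbb{R}^n$ be a bounded Lipschitz domain and let $D\subset\Omega$ be $\mathcal{L}^n$-measurable with $0\le\mathcal{L}^n(D)<\mathcal{L}^n(\Omega)$. Fix $\zeta>1$, $\lambda>0$ and $f\in L^{\zeta}(\Omega-D)^M$. Let $F:\mathbb{R}^{nM}\to[0,\infty)$ be of class $C^1$, strictly convex, with $F(0)=0$, $|DF(P)|\le\nu_1$ and $F(P)\ge\nu_2|P|-\nu_3$ for all $P$, where $\nu_1,\nu_2>0$, $\nu_3\in\mathbb{R}$. With $$R[\varkappa]:=\inf_{w\in W^{1,1}(\Omega)^M\cap L^{\zeta}(\Omega-D)^M}\Big(\int_\Omega[\varkappa:\nabla w-F^*(\varkappa)]\,dx+\frac{\lambda}{\zeta}\int_{\Omega-D}|w-f|^\zeta dx\Big),\quad \varkappa\in L^\infty(\Omega)^{nM},$$ the problem of maximizing $R$ over $L^\infty(\Omega)^{nM}$ has a unique solution $\sigma$, and $$\sigma=DF(\nabla^a u)\quad\text{a.e. on }\Omega,$$ where $u$ is an arbitrary minimizer in $BV(\Omega)^M\cap L^{\zeta}(\Omega-D)^M$ of $$K[w]:=\int_\Omega F(\nabla^a w)\,dx+\int_\Omega F^{\infty}\Big(\frac{\nabla^s w}{|\nabla^s w|}\Big)d|\nabla^s w|+\frac{\lambda}{\zeta}\int_{\Omega-D}|w-f|^{\zeta}dx.$$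
   Context: $F^*(Q):=\sup_{P}[P:Q-F(P)]$ is the convex conjugate of $F$ and $F^\infty(P):=\lim_{t\to\infty}F(tP)/t$ its recession function. The spaces $W^{1,1}(\Omega)^M\cap L^{\zeta}(\Omega-D)^M$, $BV(\Omega)^M\cap L^{\zeta}(\Omega-D)^M$ consist of $W^{1,1}$ resp. $BV$ functions $\Omega\to\mathbb{R}^M$ whose restriction to $\Omega-D$ is in $L^\zeta$. For $w\in BV(\Omega)^M$, $\nabla w=\nabla^a w\,\mathcal{L}^n+\nabla^s w$ is the Lebesgue decomposition of the gradient measure, and $\nabla^s w/|\nabla^s w|$ is the density of $\nabla^s w$ with respect to its total variation $|\nabla^s w|$. Existence of $K$-minimizers is guaranteed under these hypotheses. *)

theory Defs
  imports "HOL-Analysis.Analysis"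
begin

definition strictly_convex :: "('a::real_vector \<Rightarrow> real) \<Rightarrow> bool" where
  "strictly_convex F \<longleftrightarrow> (\<forall>x y t. x \<noteq> y \<and> 0 < t \<and> t < 1 \<longrightarrow>
      F ((1 - t) *\<^sub>R x + t *\<^sub>R y) < (1 - t) * F x + t * F y)"

definition lipschitz_domain :: "('n::euclidean_space) set \<Rightarrow> bool" where
  "lipschitz_domain \<Omega> \<longleftrightarrow> open \<Omega> \<and> connected \<Omega> \<and> bounded \<Omega> \<and> \<Omega> \<noteq> {} \<and>
     (\<forall>x\<in>frontier \<Omega>. \<exists>r>0. \<exists>e. norm e = 1 \<and> (\<exists>\<gamma> L.
        L-lipschitz_on {z. z \<bullet> e = 0} \<gamma> \<and>
        \<Omega> \<inter> ball x r = {y \<in> ball x r. y \<bullet> e > \<gamma> (y - (y \<bullet> e) *\<^sub>R e)}))"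

definition Lp_on :: "real \<Rightarrow> ('n::euclidean_space) set \<Rightarrow> ('n \<Rightarrow> 'b::euclidean_space) set" where
  "Lp_on p S = {w. w \<in> borel_measurable (lebesgue_on S) \<and>
       integrable (lebesgue_on S) (\<lambda>x. norm (w x) powr p)}"

definition Linf_on :: "('n::euclidean_space) set \<Rightarrow> ('n \<Rightarrow> 'b::euclidean_space) set" where
  "Linf_on S = {w. w \<in> borel_measurable (lebesgue_on S) \<and>
       (\<exists>C. AE x in lebesgue_on S. norm (w x) \<le> C)}"

definition test_fun :: "('n::euclidean_space) set \<Rightarrow> ('n \<Rightarrow> real) \<Rightarrow> ('n \<Rightarrow> 'n) \<Rightarrow> bool" where
  "test_fun \<Omega> \<phi> d\<phi> \<longleftrightarrow> continuous_on UNIV d\<phi> \<and>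
     (\<forall>x. (\<phi> has_derivative (\<lambda>h. d\<phi> x \<bullet> h)) (at x)) \<and>
     (\<exists>K. compact K \<and> K \<subseteq> \<Omega> \<and> (\<forall>x. x \<notin> K \<longrightarrow> \<phi> x = 0))"

definition weak_grad :: "(real^'n) set \<Rightarrow> (real^'n \<Rightarrow> real^'m) \<Rightarrow> (real^'n \<Rightarrow> real^'n^'m) \<Rightarrow> bool" where
  "weak_grad \<Omega> w g \<longleftrightarrow> g \<in> Lp_on 1 \<Omega> \<and>
     (\<forall>\<phi> d\<phi> k i. test_fun \<Omega> \<phi> d\<phi> \<longrightarrow>
        (\<integral>x. w x $ k * d\<phi> x $ i \<partial>lebesgue_on \<Omega>) = - (\<integral>x. g x $ k $ i * \<phi> x \<partial>lebesgue_on \<Omega>))"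

definition W11 :: "(real^'n) set \<Rightarrow> (real^'n \<Rightarrow> real^'m) set" where
  "W11 \<Omega> = {w. w \<in> Lp_on 1 \<Omega> \<and> (\<exists>g. weak_grad \<Omega> w g)}"

definition W11_grad :: "(real^'n) set \<Rightarrow> (real^'n \<Rightarrow> real^'m) \<Rightarrow> (real^'n \<Rightarrow> real^'n^'m)" where
  "W11_grad \<Omega> w = (SOME g. weak_grad \<Omega> w g)"

text \<open>BV: the distributional gradient is a finite vector measure
  g \<L>^n + h \<nu>  with \<nu> a finite Borel measure on \<Omega> singular to \<L>^n.
  Then \<nabla>^a w = g, \<nabla>^s w = h \<nu>, |\<nabla>^s w| = |h| \<nu>, \<nabla>^s w/|\<nabla>^s w| = h/|h|.\<close>
definition bv_repr :: "(real^'n) set \<Rightarrow> (real^'n \<Rightarrow> real^'m)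
    \<Rightarrow> (real^'n \<Rightarrow> real^'n^'m) \<times> (real^'n) measure \<times> (real^'n \<Rightarrow> real^'n^'m) \<Rightarrow> bool" where
  "bv_repr \<Omega> w r \<longleftrightarrow> (case r of (g, \<nu>, h) \<Rightarrow>
     g \<in> Lp_on 1 \<Omega> \<and>
     space \<nu> = \<Omega> \<and> sets \<nu> = sets (restrict_space borel \<Omega>) \<and> finite_measure \<nu> \<and>
     (\<exists>N \<in> sets \<nu>. emeasure lebesgue N = 0 \<and> emeasure \<nu> (\<Omega> - N) = 0) \<and>
     integrable \<nu> h \<and>
     (\<forall>\<phi> d\<phi> k i. test_fun \<Omega> \<phi> d\<phi> \<longrightarrow>
        (\<integral>x. w x $ k * d\<phi> x $ i \<partial>lebesgue_on \<Omega>) =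
          - ((\<integral>x. g x $ k $ i * \<phi> x \<partial>lebesgue_on \<Omega>) + (\<integral>x. h x $ k $ i * \<phi> x \<partial>\<nu>))))"

definition BV :: "(real^'n) set \<Rightarrow> (real^'n \<Rightarrow> real^'m) set" where
  "BV \<Omega> = {w. w \<in> Lp_on 1 \<Omega> \<and> (\<exists>r. bv_repr \<Omega> w r)}"

definition bv_choice where
  "bv_choice \<Omega> w = (SOME r. bv_repr \<Omega> w r)"

definition grad_a :: "(real^'n) set \<Rightarrow> (real^'n \<Rightarrow> real^'m) \<Rightarrow> (real^'n \<Rightarrow> real^'n^'m)" where
  "grad_a \<Omega> w = fst (bv_choice \<Omega> w)"

definition conj_fun :: "('a::real_inner \<Rightarrow> real) \<Rightarrow> 'a \<Rightarrow> ereal" where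
  "conj_fun F Q = (SUP P. ereal (P \<bullet> Q - F P))"

definition recession :: "('a::real_vector \<Rightarrow> real) \<Rightarrow> 'a \<Rightarrow> real" where
  "recession F P = Lim at_top (\<lambda>t::real. F (t *\<^sub>R P) / t)"

definition K_fun :: "(real^'n^'m \<Rightarrow> real) \<Rightarrow> real \<Rightarrow> real \<Rightarrow> (real^'n) set \<Rightarrow> (real^'n) set
     \<Rightarrow> (real^'n \<Rightarrow> real^'m) \<Rightarrow> (real^'n \<Rightarrow> real^'m) \<Rightarrow> real" where
  "K_fun F lam \<zeta> \<Omega> D f w =
     (case bv_choice \<Omega> w of (g, \<nu>, h) \<Rightarrow>
        (\<integral>x. F (g x) \<partial>lebesgue_on \<Omega>)
      + (\<integral>x. recession F ((1 / norm (h x)) *\<^sub>R h x) * norm (h x) \<partial>\<nu>)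
      + lam / \<zeta> * (\<integral>x. norm (w x - f x) powr \<zeta> \<partial>lebesgue_on (\<Omega> - D)))"

text \<open>The dual functional R (extended-real valued; note F* \<ge> 0 since F(0)=0).\<close>
definition R_fun :: "(real^'n^'m \<Rightarrow> real) \<Rightarrow> real \<Rightarrow> real \<Rightarrow> (real^'n) set \<Rightarrow> (real^'n) set
     \<Rightarrow> (real^'n \<Rightarrow> real^'m) \<Rightarrow> (real^'n \<Rightarrow> real^'n^'m) \<Rightarrow> ereal" where
  "R_fun F lam \<zeta> \<Omega> D f \<kappa> =
     (INF w \<in> W11 \<Omega> \<inter> Lp_on \<zeta> (\<Omega> - D).
        ereal (\<integral>x. \<kappa> x \<bullet> W11_grad \<Omega> w x \<partial>lebesgue_on \<Omega>)
        - enn2ereal (\<integral>\<^sup>+x. e2ennreal (conj_fun F (\<kappa> x)) \<partial>lebesgue_on \<Omega>)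
        + ereal (lam / \<zeta> * (\<integral>x. norm (w x - f x) powr \<zeta> \<partial>lebesgue_on (\<Omega> - D))))"

end

theory Submission
  imports Defs
begin

text \<open>Write \<open>J\<close> for the primal energy on \<open>W\<^sup>1\<^sup>,\<^sup>1 \<inter> L\<^sup>\<zeta>\<close> and \<open>I\<close> for its infimum; Fenchel--Young gives
  \<open>R \<le> I\<close>. For a fast minimizing sequence, strict convexity makes the gradients converge almost
  everywhere to some \<open>g\<close>, and convexity together with Fatou's lemma gives \<open>R[DF(g)] \<ge> I\<close>.
  If \<open>R[\<tau>] = I\<close>, the Fenchel--Young deficits of \<open>\<tau>\<close> along the sequence tend to zero in \<open>L\<^sup>1\<close>, so
  \<open>\<tau> = DF(g)\<close>; this is uniqueness. A minimizer \<open>u\<close> of \<open>K\<close> satisfies \<open>R[DF(\<nabla>\<^sup>a u)] \<ge> K[u]\<close> by the first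
  variation towards \<open>W\<^sup>1\<^sup>,\<^sup>1\<close> functions, so it remains to see that \<open>K[u] \<ge> I\<close>. For this \<open>u\<close> is mollified
  with a radius proportional to a smooth function comparable to the distance from the boundary, so
  that Jensen's inequality bounds the energy, and then truncated by a logarithmic cutoff, which
  is needed because \<open>u\<close> is only integrable on \<open>D\<close>.\<close>

section \<open>Convex densities of linear growth\<close>

text \<open>The gradients of a minimizing sequence are bounded only in \<open>L^1\<close>: mass may
  concentrate, and only their pointwise limit survives. On shrinking by 1 - t, the energy of the
  concentrated part falls to at most 1 - t times its value, just as the singular part of a BV
  function contributes exactly the factor 1 - t by homogeneity of the recession function. Along a
  segment the unseen energy thus enters linearly in t, so that \<open>R_DF_ge\<close> serves both
  the limit of the sequence and a minimizer of K.

  A second obstacle is that \<open>W11_grad\<close> and \<open>bv_choice\<close> are arbitrary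
  choices, so nothing can be computed before the decomposition is known to be unique. The pair of
  singular measure and density is not unique; only their product is, and homogeneity makes the
  recession integral depend on the product alone.

  A third is the variable radius: the gradient of the mollified function is no longer the mollified
  gradient measure. The difference carries the gradient of the radius, of size at most e, and a
  kernel of the same mass, hence vanishes with e.\<close>

locale linear_growth_density =
  fixes F :: "'a::euclidean_space \<Rightarrow> real" and DF :: "'a \<Rightarrow> 'a" and \<nu>1 \<nu>2 \<nu>3 :: real
  assumes F_nonneg: "\<And>P. F P \<ge> 0"
    and F_deriv: "\<And>P. (F has_derivative (\<lambda>H. DF P \<bullet> H)) (at P)"
    and DF_cont: "continuous_on UNIV DF"
    and F_convex: "strictly_convex F"
    and F_0: "F 0 = 0"
    and nu_pos: "\<nu>1 > 0" "\<nu>2 > 0"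
    and DF_bound: "\<And>P. norm (DF P) \<le> \<nu>1"
    and F_growth: "\<And>P. F P \<ge> \<nu>2 * norm P - \<nu>3"
begin

lemma F_convex_le:
  assumes "0 \<le> t" "t \<le> 1"
  shows "F ((1 - t) *\<^sub>R x + t *\<^sub>R y) \<le> (1 - t) * F x + t * F y"
proof (cases "x = y \<or> t = 0 \<or> t = 1")
  case True
  have "(1 - t) *\<^sub>R y + t *\<^sub>R y = y" by (simp flip: scaleR_left_distrib)
  moreover have "(1 - t) * F y + t * F y = F y" by (simp add: algebra_simps)
  ultimately show ?thesis using True by auto
next
  case False
  then have "0 < t" "t < 1" using assms by auto
  then show ?thesis using F_convex False unfolding strictly_convex_def by (simp add: less_imp_le)
qed

text \<open>Convexity between 0 and P with \<open>F 0 = 0\<close>. In this form it gives the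
  monotone quotients behind the recession function, and it shows that shrinking a gradient by a
  cutoff factor does not raise the energy.\<close>

lemma F_scale_le:
  assumes "0 \<le> t" "t \<le> 1"
  shows "F (t *\<^sub>R P) \<le> t * F P"
  using F_convex_le[OF assms, of 0 P] F_0 by simp

lemma F_difference_quotient:
  "((\<lambda>t. (F (P + t *\<^sub>R H) - F P) / t) \<longlongrightarrow> DF P \<bullet> H) (at_right 0)"
proof -
  have "((\<lambda>t::real. P + t *\<^sub>R H) has_derivative (\<lambda>t. t *\<^sub>R H)) (at 0)"
    by (auto intro!: derivative_eq_intros)
  moreover have "(F has_derivative (\<lambda>H. DF P \<bullet> H)) (at (P + 0 *\<^sub>R H))"
    using F_deriv by simp
  ultimately have "((\<lambda>t::real. F (P + t *\<^sub>R H)) has_derivative (\<lambda>t. DF P \<bullet> (t *\<^sub>R H))) (at 0)"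
    using has_derivative_compose by blast
  then have "((\<lambda>t::real. F (P + t *\<^sub>R H)) has_real_derivative (DF P \<bullet> H)) (at 0)"
    by (rule has_derivative_imp_has_field_derivative) simp
  then have "((\<lambda>t. (F (P + t *\<^sub>R H) - F P) / t) \<longlongrightarrow> DF P \<bullet> H) (at 0)"
    by (simp add: DERIV_def)
  then show ?thesis by (simp add: filterlim_at_split)
qed

lemma F_subgradient: "F P + DF P \<bullet> (Q - P) \<le> F Q"
proof -
  have "DF P \<bullet> (Q - P) \<le> F Q - F P"
  proof (rule tendsto_upperbound[OF F_difference_quotient])
    show "eventually (\<lambda>t. (F (P + t *\<^sub>R (Q - P)) - F P) / t \<le> F Q - F P) (at_right 0)"
      unfolding eventually_at_right_field
    proof (intro exI[of _ 1] conjI allI impI)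
      fix t :: real assume t: "t > 0" "t < 1"
      have "P + t *\<^sub>R (Q - P) = (1 - t) *\<^sub>R P + t *\<^sub>R Q" by (simp add: algebra_simps)
      then have "F (P + t *\<^sub>R (Q - P)) \<le> (1 - t) * F P + t * F Q"
        using F_convex_le[of t P Q] t by simp
      then have "F (P + t *\<^sub>R (Q - P)) - F P \<le> t * (F Q - F P)" by (simp add: algebra_simps)
      then show "(F (P + t *\<^sub>R (Q - P)) - F P) / t \<le> F Q - F P"
        using t by (simp add: divide_le_eq mult.commute)
    qed simp
  qed simp
  then show ?thesis by simp
qed

lemma DF_inner_le: "\<bar>DF P \<bullet> H\<bar> \<le> \<nu>1 * norm H"
  by (meson DF_bound Cauchy_Schwarz_ineq2 mult_right_mono norm_ge_zero order_trans)

lemma F_lipschitz: "\<bar>F P - F Q\<bar> \<le> \<nu>1 * norm (P - Q)"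
proof -
  have "F P - F Q \<le> \<nu>1 * norm (P - Q)" for P Q
    using F_subgradient[of P Q] DF_inner_le[of P "P - Q"] by (simp add: inner_diff_right)
  from this[of P Q] this[of Q P] show ?thesis by (simp add: norm_minus_commute)
qed

lemma F_le_norm: "F P \<le> \<nu>1 * norm P"
  using F_lipschitz[of P 0] F_0 by simp

lemma F_continuous: "continuous_on UNIV F"
  by (rule continuous_at_imp_continuous_on) (use F_deriv has_derivative_continuous in blast)

lemma F_borel [measurable]: "F \<in> borel_measurable borel"
  and DF_borel [measurable]: "DF \<in> borel_measurable borel"
  using F_continuous DF_cont by (auto intro: borel_measurable_continuous_onI)

lemma fenchel_young: "ereal (P \<bullet> Q - F P) \<le> conj_fun F Q"
  unfolding conj_fun_def by (rule SUP_upper) simp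

lemma conj_fun_nonneg: "conj_fun F Q \<ge> 0"
  using fenchel_young[of 0 Q] F_0 by (simp add: zero_ereal_def)

lemma conj_fun_DF: "conj_fun F (DF P) = ereal (DF P \<bullet> P - F P)"
proof (rule antisym)
  show "conj_fun F (DF P) \<le> ereal (DF P \<bullet> P - F P)"
    unfolding conj_fun_def
  proof (rule SUP_least)
    fix Q show "ereal (Q \<bullet> DF P - F Q) \<le> ereal (DF P \<bullet> P - F P)"
      using F_subgradient[of P Q] by (simp add: inner_diff_right inner_commute)
  qed
  show "ereal (DF P \<bullet> P - F P) \<le> conj_fun F (DF P)"
    using fenchel_young[of P "DF P"] by (simp add: inner_commute)
qed

text \<open>Equality makes P a minimizer of the differentiable function F - Q . _, whose gradient DF
  P - Q must vanish. This is how a vanishing deficit identifies a maximizer of R.\<close>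

lemma fenchel_young_equality:
  assumes "conj_fun F Q \<le> ereal (P \<bullet> Q - F P)"
  shows "Q = DF P"
proof -
  have min: "F P - Q \<bullet> P \<le> F P' - Q \<bullet> P'" for P'
    using order_trans[OF fenchel_young[of P' Q] assms] by (simp add: inner_commute)
  have "((\<lambda>P. F P - Q \<bullet> P) has_derivative (\<lambda>H. DF P \<bullet> H - Q \<bullet> H)) (at P)"
    by (intro derivative_intros F_deriv)
  then have "(\<lambda>H. DF P \<bullet> H - Q \<bullet> H) = (\<lambda>H. 0)"
    using differential_zero_maxmin[of P UNIV "\<lambda>P. F P - Q \<bullet> P"] min by auto
  then have "(DF P - Q) \<bullet> (DF P - Q) = 0"
    by (metis inner_diff_left)
  then show ?thesis by simp
qed

text \<open>The supremum runs over uncountably many P, so measurability comes from lower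
  semicontinuity: the superlevel sets are unions of open half spaces, or empty or
  everything.\<close>

lemma conj_fun_borel [measurable]: "conj_fun F \<in> borel_measurable borel"
proof (rule borel_measurableI_greater)
  fix a :: ereal
  have "{Q. a < conj_fun F Q} = (\<Union>P. {Q. a < ereal (P \<bullet> Q - F P)})"
    by (auto simp: conj_fun_def less_SUP_iff)
  moreover have "open {Q. a < ereal (P \<bullet> Q - F P)}" for P
    by (intro open_Collect_less continuous_intros)
  ultimately have "open {Q. a < conj_fun F Q}" by auto
  then show "{x \<in> space borel. a < conj_fun F x} \<in> sets borel" by simp
qed

text \<open>By convexity, the quotients increase with \<open>t\<close>, so the limit defining the recession
  function exists.\<close>

lemma recession_tendsto: "((\<lambda>t. F (t *\<^sub>R P) / t) \<longlongrightarrow> recession F P) at_top"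
proof -
  define q where "q = (\<lambda>t. F (t *\<^sub>R P) / t)"
  have mono: "q s \<le> q t" if "0 < s" "s \<le> t" for s t
  proof -
    have "F ((s / t) *\<^sub>R (t *\<^sub>R P)) \<le> s / t * F (t *\<^sub>R P)"
      by (rule F_scale_le) (use that in auto)
    then show ?thesis using that by (simp add: q_def field_simps)
  qed
  have bdd: "q t \<le> \<nu>1 * norm P" if "t > 0" for t
    using F_le_norm[of "t *\<^sub>R P"] that by (simp add: q_def divide_le_eq mult_ac)
  define L where "L = (SUP t\<in>{0<..}. q t)"
  have bdda: "bdd_above (q ` {0<..})" using bdd by (auto intro!: bdd_aboveI)
  have "(q \<longlongrightarrow> L) at_top"
  proof (rule order_tendstoI)
    fix a assume "a < L"
    then obtain s where s: "s > 0" "a < q s"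
      unfolding L_def using less_cSUP_iff[OF _ bdda] by auto
    then show "\<forall>\<^sub>F t in at_top. a < q t"
      using mono by (intro eventually_mono[OF eventually_ge_at_top[of s]]) (meson less_le_trans)
  next
    fix a assume "L < a"
    then show "\<forall>\<^sub>F t in at_top. q t < a"
      by (intro eventually_mono[OF eventually_gt_at_top[of 0]])
        (metis L_def bdda cSUP_upper greaterThan_iff le_less_trans)
  qed
  then have "(q \<longlongrightarrow> recession F P) at_top"
    unfolding recession_def q_def[symmetric] using tendsto_Lim[of at_top q L] by simp
  then show ?thesis by (simp add: q_def)
qed

text \<open>The tangent plane at P, evaluated at t H and divided by t, lies below F (t H) / t; its
  constant part disappears as t grows.\<close>

lemma DF_le_recession: "DF P \<bullet> H \<le> recession F H"
proof (rule tendsto_le[OF _ recession_tendsto])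
  have "((\<lambda>t::real. (F P - DF P \<bullet> P) * inverse t + DF P \<bullet> H) \<longlongrightarrow> (F P - DF P \<bullet> P) * 0 + DF P \<bullet> H) at_top"
    by (intro tendsto_intros tendsto_inverse_0_at_top filterlim_ident)
  then show "((\<lambda>t::real. (F P - DF P \<bullet> P) * inverse t + DF P \<bullet> H) \<longlongrightarrow> DF P \<bullet> H) at_top" by simp
  show "\<forall>\<^sub>F t in at_top. (F P - DF P \<bullet> P) * inverse t + DF P \<bullet> H \<le> F (t *\<^sub>R H) / t"
  proof (rule eventually_mono[OF eventually_gt_at_top[of 0]])
    fix t :: real assume t: "t > 0"
    have "F P + DF P \<bullet> (t *\<^sub>R H - P) \<le> F (t *\<^sub>R H)" by (rule F_subgradient)
    then have "((F P - DF P \<bullet> P) + t * (DF P \<bullet> H)) / t \<le> F (t *\<^sub>R H) / t"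
      using t by (intro divide_right_mono) (simp_all add: inner_diff_right)
    moreover have "(F P - DF P \<bullet> P) * inverse t + DF P \<bullet> H = ((F P - DF P \<bullet> P) + t * (DF P \<bullet> H)) / t"
      using t by (simp add: field_simps)
    ultimately show "(F P - DF P \<bullet> P) * inverse t + DF P \<bullet> H \<le> F (t *\<^sub>R H) / t"
      by simp
  qed
qed simp

text \<open>The subgradient is taken at P + Q, not at P. Together with
  \<open>DF_le_recession\<close> this bounds the cost of adding Q by \<open>recession F Q\<close>,
  which is how the singular part enters Jensen's inequality.\<close>

lemma F_add_le: "F (P + Q) \<le> F P + DF (P + Q) \<bullet> Q"
  using F_subgradient[of "P + Q" P] by simp

lemma recession_scaleR:
  assumes "c > 0"
  shows "recession F (c *\<^sub>R P) = c * recession F P"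
proof -
  have "filterlim (\<lambda>t::real. c * t) at_top at_top"
    by (rule filterlim_tendsto_pos_mult_at_top[OF tendsto_const assms filterlim_ident])
  then have "((\<lambda>t. F ((c * t) *\<^sub>R P) / (c * t)) \<longlongrightarrow> recession F P) at_top"
    by (rule filterlim_compose[OF recession_tendsto])
  then have "((\<lambda>t. c * (F ((c * t) *\<^sub>R P) / (c * t))) \<longlongrightarrow> c * recession F P) at_top"
    by (intro tendsto_intros)
  moreover have "(\<lambda>t. c * (F ((c * t) *\<^sub>R P) / (c * t))) = (\<lambda>t. F (t *\<^sub>R (c *\<^sub>R P)) / t)"
    using assms by (auto simp: mult.commute)
  ultimately show ?thesis
    using recession_tendsto[of "c *\<^sub>R P"] tendsto_unique by (metis trivial_limit_at_top_linorder)
qed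

lemma recession_0: "recession F 0 = 0"
  using recession_tendsto[of 0] by (simp add: F_0 tendsto_const_iff)

lemma recession_scaleR_nonneg: "c \<ge> 0 \<Longrightarrow> recession F (c *\<^sub>R P) = c * recession F P"
  using recession_scaleR[of c P] recession_0 by (cases "c = 0") auto

text \<open>\<open>K_fun\<close> evaluates the recession function at the polar direction and weights
  it by the norm. Homogeneity merges the two; at P = 0 the convention 1 / 0 = 0 makes both sides
  vanish.\<close>

lemma recession_polar: "recession F ((1 / norm P) *\<^sub>R P) * norm P = recession F P"
  by (cases "P = 0") (simp_all add: recession_0 recession_scaleR)

lemma recession_nonneg: "recession F P \<ge> 0"
  by (rule tendsto_lowerbound[OF recession_tendsto])
    (use F_nonneg in \<open>auto intro!: eventually_mono[OF eventually_gt_at_top[of 0]]\<close>)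

lemma recession_le: "recession F P \<le> \<nu>1 * norm P"
proof (rule tendsto_upperbound[OF recession_tendsto])
  show "\<forall>\<^sub>F t in at_top. F (t *\<^sub>R P) / t \<le> \<nu>1 * norm P"
  proof (rule eventually_mono[OF eventually_gt_at_top[of 0]])
    fix t :: real assume "t > 0"
    then show "F (t *\<^sub>R P) / t \<le> \<nu>1 * norm P"
      using F_le_norm[of "t *\<^sub>R P"] by (simp add: divide_le_eq mult_ac)
  qed
qed simp

lemma recession_borel [measurable]: "recession F \<in> borel_measurable borel"
proof (rule borel_measurable_LIMSEQ_real)
  show "(\<lambda>n. F (real n *\<^sub>R P) / real n) \<longlonglongrightarrow> recession F P" for P
    by (rule filterlim_compose[OF recession_tendsto filterlim_real_sequentially])
qed measurable

lemma midpoint_gap_pos: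
  assumes "P \<noteq> Q"
  shows "F ((1/2) *\<^sub>R P + (1/2) *\<^sub>R Q) < F P / 2 + F Q / 2"
  using F_convex[unfolded strictly_convex_def, rule_format, of P Q "1/2"] assms by simp

text \<open>Strict convexity gives no modulus by itself. The pairs in a fixed ball at distance at
  least r form a compact set, and on it the continuous positive gap attains its minimum.\<close>

lemma midpoint_gap_uniform:
  assumes "r > 0"
  obtains \<eta> where "\<eta> > 0"
    "\<And>P Q. norm P \<le> R \<Longrightarrow> norm Q \<le> R \<Longrightarrow> norm (P - Q) \<ge> r \<Longrightarrow>
      F P / 2 + F Q / 2 - F ((1/2) *\<^sub>R P + (1/2) *\<^sub>R Q) \<ge> \<eta>"
proof -
  define K where "K = (cball 0 R \<times> cball 0 R) \<inter> {z::'a\<times>'a. r \<le> norm (fst z - snd z)}"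
  define g where "g z = F (fst z) / 2 + F (snd z) / 2 - F ((1/2) *\<^sub>R fst z + (1/2) *\<^sub>R snd z)" for z
  have "closed {z::'a\<times>'a. r \<le> norm (fst z - snd z)}"
    by (intro closed_Collect_le continuous_intros)
  then have K: "compact K"
    unfolding K_def by (intro compact_Int_closed compact_Times) auto
  have g: "continuous_on K g"
    unfolding g_def by (intro continuous_intros continuous_on_compose2[OF F_continuous]) auto
  have pos: "g z > 0" if "z \<in> K" for z
  proof -
    have "fst z \<noteq> snd z" using that assms by (auto simp: K_def)
    from midpoint_gap_pos[OF this] show ?thesis by (simp add: g_def)
  qed
  obtain \<eta> where "\<eta> > 0" "\<And>z. z \<in> K \<Longrightarrow> g z \<ge> \<eta>"
  proof (cases "K = {}")
    case True
    then show ?thesis using that[of 1] by simp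
  next
    case False
    then obtain z where "z \<in> K" "\<And>y. y \<in> K \<Longrightarrow> g z \<le> g y"
      using continuous_attains_inf[OF K _ g] by blast
    then show ?thesis using that[of "g z"] pos by blast
  qed
  moreover have "(P, Q) \<in> K" if "norm P \<le> R" "norm Q \<le> R" "norm (P - Q) \<ge> r" for P Q
    using that by (simp add: K_def)
  ultimately show ?thesis
    using that[of \<eta>] by (fastforce simp: g_def)
qed

end

section \<open>Test functions and weak gradients\<close>

lemma Lp_on_1: "w \<in> Lp_on 1 S \<longleftrightarrow> integrable (lebesgue_on S) w"
  unfolding Lp_on_def using integrable_norm_iff[of w "lebesgue_on S"] by auto

lemma norm_add_powr_le:
  assumes "p \<ge> 0"
  shows "norm (a + b) powr p \<le> 2 powr p * (norm a powr p + norm b powr p)"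
proof -
  have "norm (a + b) powr p \<le> (2 * max (norm a) (norm b)) powr p"
    by (rule powr_mono2[OF assms]) (use norm_triangle_ineq[of a b] in auto)
  also have "\<dots> = 2 powr p * max (norm a) (norm b) powr p" by (rule powr_mult)
  also have "max (norm a) (norm b) powr p \<le> norm a powr p + norm b powr p"
    by (auto simp: max_def)
  finally show ?thesis by (simp add: mult_left_mono)
qed

lemma Lp_on_add:
  assumes "p \<ge> 0" "v \<in> Lp_on p S" "w \<in> Lp_on p S"
  shows "(\<lambda>x. v x + w x) \<in> Lp_on p S"
proof -
  have [measurable]: "v \<in> borel_measurable (lebesgue_on S)" "w \<in> borel_measurable (lebesgue_on S)"
    and i: "integrable (lebesgue_on S) (\<lambda>x. norm (v x) powr p)" "integrable (lebesgue_on S) (\<lambda>x. norm (w x) powr p)"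
    using assms by (auto simp: Lp_on_def)
  have "integrable (lebesgue_on S) (\<lambda>x. norm (v x + w x) powr p)"
    by (rule Bochner_Integration.integrable_bound[OF
        integrable_mult_right[OF Bochner_Integration.integrable_add[OF i], of "2 powr p"]])
      (use norm_add_powr_le[OF assms(1)] in auto)
  then show ?thesis by (simp add: Lp_on_def)
qed

lemma Lp_on_scaleR:
  assumes "w \<in> Lp_on p S"
  shows "(\<lambda>x. c *\<^sub>R w x) \<in> Lp_on p S"
  using assms by (auto simp: Lp_on_def powr_mult)

lemma norm_convex_powr:
  assumes "p \<ge> 1" "0 \<le> t" "t \<le> 1"
  shows "norm ((1 - t) *\<^sub>R a + t *\<^sub>R b) powr p \<le> (1 - t) * norm a powr p + t * norm b powr p"
proof -
  have le: "norm ((1 - t) *\<^sub>R a + t *\<^sub>R b) \<le> (1 - t) * norm a + t * norm b"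
    using norm_triangle_ineq[of "(1 - t) *\<^sub>R a" "t *\<^sub>R b"] assms by simp
  \<comment> \<open>Treats separately the case that one of the two norms is zero, through
    \<open>s powr p \<le> s\<close> on the unit interval.\<close>
  have sc: "(s * r) powr p \<le> s * r powr p" if "0 \<le> s" "s \<le> 1" for s r :: real
  proof -
    have "s powr p \<le> s"
      using that assms powr_mono'[of 1 p s] by simp
    then show ?thesis using that by (simp add: powr_mult mult_right_mono)
  qed
  have "((1 - t) * norm a + t * norm b) powr p \<le> (1 - t) * norm a powr p + t * norm b powr p"
  proof (cases "norm a = 0 \<or> norm b = 0")
    case True
    then show ?thesis using sc[of "1 - t" "norm a"] sc[of t "norm b"] assms by auto
  next
    case False
    then show ?thesis
      using convex_onD[OF powr_convex[OF assms(1)], of t "norm a" "norm b"] assms by auto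
  qed
  then show ?thesis using powr_mono2[OF _ _ le, of p] assms by auto
qed

lemma abs_inner_le: "norm a \<le> C \<Longrightarrow> \<bar>a \<bullet> b\<bar> \<le> C * norm b"
  by (meson Cauchy_Schwarz_ineq2 mult_right_mono norm_ge_zero order_trans)

text \<open>A C^1 function that is positive exactly on the positive half line. As
  \<open>test_fun\<close> asks only for a continuous gradient, all cutoffs and bumps below are built
  from it.\<close>

definition pos_sq :: "real \<Rightarrow> real" where "pos_sq t = (max 0 t)\<^sup>2"

lemma pos_sq_nonneg [simp]: "pos_sq t \<ge> 0"
  and pos_sq_eq_0_iff [simp]: "pos_sq t = 0 \<longleftrightarrow> t \<le> 0"
  and pos_sq_pos_iff [simp]: "pos_sq t > 0 \<longleftrightarrow> t > 0"
  by (auto simp: pos_sq_def max_def)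

lemma pos_sq_mono: "s \<le> t \<Longrightarrow> pos_sq s \<le> pos_sq t"
  by (auto simp: pos_sq_def intro!: power_mono)

lemma pos_sq_continuous [continuous_intros]:
  "continuous_on S f \<Longrightarrow> continuous_on S (\<lambda>x. pos_sq (f x))"
  unfolding pos_sq_def by (intro continuous_intros)

lemma pos_sq_borel [measurable]: "pos_sq \<in> borel_measurable borel"
  unfolding pos_sq_def by measurable

lemma pos_sq_deriv: "(pos_sq has_real_derivative 2 * max 0 t) (at t)"
proof -
  consider "t > 0" | "t < 0" | "t = 0" by linarith
  then show ?thesis
  proof cases
    case 1
    have "((\<lambda>t. t\<^sup>2) has_real_derivative 2 * max 0 t) (at t)"
      using 1 by (auto intro!: derivative_eq_intros)
    then show ?thesis
      by (rule has_field_derivative_transform_within_open[of _ _ _ "{0<..}"]) (use 1 in \<open>auto simp: pos_sq_def\<close>)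
  next
    case 2
    have "((\<lambda>t. 0) has_real_derivative 2 * max 0 t) (at t)"
      using 2 by (auto intro!: derivative_eq_intros)
    then show ?thesis
      by (rule has_field_derivative_transform_within_open[of _ _ _ "{..<0}"]) (use 2 in \<open>auto simp: pos_sq_def\<close>)
  next
    case 3
    have "(\<lambda>h. pos_sq h / h) \<midarrow>0\<rightarrow> 0"
    proof (rule Lim_null_comparison)
      show "\<forall>\<^sub>F h in at 0. norm (pos_sq h / h) \<le> \<bar>h\<bar>"
        by (rule always_eventually) (auto simp: pos_sq_def max_def power2_eq_square)
      show "((\<lambda>h::real. \<bar>h\<bar>) \<longlongrightarrow> 0) (at 0)"
        using tendsto_rabs_zero[OF tendsto_ident_at] by blast
    qed
    then show ?thesis using 3 by (simp add: DERIV_def pos_sq_def)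
  qed
qed

lemma pos_sq_has_derivative [derivative_intros]:
  assumes "(f has_derivative f') (at x within S)"
  shows "((\<lambda>x. pos_sq (f x)) has_derivative (\<lambda>h. 2 * max 0 (f x) * f' h)) (at x within S)"
  using has_derivative_compose[OF assms, of pos_sq "(*) (2 * max 0 (f x))"] pos_sq_deriv[of "f x"]
  by (simp add: has_field_derivative_def)

text \<open>Every open set is a countable union of balls; summing suitably weighted \<open>C\<^sup>1\<close> bumps on these
  balls gives \<open>d\<close>.\<close>

lemma smooth_distance:
  fixes U :: "'a::euclidean_space set"
  assumes "open U"
  obtains d dd where
    "\<And>x. (d has_derivative (\<lambda>h. dd x \<bullet> h)) (at x)" "continuous_on UNIV dd"
    "\<And>x. d x \<ge> 0" "\<And>x. d x > 0 \<longleftrightarrow> x \<in> U" "\<And>x. norm (dd x) \<le> 1"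
    "\<And>x y. \<bar>d x - d y\<bar> \<le> norm (x - y)"
proof (cases "U = {}")
  case True
  then show ?thesis using that[of "\<lambda>_. 0" "\<lambda>_. 0"] by auto
next
  case False
  define I where "I = {(x, r). 0 < r \<and> r \<le> 1 \<and> ball x r \<subseteq> U}"
  have "open S" if "S \<in> (\<lambda>(x,r). ball x r) ` I" for S :: "'a set" using that by auto
  then obtain G where G: "G \<subseteq> (\<lambda>(x,r). ball x r) ` I" "countable G" "\<Union>G = \<Union>((\<lambda>(x,r). ball x r) ` I)"
    using Lindelof[of "(\<lambda>(x,r). ball x r) ` I"] by metis
  have "U \<subseteq> \<Union>G"
  proof
    fix x assume "x \<in> U"
    then obtain e where "e > 0" "ball x e \<subseteq> U" using assms open_contains_ball by blast
    then have "(x, min e 1) \<in> I" by (auto simp: I_def)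
    moreover have "x \<in> ball x (min e 1)" using \<open>e > 0\<close> by simp
    ultimately show "x \<in> \<Union>G" unfolding G(3) by blast
  qed
  then have U: "U = \<Union>G" "G \<noteq> {}" using G(3) False by (auto simp: I_def)
  have "\<exists>a r. 0 < r \<and> r \<le> 1 \<and> from_nat_into G n = ball a r" for n
  proof -
    have "from_nat_into G n \<in> (\<lambda>(x,r). ball x r) ` I" using from_nat_into[OF U(2), of n] G(1) by blast
    then show ?thesis by (auto simp: I_def)
  qed
  then obtain a r where ar: "\<And>n. 0 < r n" "\<And>n. r n \<le> (1::real)" "\<And>n. from_nat_into G n = ball (a n) (r n)"
    by metis
  have Un: "U = (\<Union>n. ball (a n) (r n))"
    using U ar(3) range_from_nat_into[OF U(2) G(2)] by (metis (no_types, lifting) SUP_cong)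
  \<comment> \<open>Since the radii are at most 1, the gradient of the n-th bump is at most 1/8 *
    (1/2)^n * 2 * 2. The factor 1/8 makes these bounds add up to exactly 1, the Lipschitz constant
    wanted for \<open>d\<close>.\<close>
  define b where "b n x = (1/8) * (1/2)^n * pos_sq ((r n)\<^sup>2 - (x - a n) \<bullet> (x - a n))" for n x
  define db where "db n x = ((1/8) * (1/2)^n * (2 * max 0 ((r n)\<^sup>2 - (x - a n) \<bullet> (x - a n)))) *\<^sub>R ((-2) *\<^sub>R (x - a n))" for n x
  have b_deriv: "(b n has_derivative (\<lambda>h. db n x \<bullet> h)) (at x)" for n x
    unfolding b_def db_def
    by (rule has_derivative_eq_rhs, (rule derivative_intros)+) (auto simp: inner_commute algebra_simps)
  have db_cont: "continuous_on UNIV (db n)" for n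
    unfolding db_def by (intro continuous_intros)
  have r2: "(r n)\<^sup>2 \<le> 1" for n using ar(1,2)[of n] by (simp add: power_le_one)
  have b_nonneg: "b n x \<ge> 0" for n x by (simp add: b_def)
  have b_le: "b n x \<le> (1/2)^n" for n x
  proof -
    have "pos_sq ((r n)\<^sup>2 - (x - a n) \<bullet> (x - a n)) \<le> pos_sq 1"
      using r2[of n] by (intro pos_sq_mono) (meson diff_le_eq inner_ge_zero le_add_same_cancel1 order_trans)
    then show ?thesis by (simp add: b_def pos_sq_def)
  qed
  have db_le: "norm (db n x) \<le> (1/2)^n / 2" for n x
  proof (cases "(r n)\<^sup>2 - (x - a n) \<bullet> (x - a n) \<le> 0")
    case True
    then show ?thesis by (simp add: db_def max_def)
  next
    case False
    then have "(norm (x - a n))\<^sup>2 \<le> 1\<^sup>2" using r2[of n] by (simp add: power2_norm_eq_inner)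
    then have 1: "norm (x - a n) \<le> 1" by (simp add: power2_le_imp_le)
    have 2: "max 0 ((r n)\<^sup>2 - (x - a n) \<bullet> (x - a n)) \<le> 1"
      using r2[of n] inner_ge_zero[of "x - a n"] by linarith
    have "norm (db n x) = (1/8) * (1/2)^n * (2 * max 0 ((r n)\<^sup>2 - (x - a n) \<bullet> (x - a n))) * (2 * norm (x - a n))"
      by (simp add: db_def abs_mult)
    also have "\<dots> \<le> (1/8) * (1/2)^n * (2 * 1) * (2 * 1)"
      using 1 2 by (intro mult_mono) auto
    finally show ?thesis by simp
  qed
  have sumb: "summable (\<lambda>n. (1/2)^n :: real)" by (rule summable_geometric) simp
  have unif: "uniform_limit UNIV (\<lambda>n x. \<Sum>i<n. db i x) (\<lambda>x. \<Sum>i. db i x) sequentially"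
    by (rule Weierstrass_m_test[where M = "\<lambda>n. (1/2)^n / 2"]) (use db_le sumb in \<open>auto intro: summable_divide\<close>)
  define dd where "dd x = (\<Sum>i. db i x)" for x
  have dd_cont: "continuous_on UNIV dd"
    unfolding dd_def
    by (rule uniform_limit_theorem[OF _ unif]) (auto intro!: always_eventually continuous_on_sum db_cont)
  have bsum: "summable (\<lambda>n. b n x)" for x
    by (rule summable_comparison_test[OF _ sumb]) (use b_nonneg b_le in auto)
  have "\<exists>g. \<forall>x\<in>UNIV. (\<lambda>n. b n x) sums (g x) \<and> (g has_derivative (\<lambda>h. dd x \<bullet> h)) (at x within UNIV)"
  proof (rule has_derivative_series)
    show "(b n has_derivative (\<lambda>h. db n x \<bullet> h)) (at x within UNIV)" for n x by (rule b_deriv)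
    \<comment> \<open>Differentiating a series term by term requires convergence at one base point;
      any point serves.\<close>
    show "(\<lambda>n. b n undefined) sums (\<Sum>n. b n undefined)" using bsum by (rule summable_sums)
    fix e :: real assume "e > 0"
    from uniform_limitD[OF unif this]
    show "\<forall>\<^sub>F n in sequentially. \<forall>x\<in>UNIV. \<forall>h. norm ((\<Sum>i<n. db i x \<bullet> h) - dd x \<bullet> h) \<le> e * norm h"
    proof (rule eventually_mono, intro ballI allI)
      fix n x h assume "\<forall>x\<in>UNIV. dist (\<Sum>i<n. db i x) (\<Sum>i. db i x) < e"
      then have "norm ((\<Sum>i<n. db i x) - dd x) \<le> e" by (auto simp: dd_def dist_norm intro: less_imp_le)
      moreover have "norm ((\<Sum>i<n. db i x \<bullet> h) - dd x \<bullet> h) = \<bar>((\<Sum>i<n. db i x) - dd x) \<bullet> h\<bar>"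
        by (simp add: inner_diff_left inner_sum_left)
      ultimately show "norm ((\<Sum>i<n. db i x \<bullet> h) - dd x \<bullet> h) \<le> e * norm h"
        by (smt (verit) Cauchy_Schwarz_ineq2 mult_right_mono norm_ge_zero)
    qed
  qed auto
  then obtain d where d: "\<And>x. (\<lambda>n. b n x) sums (d x)" "\<And>x. (d has_derivative (\<lambda>h. dd x \<bullet> h)) (at x)"
    by auto
  have d_eq: "d x = (\<Sum>n. b n x)" for x using d(1) by (simp add: sums_iff)
  have dd_le: "norm (dd x) \<le> 1" for x
  proof -
    have "norm (dd x) \<le> (\<Sum>n. norm (db n x))"
      unfolding dd_def
      by (rule summable_norm, rule summable_comparison_test[OF _ summable_divide[OF sumb, of 2]])
        (use db_le in auto)
    also have "\<dots> \<le> (\<Sum>n. (1/2)^n / 2)"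
      by (intro suminf_le db_le summable_divide sumb summable_comparison_test[OF _ summable_divide[OF sumb, of 2]])
        (use db_le in auto)
    also have "\<dots> = (\<Sum>n. (1/2)^n) / 2" by (rule suminf_divide[OF sumb])
    also have "\<dots> = 1" by (subst suminf_geometric) auto
    finally show ?thesis .
  qed
  show ?thesis
  proof (rule that[OF d(2) dd_cont _ _ dd_le])
    fix x y :: 'a
    show "d x \<ge> 0" unfolding d_eq by (rule suminf_nonneg[OF bsum b_nonneg])
    have "d x > 0 \<longleftrightarrow> (\<exists>n. b n x > 0)"
      unfolding d_eq using suminf_pos_iff[OF bsum b_nonneg] by blast
    also have "\<dots> \<longleftrightarrow> (\<exists>n. (norm (x - a n))\<^sup>2 < (r n)\<^sup>2)"
      by (simp add: b_def power2_norm_eq_inner zero_less_mult_iff)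
    also have "\<dots> \<longleftrightarrow> (\<exists>n. x \<in> ball (a n) (r n))"
    proof -
      have "(norm z)\<^sup>2 < (r n)\<^sup>2 \<longleftrightarrow> norm z < r n" for z :: 'a and n
        using ar(1)[of n] by (meson less_imp_le norm_ge_zero power2_less_imp_less power_strict_mono zero_less_numeral)
      then show ?thesis by (simp add: dist_norm norm_minus_commute)
    qed
    finally show "d x > 0 \<longleftrightarrow> x \<in> U" unfolding Un by auto
    have "norm (d x - d y) \<le> 1 * norm (x - y)"
    proof (rule differentiable_bound[of UNIV d "\<lambda>x h. dd x \<bullet> h"])
      show "onorm (\<lambda>h. dd x \<bullet> h) \<le> 1" for x
        using abs_inner_le[OF dd_le] by (intro onorm_bound) simp_all
    qed (use d(2) in auto)
    then show "\<bar>d x - d y\<bar> \<le> norm (x - y)" by simp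
  qed
qed

text \<open>\<open>test_fun\<close> asks only the function to vanish off K. The complement of K is
  open, so the gradient vanishes there as well.\<close>

lemma test_fun_compact_support:
  assumes "test_fun \<Omega> \<phi> d\<phi>"
  obtains K where "compact K" "K \<subseteq> \<Omega>" "\<And>x. x \<notin> K \<Longrightarrow> \<phi> x = 0" "\<And>x. x \<notin> K \<Longrightarrow> d\<phi> x = 0"
proof -
  obtain K where K: "compact K" "K \<subseteq> \<Omega>" "\<And>x. x \<notin> K \<Longrightarrow> \<phi> x = 0"
    and d: "\<And>x. (\<phi> has_derivative (\<lambda>h. d\<phi> x \<bullet> h)) (at x)"
    using assms unfolding test_fun_def by blast
  have "d\<phi> x = 0" if "x \<notin> K" for x
  proof -
    have "((\<lambda>x. 0) has_derivative (\<lambda>h. d\<phi> x \<bullet> h)) (at x)"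
      by (rule has_derivative_transform_within_open[OF d, of "- K"])
        (use K that in \<open>auto simp: compact_imp_closed\<close>)
    then have "(\<lambda>h. d\<phi> x \<bullet> h) = (\<lambda>h. 0)"
      using has_derivative_unique has_derivative_const by blast
    then have "d\<phi> x \<bullet> d\<phi> x = 0" by metis
    then show ?thesis by simp
  qed
  with K show ?thesis using that by blast
qed

lemma compact_support_bounded:
  fixes f :: "'a::euclidean_space \<Rightarrow> 'b::real_normed_vector"
  assumes "continuous_on UNIV f" "compact K" "\<And>x. x \<notin> K \<Longrightarrow> f x = 0"
  obtains C where "C \<ge> 0" "\<And>x. norm (f x) \<le> C"
proof -
  have "compact (f ` K)" using assms compact_continuous_image continuous_on_subset by blast
  then obtain C where C: "\<forall>x\<in>f ` K. norm x \<le> C" "C > 0"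
    using compact_imp_bounded bounded_pos by blast
  then have "norm (f x) \<le> C" for x using assms(3)[of x] by (cases "x \<in> K") auto
  then show ?thesis using that[of C] C by auto
qed

lemma test_fun_bounded:
  assumes "test_fun \<Omega> \<phi> d\<phi>"
  obtains C where "C \<ge> 0" "\<And>x. \<bar>\<phi> x\<bar> \<le> C" "\<And>x. norm (d\<phi> x) \<le> C"
proof -
  obtain K where K: "compact K" "K \<subseteq> \<Omega>" "\<And>x. x \<notin> K \<Longrightarrow> \<phi> x = 0" "\<And>x. x \<notin> K \<Longrightarrow> d\<phi> x = 0"
    using test_fun_compact_support[OF assms] by blast
  have c: "continuous_on UNIV \<phi>" "continuous_on UNIV d\<phi>"
    using assms unfolding test_fun_def
    by (auto intro!: continuous_at_imp_continuous_on dest: has_derivative_continuous)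
  obtain A where "A \<ge> 0" "\<And>x. norm (\<phi> x) \<le> A" using compact_support_bounded[OF c(1) K(1,3)] by blast
  moreover obtain B where "B \<ge> 0" "\<And>x. norm (d\<phi> x) \<le> B" using compact_support_bounded[OF c(2) K(1,4)] by blast
  ultimately show ?thesis by (intro that[of "max A B"]) (auto simp: le_max_iff_disj)
qed

lemma test_fun_continuous:
  assumes "test_fun \<Omega> \<phi> d\<phi>"
  shows "continuous_on UNIV \<phi>" "continuous_on UNIV d\<phi>"
  using assms unfolding test_fun_def
  by (auto intro!: continuous_at_imp_continuous_on dest: has_derivative_continuous)

lemma test_fun_borel:
  assumes "test_fun \<Omega> \<phi> d\<phi>"
  shows "\<phi> \<in> borel_measurable borel" "d\<phi> \<in> borel_measurable borel"
  using test_fun_continuous[OF assms] by (auto intro: borel_measurable_continuous_onI)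

lemma lborel_integral_translate:
  fixes f :: "'a::euclidean_space \<Rightarrow> real"
  assumes [measurable]: "f \<in> borel_measurable borel"
  shows "(\<integral>x. f (c + x) \<partial>lborel) = (\<integral>x. f x \<partial>lborel)"
proof -
  have "(\<integral>x. f x \<partial>lborel) = (\<integral>x. f x \<partial>distr lborel borel ((+) c))"
    by (simp add: lborel_distr_plus)
  also have "\<dots> = (\<integral>x. f (c + x) \<partial>lborel)" by (subst integral_distr) auto
  finally show ?thesis by simp
qed

text \<open>Translation invariance: the difference quotients of \<open>\<phi>\<close> have integral zero.\<close>

lemma integral_test_fun_derivative:
  assumes T: "test_fun \<Omega> \<phi> d\<phi>"
  shows "(\<integral>x. d\<phi> x \<bullet> v \<partial>lborel) = 0"
proof -
  obtain K where K: "compact K" "K \<subseteq> \<Omega>" "\<And>x. x \<notin> K \<Longrightarrow> \<phi> x = 0" "\<And>x. x \<notin> K \<Longrightarrow> d\<phi> x = 0"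
    using test_fun_compact_support[OF T] by blast
  obtain C where C: "C \<ge> 0" "\<And>x. \<bar>\<phi> x\<bar> \<le> C" "\<And>x. norm (d\<phi> x) \<le> C"
    using test_fun_bounded[OF T] by blast
  have d: "(\<phi> has_derivative (\<lambda>h. d\<phi> x \<bullet> h)) (at x)" for x using T unfolding test_fun_def by blast
  note [measurable] = test_fun_borel[OF T]
  define q where "q n x = real (Suc n) * (\<phi> (x + (1 / real (Suc n)) *\<^sub>R v) - \<phi> x)" for n x
  have lip: "\<bar>\<phi> x - \<phi> y\<bar> \<le> C * norm (x - y)" for x y
  proof -
    have "norm (\<phi> x - \<phi> y) \<le> C * norm (x - y)"
    proof (rule differentiable_bound[of UNIV \<phi> "\<lambda>x h. d\<phi> x \<bullet> h"])
      show "onorm (\<lambda>h. d\<phi> x \<bullet> h) \<le> C" for x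
        using abs_inner_le[OF C(3)] by (intro onorm_bound[OF C(1)]) simp
    qed (use d in auto)
    then show ?thesis by simp
  qed
  obtain R where R: "\<And>x. x \<in> K \<Longrightarrow> norm x \<le> R"
    using compact_imp_bounded[OF K(1)] bounded_iff by blast
  \<comment> \<open>A dominating function for all quotients at once: the increments have length at
    most \<open>norm v\<close>, so every quotient is supported in the ball enlarged by that amount,
    and the Lipschitz bound controls its size.\<close>
  define W where "W x = indicator (cball 0 (R + norm v)) x * (C * norm v)" for x :: 'a
  have "compact (cball (0::'a) (R + norm v))" by simp
  then have "integrable lborel (indicator (cball (0::'a) (R + norm v)) :: 'a \<Rightarrow> real)"
    using emeasure_lborel_cball_finite by (simp add: integrable_indicator_iff)
  then have Wint: "integrable lborel W" unfolding W_def by (rule integrable_mult_left) 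
  have qW: "norm (q n x) \<le> W x" for n x
  proof (cases "norm x \<le> R + norm v")
    case True
    have "\<bar>q n x\<bar> = real (Suc n) * \<bar>\<phi> (x + (1 / real (Suc n)) *\<^sub>R v) - \<phi> x\<bar>"
      by (simp add: q_def abs_mult)
    also have "\<dots> \<le> real (Suc n) * (C * norm ((1 / real (Suc n)) *\<^sub>R v))"
      using lip[of "x + (1 / real (Suc n)) *\<^sub>R v" x] by (intro mult_left_mono) auto
    also have "\<dots> = C * norm v" by simp
    finally show ?thesis using True by (simp add: W_def)
  next
    case False
    have "norm ((1 / real (Suc n)) *\<^sub>R v) \<le> 1 * norm v"
      unfolding norm_scaleR by (intro mult_right_mono) auto
    then have "\<not> norm (x + (1 / real (Suc n)) *\<^sub>R v) \<le> R"
      using False norm_diff_ineq[of x "(1 / real (Suc n)) *\<^sub>R v"] by linarith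
    then have "\<phi> (x + (1 / real (Suc n)) *\<^sub>R v) = 0" using R K(3) by blast
    moreover have "\<phi> x = 0" using False R[of x] K(3)[of x] norm_ge_zero[of v] by force
    ultimately show ?thesis by (simp add: q_def W_def C(1))
  qed
  have lim: "(\<lambda>n. q n x) \<longlonglongrightarrow> d\<phi> x \<bullet> v" for x
  proof -
    have "((\<lambda>t::real. x + t *\<^sub>R v) has_derivative (\<lambda>t. t *\<^sub>R v)) (at 0)"
      by (auto intro!: derivative_eq_intros)
    moreover have "(\<phi> has_derivative (\<lambda>h. d\<phi> x \<bullet> h)) (at (x + 0 *\<^sub>R v))" using d by simp
    ultimately have "((\<lambda>t::real. \<phi> (x + t *\<^sub>R v)) has_derivative (\<lambda>t. d\<phi> x \<bullet> (t *\<^sub>R v))) (at 0)"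
      using has_derivative_compose by blast
    then have "((\<lambda>t::real. \<phi> (x + t *\<^sub>R v)) has_real_derivative (d\<phi> x \<bullet> v)) (at 0)"
      by (rule has_derivative_imp_has_field_derivative) simp
    then have "((\<lambda>t. (\<phi> (x + t *\<^sub>R v) - \<phi> x) / t) \<longlongrightarrow> d\<phi> x \<bullet> v) (at 0)"
      by (simp add: DERIV_def)
    moreover have "filterlim (\<lambda>n. 1 / real (Suc n)) (at 0) sequentially"
      unfolding filterlim_at using LIMSEQ_inverse_real_of_nat by (auto simp: inverse_eq_divide)
    ultimately have "(\<lambda>n. (\<phi> (x + (1 / real (Suc n)) *\<^sub>R v) - \<phi> x) / (1 / real (Suc n))) \<longlonglongrightarrow> d\<phi> x \<bullet> v"
      using filterlim_compose by blast
    then show ?thesis by (simp add: q_def mult.commute)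
  qed
  have "(\<lambda>n. \<integral>x. q n x \<partial>lborel) \<longlonglongrightarrow> (\<integral>x. d\<phi> x \<bullet> v \<partial>lborel)"
    by (rule integral_dominated_convergence[OF _ _ Wint]) (use lim qW in \<open>auto simp: q_def\<close>)
  moreover have "(\<integral>x. q n x \<partial>lborel) = 0" for n
  proof -
    have "compact K" by fact
    then have "integrable lborel (indicator (cball (0::'a) R) :: 'a \<Rightarrow> real)"
      using emeasure_lborel_cball_finite by (simp add: integrable_indicator_iff)
    then have "integrable lborel (\<lambda>x. indicator (cball (0::'a) R) x * C)" by (rule integrable_mult_left)
    then have i: "integrable lborel \<phi>"
      by (rule Bochner_Integration.integrable_bound)
        (use R K(3) C in \<open>auto simp: indicator_def split: if_splits\<close>)
    let ?c = "(1 / real (Suc n)) *\<^sub>R v"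
    have "integrable (distr lborel borel ((+) ?c)) \<phi>" using i by (simp add: lborel_distr_plus)
    then have "integrable lborel (\<lambda>x. \<phi> (?c + x))" by (subst (asm) integrable_distr_eq) auto
    then have "(\<integral>x. q n x \<partial>lborel) = real (Suc n) * ((\<integral>x. \<phi> (?c + x) \<partial>lborel) - (\<integral>x. \<phi> x \<partial>lborel))"
      unfolding q_def using i by (simp add: add.commute)
    then show ?thesis by (simp add: lborel_integral_translate)
  qed
  ultimately have "(\<lambda>n::nat. 0) \<longlonglongrightarrow> (\<integral>x. d\<phi> x \<bullet> v \<partial>lborel)" by simp
  then show ?thesis by (simp add: LIMSEQ_const_iff)
qed


section \<open>Products with test functions and integration by parts\<close>

lemma integrable_mult_bounded_real:
  fixes f \<phi> :: "'a \<Rightarrow> real"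
  assumes "integrable M f" "\<phi> \<in> borel_measurable M" "\<And>x. x \<in> space M \<Longrightarrow> \<bar>\<phi> x\<bar> \<le> C"
  shows "integrable M (\<lambda>x. f x * \<phi> x)"
proof (rule Bochner_Integration.integrable_bound[OF integrable_mult_left[OF assms(1), of C]])
  show "AE x in M. norm (f x * \<phi> x) \<le> norm (f x * C)"
  proof (rule AE_I2)
    fix x assume "x \<in> space M"
    then have "\<bar>\<phi> x\<bar> \<le> \<bar>C\<bar>" using assms(3) by fastforce
    then show "norm (f x * \<phi> x) \<le> norm (f x * C)" by (simp add: abs_mult mult_left_mono)
  qed
qed (use assms in measurable)

lemma integrable_vec_nth: "integrable M w \<Longrightarrow> integrable M (\<lambda>x. w x $ k)"
  for w :: "'a \<Rightarrow> ('b::euclidean_space)^'k"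
  by (rule integrable_bounded_linear[OF bounded_linear_vec_nth])

lemma borel_lebesgue_on: "f \<in> borel_measurable borel \<Longrightarrow> f \<in> borel_measurable (lebesgue_on S)"
  by (rule measurable_restrict_space1) (simp add: measurable_completion)

lemma integrable_test_fun_lebesgue_on:
  assumes "test_fun \<Omega> \<phi> d\<phi>" "integrable (lebesgue_on \<Omega>) f"
  shows "integrable (lebesgue_on \<Omega>) (\<lambda>x. f x * \<phi> x)" "integrable (lebesgue_on \<Omega>) (\<lambda>x. f x * (d\<phi> x \<bullet> b))"
proof -
  obtain C where C: "C \<ge> 0" "\<And>x. \<bar>\<phi> x\<bar> \<le> C" "\<And>x. norm (d\<phi> x) \<le> C"
    using test_fun_bounded[OF assms(1)] by blast
  note [measurable] = test_fun_borel[OF assms(1)]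
  show "integrable (lebesgue_on \<Omega>) (\<lambda>x. f x * \<phi> x)"
    by (rule integrable_mult_bounded_real[OF assms(2) borel_lebesgue_on C(2)]) measurable
  show "integrable (lebesgue_on \<Omega>) (\<lambda>x. f x * (d\<phi> x \<bullet> b))"
    by (rule integrable_mult_bounded_real[OF assms(2) borel_lebesgue_on abs_inner_le[OF C(3)]]) measurable
qed

text \<open>The factor w is differentiable in \<Omega> only. Extension of the product by zero is
  harmless because \<Omega> and the complement of the support of \<phi> are two open sets covering
  the space.\<close>

lemma test_fun_mult:
  assumes T: "test_fun \<Omega> \<phi> d\<phi>" and \<Omega>: "open \<Omega>"
    and w: "\<And>x. x \<in> \<Omega> \<Longrightarrow> (w has_derivative (\<lambda>h. g x \<bullet> h)) (at x)" and g: "continuous_on \<Omega> g"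
  shows "test_fun \<Omega> (\<lambda>x. if x \<in> \<Omega> then \<phi> x * w x else 0)
           (\<lambda>x. if x \<in> \<Omega> then \<phi> x *\<^sub>R g x + w x *\<^sub>R d\<phi> x else 0)"
    (is "test_fun _ ?\<psi> ?d")
proof -
  obtain K where K: "compact K" "K \<subseteq> \<Omega>" "\<And>x. x \<notin> K \<Longrightarrow> \<phi> x = 0" "\<And>x. x \<notin> K \<Longrightarrow> d\<phi> x = 0"
    using test_fun_compact_support[OF T] by blast
  have d: "\<And>x. (\<phi> has_derivative (\<lambda>h. d\<phi> x \<bullet> h)) (at x)" using T unfolding test_fun_def by blast
  have oK: "open (- K)" using K(1) by (simp add: compact_imp_closed open_Compl)
  have wc: "continuous_on \<Omega> w"
    using w by (intro continuous_at_imp_continuous_on) (auto dest: has_derivative_continuous)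
  have "continuous_on (\<Omega> \<union> - K) ?d"
  proof (rule continuous_on_open_Un[OF \<Omega> oK])
    have "continuous_on \<Omega> (\<lambda>x. \<phi> x *\<^sub>R g x + w x *\<^sub>R d\<phi> x)"
      by (intro continuous_intros wc g continuous_on_subset[OF test_fun_continuous(1)[OF T]]
          continuous_on_subset[OF test_fun_continuous(2)[OF T]]) auto
    then show "continuous_on \<Omega> ?d" by (rule continuous_on_eq) auto
    have "continuous_on (- K) (\<lambda>x. 0::'a)" by simp
    then show "continuous_on (- K) ?d" by (rule continuous_on_eq) (use K in auto)
  qed
  moreover have "\<Omega> \<union> - K = UNIV" using K(2) by auto
  ultimately have "continuous_on UNIV ?d" by simp
  moreover have "(?\<psi> has_derivative (\<lambda>h. ?d x \<bullet> h)) (at x)" for x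
  proof (cases "x \<in> \<Omega>")
    case True
    have "((\<lambda>x. \<phi> x * w x) has_derivative (\<lambda>h. ?d x \<bullet> h)) (at x)"
      by (rule has_derivative_eq_rhs, rule has_derivative_mult[OF d w[OF True]])
        (use True in \<open>auto simp: algebra_simps inner_add_left\<close>)
    then show ?thesis
      by (rule has_derivative_transform_within_open[OF _ \<Omega> True]) simp
  next
    case False
    then have x: "x \<in> - K" using K(2) by auto
    have "((\<lambda>x. 0) has_derivative (\<lambda>h. ?d x \<bullet> h)) (at x)" using False by simp
    then show ?thesis
      by (rule has_derivative_transform_within_open[OF _ oK x]) (use K(3) in auto)
  qed
  moreover have "\<forall>x. x \<notin> K \<longrightarrow> ?\<psi> x = 0" using K(3) by auto
  ultimately show ?thesis unfolding test_fun_def using K(1,2) by blast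
qed

lemma integral_lebesgue_on_eq_lborel:
  fixes f :: "'a::euclidean_space \<Rightarrow> real"
  assumes "\<Omega> \<in> sets borel" "f \<in> borel_measurable borel" "\<And>x. x \<notin> \<Omega> \<Longrightarrow> f x = 0"
  shows "(\<integral>x. f x \<partial>lebesgue_on \<Omega>) = (\<integral>x. f x \<partial>lborel)"
proof -
  have "(\<integral>x. f x \<partial>lebesgue_on \<Omega>) = (\<integral>x. indicator \<Omega> x *\<^sub>R f x \<partial>lebesgue)"
    by (rule integral_restrict_space) (use assms(1) in auto)
  also have "(\<lambda>x. indicator \<Omega> x *\<^sub>R f x) = f" using assms(3) by (auto simp: indicator_def fun_eq_iff)
  also have "(\<integral>x. f x \<partial>lebesgue) = (\<integral>x. f x \<partial>lborel)" by (rule integral_completion) (use assms in auto)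
  finally show ?thesis .
qed

lemma integrable_continuous_on_open:
  fixes g :: "'a::euclidean_space \<Rightarrow> 'b::euclidean_space"
  assumes "open \<Omega>" "continuous_on \<Omega> g"
  shows "g \<in> borel_measurable (lebesgue_on \<Omega>)"
  using assms by (intro continuous_imp_measurable_on_sets_lebesgue) auto

text \<open>Integration by parts without boundary terms: the product of \<phi> with a component of w
  is again a test function, and the integral of its partial derivative vanishes. The behaviour of w
  at the boundary enters only through integrability.\<close>

lemma weak_grad_classical:
  fixes w :: "real^'n \<Rightarrow> real^'m"
  assumes \<Omega>: "open \<Omega>"
    and w: "\<And>x. x \<in> \<Omega> \<Longrightarrow> (w has_derivative (\<lambda>h. g x *v h)) (at x)" and gc: "continuous_on \<Omega> g"
    and wi: "integrable (lebesgue_on \<Omega>) w" and gi: "integrable (lebesgue_on \<Omega>) g"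
  shows "weak_grad \<Omega> w g"
  unfolding weak_grad_def
proof (intro conjI allI impI)
  show "g \<in> Lp_on 1 \<Omega>" using gi by (simp add: Lp_on_1)
  fix \<phi> :: "real^'n \<Rightarrow> real" and d\<phi> k i
  assume T: "test_fun \<Omega> \<phi> d\<phi>"
  have wk: "((\<lambda>x. w x $ k) has_derivative (\<lambda>h. (g x $ k) \<bullet> h)) (at x)" if "x \<in> \<Omega>" for x
    using bounded_linear.has_derivative[OF bounded_linear_vec_nth w[OF that], of k]
    by (simp add: matrix_vector_mul_component)
  let ?d = "\<lambda>x. if x \<in> \<Omega> then \<phi> x *\<^sub>R (g x $ k) + (w x $ k) *\<^sub>R d\<phi> x else 0"
  have T': "test_fun \<Omega> (\<lambda>x. if x \<in> \<Omega> then \<phi> x * w x $ k else 0) ?d"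
    by (rule test_fun_mult[OF T \<Omega> wk]) (auto intro!: continuous_intros gc)
  have "0 = (\<integral>x. ?d x \<bullet> axis i 1 \<partial>lborel)" using integral_test_fun_derivative[OF T'] by simp
  also have "\<dots> = (\<integral>x. ?d x \<bullet> axis i 1 \<partial>lebesgue_on \<Omega>)"
    by (rule integral_lebesgue_on_eq_lborel[symmetric])
      (use \<Omega> test_fun_borel(2)[OF T'] in \<open>auto intro: borel_measurable_inner\<close>)
  also have "\<dots> = (\<integral>x. g x $ k $ i * \<phi> x + w x $ k * (d\<phi> x \<bullet> axis i 1) \<partial>lebesgue_on \<Omega>)"
    by (rule Bochner_Integration.integral_cong) (auto simp: inner_add_left inner_axis algebra_simps)
  also have "\<dots> = (\<integral>x. g x $ k $ i * \<phi> x \<partial>lebesgue_on \<Omega>) + (\<integral>x. w x $ k * (d\<phi> x \<bullet> axis i 1) \<partial>lebesgue_on \<Omega>)"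
    by (intro Bochner_Integration.integral_add integrable_test_fun_lebesgue_on[OF T] integrable_vec_nth gi wi)
  finally show "(\<integral>x. w x $ k * d\<phi> x $ i \<partial>lebesgue_on \<Omega>) = - (\<integral>x. g x $ k $ i * \<phi> x \<partial>lebesgue_on \<Omega>)"
    by (simp add: inner_axis)
qed

lemma weak_grad_lincomb:
  fixes v w :: "real^'n \<Rightarrow> real^'m"
  assumes v: "weak_grad \<Omega> v g" "v \<in> Lp_on 1 \<Omega>" and w: "weak_grad \<Omega> w h" "w \<in> Lp_on 1 \<Omega>"
  shows "weak_grad \<Omega> (\<lambda>x. a *\<^sub>R v x + b *\<^sub>R w x) (\<lambda>x. a *\<^sub>R g x + b *\<^sub>R h x)"
proof -
  have i: "integrable (lebesgue_on \<Omega>) v" "integrable (lebesgue_on \<Omega>) w"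
    "integrable (lebesgue_on \<Omega>) g" "integrable (lebesgue_on \<Omega>) h"
    using assms by (auto simp: weak_grad_def Lp_on_1)
  show ?thesis
    unfolding weak_grad_def
  proof (intro conjI allI impI)
    show "(\<lambda>x. a *\<^sub>R g x + b *\<^sub>R h x) \<in> Lp_on 1 \<Omega>" using i by (simp add: Lp_on_1)
    fix \<phi> :: "real^'n \<Rightarrow> real" and d\<phi> k i assume T: "test_fun \<Omega> \<phi> d\<phi>"
    note I = integrable_test_fun_lebesgue_on(2)[OF T integrable_vec_nth[OF i(1), of k], where b = "axis i 1"]
      integrable_test_fun_lebesgue_on(2)[OF T integrable_vec_nth[OF i(2), of k], where b = "axis i 1"]
      integrable_test_fun_lebesgue_on(1)[OF T integrable_vec_nth[OF integrable_vec_nth[OF i(3), of k], of i]]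
      integrable_test_fun_lebesgue_on(1)[OF T integrable_vec_nth[OF integrable_vec_nth[OF i(4), of k], of i]]
    have "(\<integral>x. (a *\<^sub>R v x + b *\<^sub>R w x) $ k * d\<phi> x $ i \<partial>lebesgue_on \<Omega>)
        = a * (\<integral>x. v x $ k * d\<phi> x $ i \<partial>lebesgue_on \<Omega>) + b * (\<integral>x. w x $ k * d\<phi> x $ i \<partial>lebesgue_on \<Omega>)"
      using I by (simp add: inner_axis algebra_simps)
    also have "\<dots> = - (a * (\<integral>x. g x $ k $ i * \<phi> x \<partial>lebesgue_on \<Omega>) + b * (\<integral>x. h x $ k $ i * \<phi> x \<partial>lebesgue_on \<Omega>))"
      using v(1) w(1) T by (simp add: weak_grad_def)
    also have "\<dots> = - (\<integral>x. (a *\<^sub>R g x + b *\<^sub>R h x) $ k $ i * \<phi> x \<partial>lebesgue_on \<Omega>)"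
      using I by (simp add: algebra_simps)
    finally show "(\<integral>x. (a *\<^sub>R v x + b *\<^sub>R w x) $ k * d\<phi> x $ i \<partial>lebesgue_on \<Omega>)
      = - (\<integral>x. (a *\<^sub>R g x + b *\<^sub>R h x) $ k $ i * \<phi> x \<partial>lebesgue_on \<Omega>)" .
  qed
qed

lemma test_fun_borel_on:
  assumes "test_fun \<Omega> \<phi> d\<phi>" "sets \<nu> = sets (restrict_space borel \<Omega>)"
  shows "\<phi> \<in> borel_measurable \<nu>"
  using measurable_restrict_space1[OF test_fun_borel(1)[OF assms(1)], of \<Omega>]
  by (simp add: measurable_cong_sets[OF assms(2) refl])

lemma integrable_test_fun_measure:
  assumes "test_fun \<Omega> \<phi> d\<phi>" "sets \<nu> = sets (restrict_space borel \<Omega>)" "integrable \<nu> f"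
  shows "integrable \<nu> (\<lambda>x. f x * \<phi> x)"
proof -
  obtain C where C: "C \<ge> 0" "\<And>x. \<bar>\<phi> x\<bar> \<le> C" "\<And>x. norm (d\<phi> x) \<le> C"
    using test_fun_bounded[OF assms(1)] by blast
  show ?thesis by (rule integrable_mult_bounded_real[OF assms(3) test_fun_borel_on[OF assms(1,2)] C(2)])
qed

text \<open>Adding a Sobolev function leaves the singular measure alone, so \<nu> is kept and only
  its density is scaled. This computes K along a segment from a BV function to a Sobolev
  function.\<close>

lemma bv_repr_lincomb:
  fixes v w :: "real^'n \<Rightarrow> real^'m"
  assumes v: "bv_repr \<Omega> v (g, \<nu>, h)" "v \<in> Lp_on 1 \<Omega>" and w: "weak_grad \<Omega> w p" "w \<in> Lp_on 1 \<Omega>"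
  shows "bv_repr \<Omega> (\<lambda>x. a *\<^sub>R v x + b *\<^sub>R w x) (\<lambda>x. a *\<^sub>R g x + b *\<^sub>R p x, \<nu>, \<lambda>x. a *\<^sub>R h x)"
proof -
  have i: "integrable (lebesgue_on \<Omega>) v" "integrable (lebesgue_on \<Omega>) w"
    "integrable (lebesgue_on \<Omega>) g" "integrable (lebesgue_on \<Omega>) p" "integrable \<nu> h"
    and \<nu>: "sets \<nu> = sets (restrict_space borel \<Omega>)"
    using assms by (auto simp: weak_grad_def bv_repr_def Lp_on_1)
  have "(\<integral>x. (a *\<^sub>R v x + b *\<^sub>R w x) $ k * d\<phi> x $ i \<partial>lebesgue_on \<Omega>) =
      - ((\<integral>x. (a *\<^sub>R g x + b *\<^sub>R p x) $ k $ i * \<phi> x \<partial>lebesgue_on \<Omega>)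
       + (\<integral>x. (a *\<^sub>R h x) $ k $ i * \<phi> x \<partial>\<nu>))"
    if T: "test_fun \<Omega> \<phi> d\<phi>" for \<phi> d\<phi> k i
  proof -
    note I = integrable_test_fun_lebesgue_on(2)[OF T integrable_vec_nth[OF i(1), of k], where b = "axis i 1"]
      integrable_test_fun_lebesgue_on(2)[OF T integrable_vec_nth[OF i(2), of k], where b = "axis i 1"]
      integrable_test_fun_lebesgue_on(1)[OF T integrable_vec_nth[OF integrable_vec_nth[OF i(3), of k], of i]]
      integrable_test_fun_lebesgue_on(1)[OF T integrable_vec_nth[OF integrable_vec_nth[OF i(4), of k], of i]]
      integrable_test_fun_measure[OF T \<nu> integrable_vec_nth[OF integrable_vec_nth[OF i(5), of k], of i]]
    have "(\<integral>x. (a *\<^sub>R v x + b *\<^sub>R w x) $ k * d\<phi> x $ i \<partial>lebesgue_on \<Omega>)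
        = a * (\<integral>x. v x $ k * d\<phi> x $ i \<partial>lebesgue_on \<Omega>) + b * (\<integral>x. w x $ k * d\<phi> x $ i \<partial>lebesgue_on \<Omega>)"
      using I by (simp add: inner_axis algebra_simps)
    also have "(\<integral>x. v x $ k * d\<phi> x $ i \<partial>lebesgue_on \<Omega>)
        = - ((\<integral>x. g x $ k $ i * \<phi> x \<partial>lebesgue_on \<Omega>) + (\<integral>x. h x $ k $ i * \<phi> x \<partial>\<nu>))"
      using v(1) T by (simp add: bv_repr_def)
    also have "(\<integral>x. w x $ k * d\<phi> x $ i \<partial>lebesgue_on \<Omega>) = - (\<integral>x. p x $ k $ i * \<phi> x \<partial>lebesgue_on \<Omega>)"
      using w(1) T by (simp add: weak_grad_def)
    finally show ?thesis using I by (simp add: algebra_simps)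
  qed
  moreover have "integrable (lebesgue_on \<Omega>) (\<lambda>x. a *\<^sub>R g x + b *\<^sub>R p x)" "integrable \<nu> (\<lambda>x. a *\<^sub>R h x)"
    using i by simp_all
  ultimately show ?thesis using v(1) unfolding bv_repr_def Lp_on_1 prod.case by blast
qed

section \<open>Uniqueness of the decomposition of the gradient measure\<close>

lemma integral_mult_indicator_limit:
  fixes f :: "'a \<Rightarrow> real"
  assumes f: "integrable M f" and \<phi>: "\<And>j. \<phi> j \<in> borel_measurable M" "\<And>j x. \<bar>\<phi> j x\<bar> \<le> 1"
    and lim: "\<And>x. x \<in> space M \<Longrightarrow> (\<lambda>j. \<phi> j x) \<longlonglongrightarrow> indicator B x"
  shows "(\<lambda>j. \<integral>x. f x * \<phi> j x \<partial>M) \<longlonglongrightarrow> (\<integral>x. f x * indicator B x \<partial>M)"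
proof (rule integral_dominated_convergence[where w = "\<lambda>x. norm (f x)"])
  note [measurable] = f \<phi>(1)
  have "(\<lambda>x. indicator B x :: real) \<in> borel_measurable M"
    by (rule borel_measurable_LIMSEQ_real[OF lim \<phi>(1)])
  then show "(\<lambda>x. f x * indicator B x) \<in> borel_measurable M" by measurable
  show "(\<lambda>x. f x * \<phi> j x) \<in> borel_measurable M" for j by measurable
  show "AE x in M. (\<lambda>j. f x * \<phi> j x) \<longlonglongrightarrow> f x * indicator B x"
    by (intro AE_I2 tendsto_intros lim)
  show "AE x in M. norm (f x * \<phi> j x) \<le> norm (f x)" for j
    using \<phi>(2)[of j] by (intro AE_I2) (simp add: abs_mult mult_left_le)
qed (use f in simp)

text \<open>The set where \<open>real (Suc j) * d x \<ge> 1\<close> is compact inside U and exhausts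
  U as j grows; the map p / (1 + p) keeps the values in the unit interval and saturates to 1
  wherever d is positive.\<close>

lemma test_fun_indicator_approx:
  fixes U :: "'a::euclidean_space set"
  assumes "open U" "bounded U" "U \<subseteq> \<Omega>"
  obtains \<phi> d\<phi> where "\<And>j::nat. test_fun \<Omega> (\<phi> j) (d\<phi> j)" "\<And>j x. \<bar>\<phi> j x\<bar> \<le> 1"
    "\<And>x. (\<lambda>j. \<phi> j x) \<longlonglongrightarrow> indicator U x"
proof -
  obtain d dd where d: "\<And>x. (d has_derivative (\<lambda>h. dd x \<bullet> h)) (at x)" "continuous_on UNIV dd"
    "\<And>x. d x \<ge> 0" "\<And>x. d x > 0 \<longleftrightarrow> x \<in> U"
    by (rule smooth_distance[OF assms(1)]) blast
  define p where "p j x = pos_sq (real (Suc j) * d x - 1)" for j x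
  define \<phi> where "\<phi> j x = p j x / (1 + p j x)" for j x
  define d\<phi> where "d\<phi> j x = ((2 * max 0 (real (Suc j) * d x - 1) * real (Suc j)) / (1 + p j x)\<^sup>2) *\<^sub>R dd x" for j x
  have p0: "p j x \<ge> 0" for j x by (simp add: p_def)
  have p1: "1 + p j x > 0" for j x using p0[of j x] by linarith
  have dc: "continuous_on UNIV d"
    by (rule continuous_at_imp_continuous_on) (use d(1) has_derivative_continuous in blast)
  show ?thesis
  proof (rule that[of \<phi> d\<phi>])
    fix j x
    show "test_fun \<Omega> (\<phi> j) (d\<phi> j)"
      unfolding test_fun_def
    proof (intro conjI allI exI[of _ "{x. 1 \<le> real (Suc j) * d x}"] impI)
      have "1 + p j x \<noteq> 0" for x using p1[of j x] by linarith
      then show "continuous_on UNIV (d\<phi> j)"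
        unfolding d\<phi>_def by (intro continuous_intros dc d(2)) (auto simp: p_def intro!: continuous_intros dc)
      fix x
      have "(p j has_derivative (\<lambda>h. 2 * max 0 (real (Suc j) * d x - 1) * (real (Suc j) * (dd x \<bullet> h)))) (at x)"
        unfolding p_def by (rule has_derivative_eq_rhs, (rule derivative_intros d(1))+) auto
      from has_derivative_divide'[OF this has_derivative_add[OF has_derivative_const[of 1] this]]
      show "(\<phi> j has_derivative (\<lambda>h. d\<phi> j x \<bullet> h)) (at x)"
        unfolding \<phi>_def d\<phi>_def using p1[of j x]
        by (auto simp: field_simps power2_eq_square elim!: has_derivative_eq_rhs)
    next
      have sub: "{x. 1 \<le> real (Suc j) * d x} \<subseteq> U"
      proof
        fix x assume "x \<in> {x. 1 \<le> real (Suc j) * d x}"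
        then have "d x \<noteq> 0" by auto
        then show "x \<in> U" using d(3,4)[of x] by auto
      qed
      moreover have "closed {x. 1 \<le> real (Suc j) * d x}"
        by (intro closed_Collect_le continuous_intros dc)
      ultimately show "compact {x. 1 \<le> real (Suc j) * d x}"
        using assms(2) bounded_subset compact_eq_bounded_closed by blast
      show "{x. 1 \<le> real (Suc j) * d x} \<subseteq> \<Omega>" using sub assms(3) by blast
    next
      fix x assume "x \<notin> {x. 1 \<le> real (Suc j) * d x}"
      then show "\<phi> j x = 0" by (simp add: \<phi>_def p_def)
    qed
    show "\<bar>\<phi> j x\<bar> \<le> 1" using p0[of j x] p1[of j x] by (simp add: \<phi>_def)
  next
    fix x
    show "(\<lambda>j. \<phi> j x) \<longlonglongrightarrow> indicator U x"
    proof (cases "x \<in> U")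
      case True
      then have dx: "d x > 0" using d(4) by simp
      have "filterlim (\<lambda>j. real (Suc j) * d x) at_top sequentially"
        by (rule filterlim_at_top_mult_tendsto_pos[OF tendsto_const dx])
          (use filterlim_real_sequentially filterlim_sequentially_Suc in blast)
      then have "filterlim (\<lambda>j. -1 + real (Suc j) * d x) at_top sequentially"
        by (rule filterlim_tendsto_add_at_top[OF tendsto_const])
      then have 1: "filterlim (\<lambda>j. real (Suc j) * d x - 1) at_top sequentially" by simp
      then have "\<forall>\<^sub>F j in sequentially. real (Suc j) * d x - 1 \<ge> 1" unfolding filterlim_at_top by blast
      then have "\<forall>\<^sub>F j in sequentially. real (Suc j) * d x - 1 \<le> p j x"
      proof (rule eventually_mono)
        fix j assume "real (Suc j) * d x - 1 \<ge> 1"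
        then show "real (Suc j) * d x - 1 \<le> p j x"
          unfolding p_def pos_sq_def power2_eq_square by (simp add: max_def mult_le_cancel_right1)
      qed
      then have "filterlim (\<lambda>j. p j x) at_top sequentially" by (rule filterlim_at_top_mono[OF 1])
      then have "filterlim (\<lambda>j. 1 + p j x) at_top sequentially"
        by (rule filterlim_tendsto_add_at_top[OF tendsto_const])
      then have "(\<lambda>j. 1 - inverse (1 + p j x)) \<longlonglongrightarrow> 1 - 0"
        by (intro tendsto_intros tendsto_inverse_0_at_top)
      moreover have "1 - inverse (1 + p j x) = \<phi> j x" for j
        using p1[of j x] by (simp add: \<phi>_def field_simps)
      ultimately show ?thesis using True by simp
    next
      case False
      then have "d x = 0" using d(3,4)[of x] by (simp add: order_less_le)
      then have "\<phi> j x = 0" for j by (simp add: \<phi>_def p_def)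
      then show ?thesis using False by simp
    qed
  qed
qed

text \<open>A fundamental lemma for a signed combination of measures. Approximation by test
  functions settles open sets, which are stable under intersection and generate the Borel sets; a
  Dynkin argument does the rest. Dominated convergence replaces monotonicity, as the densities have
  no sign.\<close>

lemma zero_distribution_set_integral:
  fixes \<Omega> :: "'a::euclidean_space set"
  assumes \<Omega>: "open \<Omega>" "bounded \<Omega>" and f: "integrable (lebesgue_on \<Omega>) f"
    and \<nu>: "sets \<nu>1 = sets (restrict_space borel \<Omega>)" "sets \<nu>2 = sets (restrict_space borel \<Omega>)"
    and h: "integrable \<nu>1 h1" "integrable \<nu>2 h2"
    and zero: "\<And>\<phi> d\<phi>. test_fun \<Omega> \<phi> d\<phi> \<Longrightarrow>
      (\<integral>x. f x * \<phi> x \<partial>lebesgue_on \<Omega>) + (\<integral>x. h1 x * \<phi> x \<partial>\<nu>1) - (\<integral>x. h2 x * \<phi> x \<partial>\<nu>2) = (0::real)"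
    and B: "B \<in> sets borel"
  shows "(\<integral>x. f x * indicator B x \<partial>lebesgue_on \<Omega>) + (\<integral>x. h1 x * indicator B x \<partial>\<nu>1)
    - (\<integral>x. h2 x * indicator B x \<partial>\<nu>2) = 0"
proof -
  define L where "L \<phi> = (\<integral>x. f x * \<phi> x \<partial>lebesgue_on \<Omega>) + (\<integral>x. h1 x * \<phi> x \<partial>\<nu>1)
    - (\<integral>x. h2 x * \<phi> x \<partial>\<nu>2)" for \<phi>
  have sp: "space \<nu>1 = \<Omega>" "space \<nu>2 = \<Omega>" using \<nu>[THEN sets_eq_imp_space_eq] by (auto simp: space_restrict_space)
  have borel: "\<phi> \<in> borel_measurable \<nu>1" "\<phi> \<in> borel_measurable \<nu>2" "\<phi> \<in> borel_measurable (lebesgue_on \<Omega>)"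
    if "\<phi> \<in> borel_measurable borel" for \<phi> :: "'a \<Rightarrow> real"
    using measurable_restrict_space1[OF that, of \<Omega>] borel_lebesgue_on[OF that]
    by (simp_all add: measurable_cong_sets[OF \<nu>(1) refl] measurable_cong_sets[OF \<nu>(2) refl])
  have limit: "(\<lambda>j. L (\<phi> j)) \<longlonglongrightarrow> L (indicator B)"
    if "\<And>j. \<phi> j \<in> borel_measurable borel" "\<And>j x. \<bar>\<phi> j x\<bar> \<le> 1"
      "\<And>x. x \<in> \<Omega> \<Longrightarrow> (\<lambda>j. \<phi> j x) \<longlonglongrightarrow> indicator B x" for \<phi> B
    unfolding L_def
    by (intro tendsto_intros integral_mult_indicator_limit f h borel that) (use that sp in auto)
  have int: "integrable (lebesgue_on \<Omega>) (\<lambda>x. f x * indicator A x)" "integrable \<nu>1 (\<lambda>x. h1 x * indicator A x)"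
    "integrable \<nu>2 (\<lambda>x. h2 x * indicator A x)" if [measurable]: "A \<in> sets borel" for A
    by (rule integrable_mult_bounded_real[where C = 1], use that f h in \<open>auto intro: borel simp: indicator_def\<close>)+
  have L_open: "L (indicator U) = 0" if U: "open U" for U
  proof -
    obtain \<phi> d\<phi> where \<phi>: "\<And>j::nat. test_fun \<Omega> (\<phi> j) (d\<phi> j)" "\<And>j x. \<bar>\<phi> j x\<bar> \<le> 1"
      "\<And>x. (\<lambda>j. \<phi> j x) \<longlonglongrightarrow> indicator (U \<inter> \<Omega>) x"
      using test_fun_indicator_approx[of "U \<inter> \<Omega>" \<Omega>] U \<Omega> by (metis Int_lower2 bounded_subset open_Int)
    have "(\<lambda>j. L (\<phi> j)) \<longlonglongrightarrow> L (indicator U)"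
    proof (rule limit)
      show "(\<lambda>j. \<phi> j x) \<longlonglongrightarrow> indicator U x" if "x \<in> \<Omega>" for x
        using \<phi>(3)[of x] that by (simp add: indicator_def)
    qed (use \<phi>(1,2) test_fun_borel in blast)+
    moreover have "L (\<phi> j) = 0" for j unfolding L_def by (rule zero[OF \<phi>(1)])
    ultimately have "(\<lambda>j::nat. 0) \<longlonglongrightarrow> L (indicator U)" by simp
    then show ?thesis by (simp add: LIMSEQ_const_iff)
  qed
  have Bs: "B \<in> sigma_sets UNIV {S. open S}" using B by (simp add: borel_def)
  have G: "Int_stable {S :: 'a set. open S}" "{S :: 'a set. open S} \<subseteq> Pow UNIV"
    by (auto simp: Int_stable_def)
  \<comment> \<open>Membership in the Borel sets is carried through the induction because splitting
    the integrals at complements and unions needs integrability on the pieces.\<close>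
  have "B \<in> sets borel \<and> L (indicator B) = 0"
    using G Bs
  proof (induction rule: sigma_sets_induct_disjoint)
    case (compl A)
    have "L (indicator (UNIV - A)) = L (indicator UNIV) - L (indicator A)"
    proof -
      have "g x * indicator (UNIV - A) x = g x * indicator UNIV x - g x * indicator A x" for g :: "'a \<Rightarrow> real" and x
        by (simp add: indicator_def)
      then show ?thesis
        unfolding L_def using int[of A] int[of UNIV] compl by simp
    qed
    then show ?case using L_open[of UNIV] compl sets.Diff[of UNIV borel A] by simp
  next
    case (union A)
    define S where "S n = (\<Union>i<n. A i)" for n :: nat
    have Sb: "S n \<in> sets borel" for n unfolding S_def using union by auto
    have L0: "L (indicator (S n)) = 0" for n
    proof (induction n)
      case 0
      then show ?case by (simp add: S_def L_def)
    next
      case (Suc n)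
      have "A n \<inter> A i = {}" if "i < n" for i
        using union(1) that by (auto simp: disjoint_family_on_def)
      then have "A n \<inter> S n = {}" by (auto simp: S_def)
      then have "g x * indicator (S (Suc n)) x = g x * indicator (S n) x + g x * indicator (A n) x"
        for g :: "'a \<Rightarrow> real" and x
        by (auto simp: S_def lessThan_Suc indicator_def)
      then have "L (indicator (S (Suc n))) = L (indicator (S n)) + L (indicator (A n))"
        unfolding L_def using int[OF Sb[of n]] int[of "A n"] union by simp
      then show ?case using Suc union by simp
    qed
    have "(\<lambda>n. L (indicator (S n))) \<longlonglongrightarrow> L (indicator (\<Union> (range A)))"
    proof (rule limit)
      show "(\<lambda>j. indicator (S j) x :: real) \<longlonglongrightarrow> indicator (\<Union> (range A)) x" for x
        unfolding S_def by (rule LIMSEQ_indicator_UN)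
    qed (use Sb in \<open>auto simp: indicator_def\<close>)
    then show ?case using L0 union sets.countable_UN[of A UNIV borel] by (auto simp: LIMSEQ_const_iff)
  qed (use L_open in \<open>auto simp: Int_stable_def L_def\<close>)
  then show ?thesis by (simp add: L_def)
qed

lemma lebesgue_on_AE_zero:
  fixes f :: "'a::euclidean_space \<Rightarrow> real"
  assumes \<Omega>: "open \<Omega>" "bounded \<Omega>" and f: "integrable (lebesgue_on \<Omega>) f"
    and zero: "\<And>B. B \<in> sets borel \<Longrightarrow> (\<integral>x. f x * indicator B x \<partial>lebesgue_on \<Omega>) = 0"
  shows "AE x in lebesgue_on \<Omega>. f x = 0"
proof -
  have "\<Omega> \<in> lmeasurable" using \<Omega> by (simp add: bounded_set_imp_lmeasurable)
  then interpret finite_measure "lebesgue_on \<Omega>" by (rule finite_measure_lebesgue_on)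
  show ?thesis
  proof (rule density_zero[OF f])
    fix A assume "A \<in> sets (lebesgue_on \<Omega>)"
    then have "A \<in> sets lebesgue" using \<Omega> by (auto simp: sets_restrict_space)
    \<comment> \<open>The hypothesis speaks of Borel sets only, but \<open>density_zero\<close>
      tests all Lebesgue sets; the two differ by the null set T.\<close>
    then obtain C T where C: "fsigma C" "T \<in> null_sets lebesgue" "C \<union> T = A" "disjnt C T"
      using lebesgue_set_almost_fsigma by blast
    have Cb: "C \<in> sets borel" using C(1) by (auto elim!: fsigma.cases)
    have "AE x in lebesgue. x \<notin> T" using C(2) by (rule AE_not_in)
    then have "AE x in lebesgue_on \<Omega>. x \<notin> T"
      by (subst AE_restrict_space_iff) (use \<Omega> in auto)
    then have "AE x in lebesgue_on \<Omega>. indicator A x *\<^sub>R f x = f x * indicator C x"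
      by eventually_elim (use C(3) in \<open>auto simp: indicator_def\<close>)
    then have "(LINT x:A|lebesgue_on \<Omega>. f x) = (\<integral>x. f x * indicator C x \<partial>lebesgue_on \<Omega>)"
      unfolding set_lebesgue_integral_def
      by (rule integral_cong_AE[rotated 2])
        (use \<open>A \<in> sets (lebesgue_on \<Omega>)\<close> f borel_lebesgue_on[of "indicator C"] Cb in \<open>auto intro!: borel_measurable_times borel_measurable_scaleR\<close>)
    then show "(LINT x:A|lebesgue_on \<Omega>. f x) = 0" using zero[OF Cb] by simp
  qed
qed

text \<open>Since the two singular measures live on a Lebesgue null set \<open>N\<close>, a Borel set splits into its
  parts inside and outside \<open>N\<close>.\<close>

lemma zero_distribution_split:
  fixes \<Omega> :: "'a::euclidean_space set"
  assumes \<Omega>: "open \<Omega>" "bounded \<Omega>" and f: "integrable (lebesgue_on \<Omega>) f"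
    and \<nu>: "sets \<nu>1 = sets (restrict_space borel \<Omega>)" "sets \<nu>2 = sets (restrict_space borel \<Omega>)"
    and h: "integrable \<nu>1 h1" "integrable \<nu>2 h2"
    and N1: "N1 \<in> sets \<nu>1" "emeasure lebesgue N1 = 0" "emeasure \<nu>1 (\<Omega> - N1) = 0"
    and N2: "N2 \<in> sets \<nu>2" "emeasure lebesgue N2 = 0" "emeasure \<nu>2 (\<Omega> - N2) = 0"
    and zero: "\<And>\<phi> d\<phi>. test_fun \<Omega> \<phi> d\<phi> \<Longrightarrow>
      (\<integral>x. f x * \<phi> x \<partial>lebesgue_on \<Omega>) + (\<integral>x. h1 x * \<phi> x \<partial>\<nu>1) - (\<integral>x. h2 x * \<phi> x \<partial>\<nu>2) = (0::real)"
  shows "AE x in lebesgue_on \<Omega>. f x = 0"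
    and "\<And>B. B \<in> sets borel \<Longrightarrow> (\<integral>x. h1 x * indicator B x \<partial>\<nu>1) = (\<integral>x. h2 x * indicator B x \<partial>\<nu>2)"
proof -
  define N where "N = N1 \<union> N2"
  have \<Omega>b: "\<Omega> \<in> sets borel" using \<Omega> by simp
  have N12b: "N1 \<in> sets borel" "N2 \<in> sets borel"
    using N1(1) N2(1) \<Omega>b unfolding \<nu> by (auto simp: sets_restrict_space)
  then have Nb: "N \<in> sets borel" by (simp add: N_def)
  have sp: "space \<nu>1 = \<Omega>" "space \<nu>2 = \<Omega>" using \<nu>[THEN sets_eq_imp_space_eq] by (auto simp: space_restrict_space)
  have "AE x in lebesgue. x \<notin> N"
    using N1(2) N2(2) N12b unfolding N_def by (intro AE_not_in null_sets.Un) auto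
  then have AEl: "AE x in lebesgue_on \<Omega>. x \<notin> N"
    by (subst AE_restrict_space_iff) (use \<Omega> in auto)
  have "AE x in \<nu>1. x \<notin> \<Omega> - N1"
    using N1 sp by (intro AE_not_in null_setsI) (metis sets.compl_sets)+
  then have AE1: "AE x in \<nu>1. x \<in> N" by (rule AE_mp) (use sp in \<open>auto simp: N_def\<close>)
  have "AE x in \<nu>2. x \<notin> \<Omega> - N2"
    using N2 sp by (intro AE_not_in null_setsI) (metis sets.compl_sets)+
  then have AE2: "AE x in \<nu>2. x \<in> N" by (rule AE_mp) (use sp in \<open>auto simp: N_def\<close>)
  have borel: "\<phi> \<in> borel_measurable \<nu>1" "\<phi> \<in> borel_measurable \<nu>2" "\<phi> \<in> borel_measurable (lebesgue_on \<Omega>)"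
    if "\<phi> \<in> borel_measurable borel" for \<phi> :: "'a \<Rightarrow> real"
    using measurable_restrict_space1[OF that, of \<Omega>] borel_lebesgue_on[OF that]
    by (simp_all add: measurable_cong_sets[OF \<nu>(1) refl] measurable_cong_sets[OF \<nu>(2) refl])
  have ind: "(indicator B :: 'a \<Rightarrow> real) \<in> borel_measurable borel" if "B \<in> sets borel" for B using that by simp
  note meas = borel_measurable_times[OF borel_measurable_integrable[OF f] borel(3)[OF ind]]
    borel_measurable_times[OF borel_measurable_integrable[OF h(1)] borel(1)[OF ind]]
    borel_measurable_times[OF borel_measurable_integrable[OF h(2)] borel(2)[OF ind]]
  have *: "(\<integral>x. f x * indicator B x \<partial>lebesgue_on \<Omega>) = 0 \<and>
      (\<integral>x. h1 x * indicator B x \<partial>\<nu>1) = (\<integral>x. h2 x * indicator B x \<partial>\<nu>2)" if B: "B \<in> sets borel" for B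
  proof
    have BN: "B - N \<in> sets borel" "B \<inter> N \<in> sets borel" using B Nb by auto
    have "(\<integral>x. f x * indicator (B - N) x \<partial>lebesgue_on \<Omega>) = (\<integral>x. f x * indicator B x \<partial>lebesgue_on \<Omega>)"
      by (rule integral_cong_AE[OF meas(1)[OF BN(1)] meas(1)[OF B]], use AEl in eventually_elim) (auto simp: indicator_def)
    moreover have "(\<integral>x. h1 x * indicator (B - N) x \<partial>\<nu>1) = (\<integral>x. 0 \<partial>\<nu>1)"
      by (rule integral_cong_AE[OF meas(2)[OF BN(1)] borel_measurable_const], use AE1 in eventually_elim) (auto simp: indicator_def)
    moreover have "(\<integral>x. h2 x * indicator (B - N) x \<partial>\<nu>2) = (\<integral>x. 0 \<partial>\<nu>2)"
      by (rule integral_cong_AE[OF meas(3)[OF BN(1)] borel_measurable_const], use AE2 in eventually_elim) (auto simp: indicator_def)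
    ultimately show "(\<integral>x. f x * indicator B x \<partial>lebesgue_on \<Omega>) = 0"
      using zero_distribution_set_integral[OF \<Omega> f \<nu> h zero BN(1)] by simp
    have "(\<integral>x. f x * indicator (B \<inter> N) x \<partial>lebesgue_on \<Omega>) = (\<integral>x. 0 \<partial>lebesgue_on \<Omega>)"
      by (rule integral_cong_AE[OF meas(1)[OF BN(2)] borel_measurable_const], use AEl in eventually_elim) (auto simp: indicator_def)
    moreover have "(\<integral>x. h1 x * indicator (B \<inter> N) x \<partial>\<nu>1) = (\<integral>x. h1 x * indicator B x \<partial>\<nu>1)"
      by (rule integral_cong_AE[OF meas(2)[OF BN(2)] meas(2)[OF B]], use AE1 in eventually_elim) (auto simp: indicator_def)
    moreover have "(\<integral>x. h2 x * indicator (B \<inter> N) x \<partial>\<nu>2) = (\<integral>x. h2 x * indicator B x \<partial>\<nu>2)"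
      by (rule integral_cong_AE[OF meas(3)[OF BN(2)] meas(3)[OF B]], use AE2 in eventually_elim) (auto simp: indicator_def)
    ultimately show "(\<integral>x. h1 x * indicator B x \<partial>\<nu>1) = (\<integral>x. h2 x * indicator B x \<partial>\<nu>2)"
      using zero_distribution_set_integral[OF \<Omega> f \<nu> h zero BN(2)] by simp
  qed
  show "AE x in lebesgue_on \<Omega>. f x = 0" by (rule lebesgue_on_AE_zero[OF \<Omega> f]) (use * in blast)
  show "\<And>B. B \<in> sets borel \<Longrightarrow> (\<integral>x. h1 x * indicator B x \<partial>\<nu>1) = (\<integral>x. h2 x * indicator B x \<partial>\<nu>2)"
    using * by blast
qed

text \<open>The sum of the two measures dominates both, so that they get densities with respect to
  one common measure. \<open>absolutely_continuous M M1\<close> means that null sets of M are null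
  for M1.\<close>

lemma sum_measure_exists:
  assumes "sets M1 = sets M2" "finite_measure M1" "finite_measure M2"
  obtains M where "sets M = sets M1" "finite_measure M" "absolutely_continuous M M1" "absolutely_continuous M M2"
proof -
  define \<mu> where "\<mu> A = emeasure M1 A + emeasure M2 A" for A
  define M where "M = measure_of (space M1) (sets M1) \<mu>"
  have s: "sets M = sets M1" "space M = space M1" by (simp_all add: M_def sets.space_closed sets.sigma_sets_eq)
  have ca: "countably_additive (sets M1) \<mu>"
  proof (rule countably_additiveI)
    fix A :: "nat \<Rightarrow> 'a set" assume A: "range A \<subseteq> sets M1" "disjoint_family A" "(\<Union>i. A i) \<in> sets M1"
    then show "(\<Sum>i. \<mu> (A i)) = \<mu> (\<Union>i. A i)"
      unfolding \<mu>_def using assms(1) by (simp add: suminf_emeasure suminf_add[symmetric])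
  qed
  have em: "emeasure M A = \<mu> A" if "A \<in> sets M1" for A
    unfolding M_def by (rule emeasure_measure_of_sigma[OF sets.sigma_algebra_axioms _ ca that])
      (simp add: positive_def \<mu>_def)
  show ?thesis
  proof (rule that[OF s(1)])
    show "finite_measure M"
    proof (rule finite_measureI)
      have "space M2 = space M1" using assms(1) sets_eq_imp_space_eq by metis
      then show "emeasure M (space M) \<noteq> \<infinity>"
        using em[of "space M1"] s(2) finite_measure.emeasure_finite[OF assms(2), of "space M1"]
          finite_measure.emeasure_finite[OF assms(3), of "space M1"] by (simp add: \<mu>_def)
    qed
    show "absolutely_continuous M M1" "absolutely_continuous M M2"
      using em unfolding absolutely_continuous_def null_sets_def s \<mu>_def assms(1) by auto
  qed
qed

text \<open>The hypothesis says that h1 \<nu>1 and h2 \<nu>2 are the same vector measure. With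
  densities \<rho>1, \<rho>2 relative to a common measure, \<rho>1 h1 = \<rho>2 h2 almost
  everywhere, and homogeneity allows \<Psi> to absorb the densities.\<close>

lemma homogeneous_integral_eq:
  fixes h1 h2 :: "'x \<Rightarrow> 'a::euclidean_space" and \<Psi> :: "'a \<Rightarrow> real"
  assumes fin: "finite_measure \<nu>1" "finite_measure \<nu>2" and s: "sets \<nu>1 = sets \<nu>2"
    and h: "integrable \<nu>1 h1" "integrable \<nu>2 h2"
    and eq: "\<And>b B. b \<in> Basis \<Longrightarrow> B \<in> sets \<nu>1 \<Longrightarrow>
      (\<integral>x. (h1 x \<bullet> b) * indicator B x \<partial>\<nu>1) = (\<integral>x. (h2 x \<bullet> b) * indicator B x \<partial>\<nu>2)"
    and \<Psi>[measurable]: "\<Psi> \<in> borel_measurable borel" and hom: "\<And>c P. c \<ge> 0 \<Longrightarrow> \<Psi> (c *\<^sub>R P) = c * \<Psi> P"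
  shows "(\<integral>x. \<Psi> (h1 x) \<partial>\<nu>1) = (\<integral>x. \<Psi> (h2 x) \<partial>\<nu>2)"
proof -
  obtain M where M: "sets M = sets \<nu>1" "finite_measure M" "absolutely_continuous M \<nu>1" "absolutely_continuous M \<nu>2"
    using sum_measure_exists[OF s fin] by blast
  interpret M: finite_measure M by (rule M)
  have dens: "\<exists>\<rho>. \<rho> \<in> borel_measurable M \<and> (\<forall>x. 0 \<le> \<rho> x) \<and> \<nu> = density M (\<lambda>x. ennreal (\<rho> x))"
    if \<nu>: "finite_measure \<nu>" "absolutely_continuous M \<nu>" "sets \<nu> = sets M" for \<nu>
  proof -
    obtain D where D: "D \<in> borel_measurable M" "AE x in M. RN_deriv M \<nu> x = ennreal (D x)" "\<And>x. 0 \<le> D x"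
      using M.real_RN_deriv[OF \<nu>] by metis
    have "\<nu> = density M (RN_deriv M \<nu>)" using M.density_RN_deriv[OF \<nu>(2,3)] by simp
    also have "\<dots> = density M (\<lambda>x. ennreal (D x))"
      by (rule density_cong) (use D in auto)
    finally show ?thesis using D by blast
  qed
  obtain \<rho>1 where \<rho>1[measurable]: "\<rho>1 \<in> borel_measurable M" and \<rho>1': "\<And>x. 0 \<le> \<rho>1 x" "\<nu>1 = density M (\<lambda>x. ennreal (\<rho>1 x))"
    using dens[OF fin(1) M(3)] M(1) by metis
  obtain \<rho>2 where \<rho>2[measurable]: "\<rho>2 \<in> borel_measurable M" and \<rho>2': "\<And>x. 0 \<le> \<rho>2 x" "\<nu>2 = density M (\<lambda>x. ennreal (\<rho>2 x))"
    using dens[OF fin(2) M(4)] M(1) s by metis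
  have hm: "h1 \<in> borel_measurable M" "h2 \<in> borel_measurable M"
    using borel_measurable_integrable[OF h(1)] borel_measurable_integrable[OF h(2)] M(1) s
    by (simp_all add: measurable_cong_sets[OF M(1) refl] measurable_cong_sets[OF s refl])
  note [measurable] = hm
  have i: "integrable M (\<lambda>x. \<rho>1 x *\<^sub>R h1 x)" "integrable M (\<lambda>x. \<rho>2 x *\<^sub>R h2 x)"
    using h \<rho>1' \<rho>2' by (simp_all add: integrable_density)
  have "AE x in M. \<forall>b\<in>Basis. (\<rho>1 x *\<^sub>R h1 x) \<bullet> b = (\<rho>2 x *\<^sub>R h2 x) \<bullet> b"
  proof (rule AE_finite_allI[OF finite_Basis])
    fix b :: 'a assume b: "b \<in> Basis"
    have ib: "integrable M (\<lambda>x. (\<rho>1 x *\<^sub>R h1 x) \<bullet> b)" "integrable M (\<lambda>x. (\<rho>2 x *\<^sub>R h2 x) \<bullet> b)"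
      using i by (auto simp del: inner_scaleR_left)
    show "AE x in M. (\<rho>1 x *\<^sub>R h1 x) \<bullet> b = (\<rho>2 x *\<^sub>R h2 x) \<bullet> b"
    proof (rule M.density_unique_banach[OF ib])
      fix A assume A[measurable]: "A \<in> sets M"
      have 1: "(\<integral>x. (h1 x \<bullet> b) * indicator A x \<partial>\<nu>1) = (\<integral>x. \<rho>1 x *\<^sub>R ((h1 x \<bullet> b) * indicator A x) \<partial>M)"
        unfolding \<rho>1'(2) by (rule integral_density) (use \<rho>1' in auto)
      have 2: "(\<integral>x. (h2 x \<bullet> b) * indicator A x \<partial>\<nu>2) = (\<integral>x. \<rho>2 x *\<^sub>R ((h2 x \<bullet> b) * indicator A x) \<partial>M)"
        unfolding \<rho>2'(2) by (rule integral_density) (use \<rho>2' in auto)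
      show "(LINT x:A|M. (\<rho>1 x *\<^sub>R h1 x) \<bullet> b) = (LINT x:A|M. (\<rho>2 x *\<^sub>R h2 x) \<bullet> b)"
        using eq[OF b, of A] A M(1) 1 2 by (simp add: set_lebesgue_integral_def mult_ac)
    qed
  qed
  then have ae: "AE x in M. \<Psi> (\<rho>1 x *\<^sub>R h1 x) = \<Psi> (\<rho>2 x *\<^sub>R h2 x)"
  proof eventually_elim
    case (elim x)
    then have "\<rho>1 x *\<^sub>R h1 x = \<rho>2 x *\<^sub>R h2 x" using euclidean_eqI by blast
    then show ?case by simp
  qed
  have "(\<integral>x. \<Psi> (h1 x) \<partial>\<nu>1) = (\<integral>x. \<rho>1 x *\<^sub>R \<Psi> (h1 x) \<partial>M)"
    unfolding \<rho>1'(2) by (rule integral_density) (use \<rho>1' in auto)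
  also have "\<dots> = (\<integral>x. \<Psi> (\<rho>1 x *\<^sub>R h1 x) \<partial>M)" by (simp add: hom \<rho>1')
  also have "\<dots> = (\<integral>x. \<Psi> (\<rho>2 x *\<^sub>R h2 x) \<partial>M)" by (rule integral_cong_AE) (use ae in auto)
  also have "\<dots> = (\<integral>x. \<rho>2 x *\<^sub>R \<Psi> (h2 x) \<partial>M)" by (simp add: hom \<rho>2')
  also have "\<dots> = (\<integral>x. \<Psi> (h2 x) \<partial>\<nu>2)"
    unfolding \<rho>2'(2) by (rule integral_density[symmetric]) (use \<rho>2' in auto)
  finally show ?thesis .
qed

text \<open>Makes quantities defined through \<open>bv_choice\<close> computable from any
  decomposition at hand. For the singular part only homogeneous integrands give a well-defined
  integral, since \<nu> and h may be rescaled against each other.\<close>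

lemma bv_repr_unique:
  fixes w :: "real^'n \<Rightarrow> real^'m"
  assumes \<Omega>: "open \<Omega>" "bounded \<Omega>"
    and r: "bv_repr \<Omega> w (g1, \<nu>1, h1)" "bv_repr \<Omega> w (g2, \<nu>2, h2)"
  shows "AE x in lebesgue_on \<Omega>. g1 x = g2 x"
    and "\<And>\<Psi> :: real^'n^'m \<Rightarrow> real. \<Psi> \<in> borel_measurable borel \<Longrightarrow> (\<And>c P. c \<ge> 0 \<Longrightarrow> \<Psi> (c *\<^sub>R P) = c * \<Psi> P) \<Longrightarrow>
      (\<integral>x. \<Psi> (h1 x) \<partial>\<nu>1) = (\<integral>x. \<Psi> (h2 x) \<partial>\<nu>2)"
proof -
  have i: "integrable (lebesgue_on \<Omega>) g1" "integrable \<nu>1 h1" "integrable (lebesgue_on \<Omega>) g2" "integrable \<nu>2 h2"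
    and \<nu>: "sets \<nu>1 = sets (restrict_space borel \<Omega>)" "sets \<nu>2 = sets (restrict_space borel \<Omega>)"
    and fin: "finite_measure \<nu>1" "finite_measure \<nu>2"
    using r by (auto simp: bv_repr_def Lp_on_1)
  obtain N1 where N1: "N1 \<in> sets \<nu>1" "emeasure lebesgue N1 = 0" "emeasure \<nu>1 (\<Omega> - N1) = 0"
    using r(1) unfolding bv_repr_def prod.case by blast
  obtain N2 where N2: "N2 \<in> sets \<nu>2" "emeasure lebesgue N2 = 0" "emeasure \<nu>2 (\<Omega> - N2) = 0"
    using r(2) unfolding bv_repr_def prod.case by blast
  have zero: "(\<integral>x. (g1 x $ k $ i - g2 x $ k $ i) * \<phi> x \<partial>lebesgue_on \<Omega>)
      + (\<integral>x. h1 x $ k $ i * \<phi> x \<partial>\<nu>1) - (\<integral>x. h2 x $ k $ i * \<phi> x \<partial>\<nu>2) = 0"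
    if T: "test_fun \<Omega> \<phi> d\<phi>" for \<phi> d\<phi> k i
  proof -
    note I = integrable_test_fun_lebesgue_on(1)[OF T integrable_vec_nth[OF integrable_vec_nth[OF i(1), of k], of i]]
      integrable_test_fun_lebesgue_on(1)[OF T integrable_vec_nth[OF integrable_vec_nth[OF i(3), of k], of i]]
    have "(\<integral>x. w x $ k * d\<phi> x $ i \<partial>lebesgue_on \<Omega>)
        = - ((\<integral>x. g1 x $ k $ i * \<phi> x \<partial>lebesgue_on \<Omega>) + (\<integral>x. h1 x $ k $ i * \<phi> x \<partial>\<nu>1))"
      "(\<integral>x. w x $ k * d\<phi> x $ i \<partial>lebesgue_on \<Omega>)
        = - ((\<integral>x. g2 x $ k $ i * \<phi> x \<partial>lebesgue_on \<Omega>) + (\<integral>x. h2 x $ k $ i * \<phi> x \<partial>\<nu>2))"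
      using r T unfolding bv_repr_def prod.case by blast+
    then show ?thesis using I by (simp add: left_diff_distrib)
  qed
  have split: "AE x in lebesgue_on \<Omega>. g1 x $ k $ i - g2 x $ k $ i = 0"
    "\<And>B. B \<in> sets borel \<Longrightarrow> (\<integral>x. h1 x $ k $ i * indicator B x \<partial>\<nu>1) = (\<integral>x. h2 x $ k $ i * indicator B x \<partial>\<nu>2)"
    for k i
    by (rule zero_distribution_split[OF \<Omega> _ \<nu> _ _ N1 N2 zero];
        (assumption | intro Bochner_Integration.integrable_diff integrable_vec_nth i))+
  have "AE x in lebesgue_on \<Omega>. \<forall>k\<in>UNIV. \<forall>i\<in>UNIV. g1 x $ k $ i - g2 x $ k $ i = 0"
    by (intro AE_finite_allI finite split(1))
  then show "AE x in lebesgue_on \<Omega>. g1 x = g2 x"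
    by (rule AE_mp) (auto simp: vec_eq_iff)
  fix \<Psi> :: "real^'n^'m \<Rightarrow> real"
  assume \<Psi>: "\<Psi> \<in> borel_measurable borel" "\<And>c P. c \<ge> 0 \<Longrightarrow> \<Psi> (c *\<^sub>R P) = c * \<Psi> P"
  show "(\<integral>x. \<Psi> (h1 x) \<partial>\<nu>1) = (\<integral>x. \<Psi> (h2 x) \<partial>\<nu>2)"
  proof (rule homogeneous_integral_eq[OF fin _ i(2,4) _ \<Psi>])
    fix b :: "real^'n^'m" and B assume b: "b \<in> Basis" and B: "B \<in> sets \<nu>1"
    obtain k i where "b = axis k (axis i 1)" using b by (auto simp: Basis_vec_def)
    then have "P \<bullet> b = P $ k $ i" for P by (simp add: inner_axis)
    moreover have "B \<in> sets borel" using B \<Omega> unfolding \<nu> by (auto simp: sets_restrict_space)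
    ultimately show "(\<integral>x. (h1 x \<bullet> b) * indicator B x \<partial>\<nu>1) = (\<integral>x. (h2 x \<bullet> b) * indicator B x \<partial>\<nu>2)"
      using split(2) by simp
  qed (use \<nu> in auto)
qed

text \<open>A weak gradient is a BV decomposition whose singular measure is zero, so uniqueness is
  inherited.\<close>

lemma weak_grad_unique:
  fixes w :: "real^'n \<Rightarrow> real^'m"
  assumes \<Omega>: "open \<Omega>" "bounded \<Omega>" and g: "weak_grad \<Omega> w g1" "weak_grad \<Omega> w g2"
  shows "AE x in lebesgue_on \<Omega>. g1 x = g2 x"
proof -
  have "bv_repr \<Omega> w (g, null_measure (restrict_space borel \<Omega>), \<lambda>_. 0)" if "weak_grad \<Omega> w g" for g
  proof -
    have "finite_measure (null_measure (restrict_space borel \<Omega>))" by (rule finite_measureI) simp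
    moreover have "\<exists>N\<in>sets (null_measure (restrict_space borel \<Omega>)). emeasure lebesgue N = 0 \<and>
        emeasure (null_measure (restrict_space borel \<Omega>)) (\<Omega> - N) = 0"
      by (rule bexI[of _ "{}"]) simp_all
    ultimately show ?thesis
      using that unfolding bv_repr_def weak_grad_def prod.case
      by (simp only: space_null_measure sets_null_measure space_restrict_space space_borel Int_UNIV_right
          integral_null_measure zero_index mult_zero_left integral_zero add_0_right
          integrable_zero simp_thms) blast
  qed
  then show ?thesis using bv_repr_unique(1)[OF \<Omega>] g by blast
qed

section \<open>Integrals depending on a parameter and mollifiers\<close>

lemma compact_param_uniform:
  fixes f :: "'a::euclidean_space \<times> 'b::euclidean_space \<Rightarrow> 'c::real_normed_vector"
  assumes "open \<Omega>" "x0 \<in> \<Omega>" "compact C" "continuous_on (\<Omega> \<times> UNIV) f" "e > 0"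
  obtains \<eta> where "\<eta> > 0" "cball x0 \<eta> \<subseteq> \<Omega>"
    "\<And>x y. x \<in> cball x0 \<eta> \<Longrightarrow> y \<in> C \<Longrightarrow> norm (f (x, y) - f (x0, y)) \<le> e"
proof -
  obtain r where r: "r > 0" "cball x0 r \<subseteq> \<Omega>"
    using assms(1,2) open_contains_cball by blast
  have "uniformly_continuous_on (cball x0 r \<times> C) f"
    by (rule compact_uniformly_continuous[OF continuous_on_subset[OF assms(4)]])
      (use r assms(3) in \<open>auto intro: compact_Times\<close>)
  then obtain d where d: "d > 0"
    "\<And>p q. p \<in> cball x0 r \<times> C \<Longrightarrow> q \<in> cball x0 r \<times> C \<Longrightarrow> dist q p < d \<Longrightarrow> dist (f q) (f p) < e"
    unfolding uniformly_continuous_on_def using assms(5) by metis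
  show ?thesis
  proof (rule that[of "min r (d/2)"])
    show "cball x0 (min r (d/2)) \<subseteq> \<Omega>" using r by auto
    fix x y assume "x \<in> cball x0 (min r (d/2))" "y \<in> C"
    then have "dist (f (x, y)) (f (x0, y)) < e"
      using d(1) r(1) by (intro d(2)) (auto simp: dist_Pair_Pair dist_commute)
    then show "norm (f (x, y) - f (x0, y)) \<le> e" by (simp add: dist_norm)
  qed (use r d in auto)
qed

lemma integrable_scaleR_bounded:
  fixes u :: "'a \<Rightarrow> 'c::{banach, second_countable_topology}"
  assumes "integrable M u" "f \<in> borel_measurable M" "\<And>x. x \<in> space M \<Longrightarrow> \<bar>f x\<bar> \<le> C"
  shows "integrable M (\<lambda>x. f x *\<^sub>R u x)"
proof (rule Bochner_Integration.integrable_bound[OF integrable_mult_right[OF integrable_norm[OF assms(1)], of C]])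
  show "AE x in M. norm (f x *\<^sub>R u x) \<le> norm (C * norm (u x))"
  proof (rule AE_I2)
    fix x assume "x \<in> space M"
    then have "\<bar>f x\<bar> \<le> \<bar>C\<bar>" using assms(3) by fastforce
    then show "norm (f x *\<^sub>R u x) \<le> norm (C * norm (u x))" by (simp add: abs_mult mult_right_mono)
  qed
qed (use assms in measurable)

text \<open>The kernels are integrated both against Lebesgue measure on \<Omega> and against the
  singular measure \<nu>, whose sigma-algebras differ. The locale keeps what they share: Borel
  functions are measurable, and all points lie in a compact set, on which continuous kernels are
  bounded.\<close>

locale borel_carrier =
  fixes M :: "'a::euclidean_space measure" and C :: "'a set"
  assumes ident_meas: "(\<lambda>x. x) \<in> M \<rightarrow>\<^sub>M borel" and compact_C: "compact C" and space_C: "space M \<subseteq> C"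
begin

lemma borel_meas: "f \<in> borel_measurable borel \<Longrightarrow> f \<in> borel_measurable M"
  by (rule measurable_compose[OF ident_meas])

lemma integrable_continuous_scaleR:
  fixes u :: "'a \<Rightarrow> 'c::euclidean_space" and f :: "'a \<Rightarrow> real"
  assumes "continuous_on UNIV f" "integrable M u"
  shows "integrable M (\<lambda>y. f y *\<^sub>R u y)"
proof -
  have "compact (f ` C)" using compact_continuous_image continuous_on_subset assms(1) compact_C by blast
  from compact_imp_bounded[OF this] obtain B where "\<forall>z\<in>f ` C. norm z \<le> B"
    unfolding bounded_iff by (elim exE)
  then have "\<And>y. y \<in> C \<Longrightarrow> norm (f y) \<le> B" by simp
  then show ?thesis
    by (intro integrable_scaleR_bounded[OF assms(2), of f B] borel_meas borel_measurable_continuous_onI assms(1))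
      (use space_C in auto)
qed

lemma continuous_slice:
  assumes "continuous_on (\<Omega> \<times> UNIV) (\<lambda>(x, y). f x y)" "x \<in> \<Omega>"
  shows "continuous_on UNIV (f x)"
  using continuous_on_compose2[OF assms(1), of UNIV "\<lambda>y. (x, y)"] assms(2)
    continuous_on_Pair[OF continuous_on_const continuous_on_id, of UNIV x] by auto

lemma continuous_on_integral_param:
  fixes u :: "'a \<Rightarrow> 'c::euclidean_space" and f :: "'b::euclidean_space \<Rightarrow> 'a \<Rightarrow> real"
  assumes \<Omega>: "open \<Omega>" and f: "continuous_on (\<Omega> \<times> UNIV) (\<lambda>(x, y). f x y)" and u: "integrable M u"
  shows "continuous_on \<Omega> (\<lambda>x. \<integral>y. f x y *\<^sub>R u y \<partial>M)"
  unfolding continuous_on_iff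
proof (intro ballI allI impI)
  fix x0 and e :: real assume x0: "x0 \<in> \<Omega>" and e: "e > 0"
  define I where "I = (\<integral>y. norm (u y) \<partial>M)"
  have I: "I \<ge> 0" by (simp add: I_def)
  \<comment> \<open>I + 1 in place of I covers the case that u vanishes almost everywhere.\<close>
  have ei: "e / (2 * (I + 1)) > 0" using e I by auto
  obtain \<eta> where \<eta>: "\<eta> > 0" "cball x0 \<eta> \<subseteq> \<Omega>"
    "\<And>x y. x \<in> cball x0 \<eta> \<Longrightarrow> y \<in> C \<Longrightarrow> norm (f x y - f x0 y) \<le> e / (2 * (I + 1))"
    using compact_param_uniform[OF \<Omega> x0 compact_C f ei] by auto
  have "dist (\<integral>y. f x y *\<^sub>R u y \<partial>M) (\<integral>y. f x0 y *\<^sub>R u y \<partial>M) < e" if x: "x \<in> \<Omega>" "dist x x0 < \<eta>" for x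
  proof -
    have i: "integrable M (\<lambda>y. f x y *\<^sub>R u y)" "integrable M (\<lambda>y. f x0 y *\<^sub>R u y)"
      using x x0 by (auto intro!: integrable_continuous_scaleR continuous_slice[OF f] u)
    have "dist (\<integral>y. f x y *\<^sub>R u y \<partial>M) (\<integral>y. f x0 y *\<^sub>R u y \<partial>M) = norm (\<integral>y. (f x y - f x0 y) *\<^sub>R u y \<partial>M)"
      using i by (simp add: dist_norm scaleR_diff_left)
    also have "\<dots> \<le> (\<integral>y. e / (2 * (I + 1)) * norm (u y) \<partial>M)"
    proof (rule Bochner_Integration.integral_norm_bound_integral)
      show "integrable M (\<lambda>y. (f x y - f x0 y) *\<^sub>R u y)" using i by (simp add: scaleR_diff_left)
      fix y assume "y \<in> space M"
      then have "norm (f x y - f x0 y) \<le> e / (2 * (I + 1))"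
        using x space_C by (intro \<eta>(3)) (auto simp: dist_commute)
      then show "norm ((f x y - f x0 y) *\<^sub>R u y) \<le> e / (2 * (I + 1)) * norm (u y)"
        unfolding norm_scaleR real_norm_def by (rule mult_right_mono) simp
    qed (use u in simp)
    also have "\<dots> = e * (I / (2 * (I + 1)))" by (simp add: I_def)
    also have "\<dots> < e * 1" using I e by (intro mult_strict_left_mono) (auto simp: divide_less_eq)
    finally show ?thesis by simp
  qed
  then show "\<exists>d>0. \<forall>x\<in>\<Omega>. dist x x0 < d \<longrightarrow> dist (\<integral>y. f x y *\<^sub>R u y \<partial>M) (\<integral>y. f x0 y *\<^sub>R u y \<partial>M) < e"
    using \<eta>(1) by blast
qed

text \<open>Compactness of C makes dk continuous in x uniformly in y. The mean value inequality then
  bounds the remainder of the kernel uniformly in y, and u needs only to be integrable.\<close>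

lemma has_derivative_integral_param:
  fixes u :: "'a \<Rightarrow> 'c::euclidean_space" and k :: "'b::euclidean_space \<Rightarrow> 'a \<Rightarrow> real"
  assumes \<Omega>: "open \<Omega>" "x0 \<in> \<Omega>" and k: "continuous_on (\<Omega> \<times> UNIV) (\<lambda>(x, y). k x y)"
    and dk: "continuous_on (\<Omega> \<times> UNIV) (\<lambda>(x, y). dk x y)"
    and deriv: "\<And>x y. x \<in> \<Omega> \<Longrightarrow> ((\<lambda>x. k x y) has_derivative (\<lambda>h. dk x y \<bullet> h)) (at x)"
    and u: "integrable M u"
  shows "((\<lambda>x. \<integral>y. k x y *\<^sub>R u y \<partial>M) has_derivative (\<lambda>h. \<integral>y. (dk x0 y \<bullet> h) *\<^sub>R u y \<partial>M)) (at x0)"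
  unfolding has_derivative_at_alt
proof (intro conjI allI impI)
  have ci: "continuous_on UNIV (\<lambda>y. dk x0 y \<bullet> h)" for h
    by (intro continuous_intros continuous_slice[OF dk \<Omega>(2)])
  have int: "integrable M (\<lambda>y. (dk x0 y \<bullet> h) *\<^sub>R u y)" for h
    by (intro integrable_continuous_scaleR ci u)
  define I where "I = (\<integral>y. norm (u y) \<partial>M)"
  have I: "I \<ge> 0" by (simp add: I_def)
  have "compact (dk x0 ` C)"
    using compact_continuous_image continuous_on_subset continuous_slice[OF dk \<Omega>(2)] compact_C by blast
  from compact_imp_bounded[OF this] obtain B where "\<forall>z\<in>dk x0 ` C. norm z \<le> B"
    unfolding bounded_iff by (elim exE)
  then have B: "\<And>y. y \<in> C \<Longrightarrow> norm (dk x0 y) \<le> B" by simp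
  show "bounded_linear (\<lambda>h. \<integral>y. (dk x0 y \<bullet> h) *\<^sub>R u y \<partial>M)"
  proof (rule bounded_linear_intro)
    fix h h' :: 'b and r :: real
    show "(\<integral>y. (dk x0 y \<bullet> (h + h')) *\<^sub>R u y \<partial>M) = (\<integral>y. (dk x0 y \<bullet> h) *\<^sub>R u y \<partial>M) + (\<integral>y. (dk x0 y \<bullet> h') *\<^sub>R u y \<partial>M)"
      using int by (simp add: inner_add_right scaleR_add_left)
    show "(\<integral>y. (dk x0 y \<bullet> (r *\<^sub>R h)) *\<^sub>R u y \<partial>M) = r *\<^sub>R (\<integral>y. (dk x0 y \<bullet> h) *\<^sub>R u y \<partial>M)"
      by (simp flip: scaleR_scaleR)
    have "norm (\<integral>y. (dk x0 y \<bullet> h) *\<^sub>R u y \<partial>M) \<le> (\<integral>y. (B * norm h) * norm (u y) \<partial>M)"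
    proof (rule Bochner_Integration.integral_norm_bound_integral[OF int])
      fix y assume "y \<in> space M"
      then have "\<bar>dk x0 y \<bullet> h\<bar> \<le> B * norm h" using abs_inner_le[OF B] space_C by blast
      then show "norm ((dk x0 y \<bullet> h) *\<^sub>R u y) \<le> B * norm h * norm (u y)" by (simp add: mult_right_mono)
    qed (use u in simp)
    then show "norm (\<integral>y. (dk x0 y \<bullet> h) *\<^sub>R u y \<partial>M) \<le> norm h * (B * I)" by (simp add: I_def mult_ac)
  qed
  fix e :: real assume e: "e > 0"
  have ei: "e / (I + 1) > 0" using e I by auto
  obtain \<eta> where \<eta>: "\<eta> > 0" "cball x0 \<eta> \<subseteq> \<Omega>"
    "\<And>x y. x \<in> cball x0 \<eta> \<Longrightarrow> y \<in> C \<Longrightarrow> norm (dk x y - dk x0 y) \<le> e / (I + 1)"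
    using compact_param_uniform[OF \<Omega> compact_C dk ei] by auto
  have "norm ((\<integral>y. k x y *\<^sub>R u y \<partial>M) - (\<integral>y. k x0 y *\<^sub>R u y \<partial>M) - (\<integral>y. (dk x0 y \<bullet> (x - x0)) *\<^sub>R u y \<partial>M)) \<le> e * norm (x - x0)"
    if x: "norm (x - x0) < \<eta>" for x
  proof -
    have xc: "x \<in> cball x0 \<eta>" using x by (simp add: dist_norm norm_minus_commute)
    then have x\<Omega>: "x \<in> \<Omega>" using \<eta>(2) by auto
    have i: "integrable M (\<lambda>y. k x y *\<^sub>R u y)" "integrable M (\<lambda>y. k x0 y *\<^sub>R u y)"
      using x\<Omega> \<Omega> by (auto intro!: integrable_continuous_scaleR continuous_slice[OF k] u)
    have "norm ((\<integral>y. k x y *\<^sub>R u y \<partial>M) - (\<integral>y. k x0 y *\<^sub>R u y \<partial>M) - (\<integral>y. (dk x0 y \<bullet> (x - x0)) *\<^sub>R u y \<partial>M))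
        = norm (\<integral>y. (k x y - k x0 y - dk x0 y \<bullet> (x - x0)) *\<^sub>R u y \<partial>M)"
      using i int by (simp add: scaleR_diff_left)
    also have "\<dots> \<le> (\<integral>y. norm (x - x0) * (e / (I + 1)) * norm (u y) \<partial>M)"
    proof (rule Bochner_Integration.integral_norm_bound_integral)
      show "integrable M (\<lambda>y. (k x y - k x0 y - dk x0 y \<bullet> (x - x0)) *\<^sub>R u y)"
        using i int by (simp add: scaleR_diff_left)
      fix y assume y: "y \<in> space M"
      have "norm (k x y - k x0 y - dk x0 y \<bullet> (x - x0)) \<le> norm (x - x0) * (e / (I + 1))"
      proof (rule differentiable_bound_linearization[where S = "cball x0 \<eta>" and f' = "\<lambda>x h. dk x y \<bullet> h" and f = "\<lambda>x. k x y"])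
        show "x0 + t *\<^sub>R (x - x0) \<in> cball x0 \<eta>" if "t \<in> {0..1}" for t
        proof -
          have "t * norm (x - x0) \<le> 1 * norm (x - x0)" using that by (intro mult_right_mono) auto
          then show ?thesis using that x by (simp add: dist_norm)
        qed
        show "((\<lambda>x. k x y) has_derivative (\<lambda>h. dk z y \<bullet> h)) (at z within cball x0 \<eta>)" if "z \<in> cball x0 \<eta>" for z
          using deriv[of z y] that \<eta>(2) has_derivative_at_withinI by blast
        show "onorm ((\<lambda>h. dk z y \<bullet> h) - (\<lambda>h. dk x0 y \<bullet> h)) \<le> e / (I + 1)" if "z \<in> cball x0 \<eta>" for z
        proof (rule onorm_bound)
          fix h
          have "norm (dk z y - dk x0 y) \<le> e / (I + 1)" using \<eta>(3)[OF that] y space_C by auto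
          then show "norm (((\<lambda>h. dk z y \<bullet> h) - (\<lambda>h. dk x0 y \<bullet> h)) h) \<le> e / (I + 1) * norm h"
            using abs_inner_le[of "dk z y - dk x0 y" "e / (I + 1)" h] by (simp add: inner_diff_left)
        qed (use ei in simp)
      qed (use \<eta>(1) in auto)
      then show "norm ((k x y - k x0 y - dk x0 y \<bullet> (x - x0)) *\<^sub>R u y) \<le> norm (x - x0) * (e / (I + 1)) * norm (u y)"
        unfolding norm_scaleR real_norm_def by (rule mult_right_mono) simp
    qed (use u in simp)
    also have "\<dots> = e * norm (x - x0) * (I / (I + 1))" by (simp add: I_def)
    also have "\<dots> \<le> e * norm (x - x0) * 1" using I e by (intro mult_left_mono) auto
    finally show ?thesis by simp
  qed
  then show "\<exists>d>0. \<forall>x. norm (x - x0) < d \<longrightarrow>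
      norm ((\<integral>y. k x y *\<^sub>R u y \<partial>M) - (\<integral>y. k x0 y *\<^sub>R u y \<partial>M) - (\<integral>y. (dk x0 y \<bullet> (x - x0)) *\<^sub>R u y \<partial>M)) \<le> e * norm (x - x0)"
    using \<eta>(1) by blast
qed

end

section \<open>A C^1 approximate identity\<close>

definition bump_mass :: "'a::euclidean_space itself \<Rightarrow> real" where
  "bump_mass _ = (\<integral>z. pos_sq (1 - z \<bullet> (z :: 'a)) \<partial>lborel)"

text \<open>For \<open>s = 0\<close> the division by zero makes the mollifier vanish.\<close>

definition bump :: "real \<Rightarrow> 'a::euclidean_space \<Rightarrow> real" where
  "bump s z = pos_sq (1 - (z \<bullet> z) / s\<^sup>2) / (bump_mass TYPE('a) * s ^ DIM('a))"

lemma bump_0 [simp]: "bump 0 (z::'a::euclidean_space) = 0"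
  by (simp add: bump_def)

lemma bump_mass_nn: "(\<integral>\<^sup>+z. ennreal (pos_sq (1 - z \<bullet> (z :: 'a::euclidean_space))) \<partial>lborel) = ennreal (bump_mass TYPE('a))"
  and bump_mass_pos: "bump_mass TYPE('a) > 0"
proof -
  let ?f = "\<lambda>z::'a. pos_sq (1 - z \<bullet> z)"
  have "integrable lborel (indicator (cball (0::'a) 1) :: 'a \<Rightarrow> real)"
    using emeasure_lborel_cball_finite by (simp add: integrable_indicator_iff)
  then have int: "integrable lborel ?f"
  proof (rule Bochner_Integration.integrable_bound)
    show "AE z in lborel. norm (?f z) \<le> norm (indicator (cball (0::'a) 1) z :: real)"
    proof (rule AE_I2)
      fix z :: 'a
      have "?f z \<le> pos_sq 1" by (rule pos_sq_mono) simp
      moreover have "?f z = 0" if "\<not> norm z \<le> 1"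
        using that by (simp add: dot_square_norm)
      ultimately show "norm (?f z) \<le> norm (indicator (cball (0::'a) 1) z :: real)"
        by (auto simp: indicator_def pos_sq_def)
    qed
  qed simp
  then show 1: "(\<integral>\<^sup>+z. ennreal (?f z) \<partial>lborel) = ennreal (bump_mass TYPE('a))"
    unfolding bump_mass_def by (rule nn_integral_eq_integral) simp
  have "\<not> (AE z in lborel. ?f z = 0)"
  proof
    assume "AE z in lborel. ?f z = 0"
    then have "AE z in lborel. z \<notin> ball (0::'a) 1"
    proof eventually_elim
      case (elim z)
      then have "1 \<le> (norm z)\<^sup>2" by (simp add: dot_square_norm)
      then have "\<not> norm z < 1" using abs_square_less_1[of "norm z"] by simp
      then show ?case by simp
    qed
    then have "ball (0::'a) 1 \<in> null_sets lborel" by (simp add: AE_iff_null_sets)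
    then have "negligible (ball (0::'a) 1)" by (simp add: negligible_iff_null_sets null_sets_completionI)
    then show False using open_not_negligible[of "ball (0::'a) 1"] by simp
  qed
  then have "bump_mass TYPE('a) \<noteq> 0"
    unfolding bump_mass_def using integral_nonneg_eq_0_iff_AE[OF int] by auto
  moreover have "bump_mass TYPE('a) \<ge> 0" unfolding bump_mass_def by simp
  ultimately show "bump_mass TYPE('a) > 0" by simp
qed

lemma bump_nonneg: "s \<ge> 0 \<Longrightarrow> bump s (z::'a::euclidean_space) \<ge> 0"
  using bump_mass_pos[where 'a='a] by (simp add: bump_def)

lemma bump_eq_0:
  assumes "s \<ge> 0" "norm z \<ge> s"
  shows "bump s z = 0"
proof (cases "s = 0")
  case False
  have "s\<^sup>2 \<le> z \<bullet> z" using assms by (simp add: dot_square_norm power_mono)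
  then show ?thesis using False assms by (simp add: bump_def)
qed simp

lemma bump_uminus: "bump s (- z) = bump s z"
  by (simp add: bump_def)

lemma nn_integral_bump:
  fixes y :: "'a::euclidean_space"
  assumes s: "s > 0"
  shows "(\<integral>\<^sup>+x. ennreal (bump s (x - y)) \<partial>lborel) = 1"
proof -
  let ?m = "bump_mass TYPE('a)"
  have "(\<integral>\<^sup>+x. ennreal (bump s (x - y)) \<partial>lborel)
      = (\<integral>\<^sup>+x. ennreal (bump s (x - y)) \<partial>density (distr lborel borel (\<lambda>x. y + s *\<^sub>R x)) (\<lambda>_. ennreal (\<bar>s\<bar>^DIM('a))))"
    using lborel_affine[of s y] s by simp
  also have "\<dots> = (\<integral>\<^sup>+x. ennreal (s^DIM('a)) * ennreal (bump s (s *\<^sub>R (x :: 'a))) \<partial>lborel)"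
    using s unfolding bump_def by (simp add: nn_integral_density nn_integral_distr)
  also have "\<dots> = (\<integral>\<^sup>+x. ennreal (1 / ?m) * ennreal (pos_sq (1 - x \<bullet> (x :: 'a))) \<partial>lborel)"
  proof (rule nn_integral_cong)
    fix x :: 'a
    have "s^DIM('a) * bump s (s *\<^sub>R x) = 1 / ?m * pos_sq (1 - x \<bullet> x)"
      using s by (simp add: bump_def power2_eq_square)
    then show "ennreal (s^DIM('a)) * ennreal (bump s (s *\<^sub>R x)) = ennreal (1 / ?m) * ennreal (pos_sq (1 - x \<bullet> x))"
      using s bump_mass_pos[where 'a='a] bump_nonneg[of s "s *\<^sub>R x"]
      by (simp add: ennreal_mult[symmetric])
  qed
  also have "\<dots> = ennreal (1 / ?m) * ennreal ?m"
    by (simp add: nn_integral_cmult bump_mass_nn)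
  also have "\<dots> = 1"
    using bump_mass_pos[where 'a='a] by (simp add: ennreal_mult[symmetric] flip: ennreal_1)
  finally show ?thesis .
qed

text \<open>Enlarging the radius only raises the profile; the price is the normalization, a ratio of
  radii to the power of the dimension.\<close>

lemma bump_radius_le:
  assumes "0 < r" "r \<le> s" "s \<le> t"
  shows "bump s (z::'a::euclidean_space) \<le> (t / r)^DIM('a) * bump t z"
proof -
  let ?m = "bump_mass TYPE('a)"
  have st: "(z \<bullet> z) / t\<^sup>2 \<le> (z \<bullet> z) / s\<^sup>2"
    using assms by (intro divide_left_mono power_mono mult_pos_pos) auto
  have "bump s z \<le> pos_sq (1 - (z \<bullet> z) / t\<^sup>2) / (?m * s ^ DIM('a))"
    unfolding bump_def using bump_mass_pos[where 'a='a] assms st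
    by (intro divide_right_mono pos_sq_mono) auto
  also have "\<dots> \<le> pos_sq (1 - (z \<bullet> z) / t\<^sup>2) / (?m * r ^ DIM('a))"
    using bump_mass_pos[where 'a='a] assms
    by (intro divide_left_mono mult_left_mono power_mono mult_pos_pos) auto
  also have "\<dots> = (t / r)^DIM('a) * bump t z"
    unfolding bump_def using assms by (simp add: power_divide)
  finally show ?thesis .
qed

section \<open>A mollifier of variable radius\<close>

lemma nn_integral_lebesgue_on_eq_lborel:
  assumes "open \<Omega>" "f \<in> borel_measurable borel" "\<And>x. x \<notin> \<Omega> \<Longrightarrow> f x = 0"
  shows "(\<integral>\<^sup>+x. f x \<partial>lebesgue_on \<Omega>) = (\<integral>\<^sup>+x. f x \<partial>lborel)"
proof -
  have "(\<integral>\<^sup>+x. f x \<partial>lebesgue_on \<Omega>) = (\<integral>\<^sup>+x. f x * indicator \<Omega> x \<partial>lebesgue)"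
    by (rule nn_integral_restrict_space) (use assms in auto)
  also have "(\<lambda>x. f x * indicator \<Omega> x) = f" using assms(3) by (auto simp: indicator_def fun_eq_iff)
  finally show ?thesis by (simp add: nn_integral_completion)
qed

locale open_distance =
  fixes \<Omega> :: "'a::euclidean_space set" and d :: "'a \<Rightarrow> real" and dd :: "'a \<Rightarrow> 'a"
  assumes \<Omega>_open: "open \<Omega>" and \<Omega>_bounded: "bounded \<Omega>"
    and d_deriv: "\<And>x. (d has_derivative (\<lambda>h. dd x \<bullet> h)) (at x)" and dd_cont: "continuous_on UNIV dd"
    and d_nonneg: "\<And>x. d x \<ge> 0" and d_pos: "\<And>x. d x > 0 \<longleftrightarrow> x \<in> \<Omega>"
    and dd_le: "\<And>x. norm (dd x) \<le> 1" and d_lip: "\<And>x y. \<bar>d x - d y\<bar> \<le> norm (x - y)"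
begin

lemma d_cont: "continuous_on UNIV d"
  by (rule continuous_at_imp_continuous_on) (use d_deriv has_derivative_continuous in blast)

lemma d_borel [measurable]: "d \<in> borel_measurable borel"
  using d_cont by (rule borel_measurable_continuous_onI)

text \<open>The radius depends on the centre x and shrinks towards the boundary, so for e < 1
  nothing leaks out of \<Omega>. In return the kernel is not symmetric: its integral in y is 1,
  while in x it is only bounded by \<open>mass_bound e\<close>, which tends to 1.\<close>

definition kern :: "real \<Rightarrow> 'a \<Rightarrow> 'a \<Rightarrow> real" where
  "kern e x y = bump (e * d x) (x - y)"

lemma kern_nonneg: "e \<ge> 0 \<Longrightarrow> kern e x y \<ge> 0"
  unfolding kern_def by (intro bump_nonneg mult_nonneg_nonneg d_nonneg)

lemma kern_borel [measurable]: "(\<lambda>(x, y). kern e x y) \<in> borel_measurable borel"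
  unfolding kern_def bump_def by (simp add: borel_prod[symmetric])

lemma kern_borel1 [measurable]: "kern e x \<in> borel_measurable borel"
  unfolding kern_def bump_def by simp

lemma kern_borel2 [measurable]: "(\<lambda>x. kern e x y) \<in> borel_measurable borel"
  unfolding kern_def bump_def by simp

lemma kern_support:
  assumes "e \<ge> 0" "kern e x y \<noteq> 0"
  shows "norm (x - y) < e * d x" "x \<in> \<Omega>"
proof -
  show 1: "norm (x - y) < e * d x"
    using assms bump_eq_0[of "e * d x" "x - y"] d_nonneg[of x] by (force simp: kern_def)
  show "x \<in> \<Omega>"
    using 1 d_nonneg[of x] d_pos[of x] norm_ge_zero[of "x - y"] by (cases "d x = 0") auto
qed

lemma near_in_\<Omega>:
  assumes "0 \<le> e" "e < 1" "x \<in> \<Omega>" "norm (x - y) \<le> e * d x"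
  shows "y \<in> \<Omega>"
proof -
  have "d x - d y \<le> e * d x" using d_lip[of x y] assms(4) by linarith
  moreover have "e * d x < 1 * d x" using assms d_pos[of x] by (intro mult_strict_right_mono) auto
  ultimately show ?thesis using d_pos[of y] by linarith
qed

lemma kern_outside:
  assumes "0 \<le> e" "e < 1" "y \<notin> \<Omega>"
  shows "kern e x y = 0"
  using near_in_\<Omega>[of e x y] kern_support[of e x y] assms by force

lemma kern_outside_fst: "e \<ge> 0 \<Longrightarrow> x \<notin> \<Omega> \<Longrightarrow> kern e x y = 0"
  using kern_support(2)[of e x y] by blast

lemma nn_integral_kern_fst:
  assumes "0 < e" "e < 1" "x \<in> \<Omega>"
  shows "(\<integral>\<^sup>+y. ennreal (kern e x y) \<partial>lebesgue_on \<Omega>) = 1"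
proof -
  have "(\<integral>\<^sup>+y. ennreal (kern e x y) \<partial>lebesgue_on \<Omega>) = (\<integral>\<^sup>+y. ennreal (kern e x y) \<partial>lborel)"
    by (rule nn_integral_lebesgue_on_eq_lborel[OF \<Omega>_open]) (use kern_outside assms in auto)
  also have "\<dots> = (\<integral>\<^sup>+y. ennreal (bump (e * d x) (y - x)) \<partial>lborel)"
    unfolding kern_def using bump_uminus[of _ "_ - x"] by (metis minus_diff_eq)
  also have "\<dots> = 1" by (rule nn_integral_bump) (use assms d_pos in auto)
  finally show ?thesis .
qed

text \<open>On the support, d x and d y differ by at most e * d x, hence d x lies between d y / (1 +
  e) and d y / (1 - e). Passing to the largest of these radii yields a bump of fixed radius, whose
  integral in x is known.\<close>

lemma kern_le_bump:
  assumes "0 < e" "e < 1" "y \<in> \<Omega>"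
  shows "kern e x y \<le> ((1 + e) / (1 - e))^DIM('a) * bump (e * d y / (1 - e)) (x - y)"
proof (cases "kern e x y = 0")
  case True
  then show ?thesis using assms d_nonneg[of y]
    by (auto intro!: mult_nonneg_nonneg bump_nonneg)
next
  case False
  have lt: "norm (x - y) < e * d x" using kern_support(1)[OF _ False] assms by simp
  have "d y - d x \<le> e * d x" "d x - d y \<le> e * d x"
    using d_lip[of x y] lt by linarith+
  then have 1: "d y / (1 + e) \<le> d x" "d x \<le> d y / (1 - e)"
    using assms by (simp_all add: pos_divide_le_eq pos_le_divide_eq algebra_simps)
  have dy: "d y > 0" using assms d_pos by simp
  have "kern e x y \<le> ((e * d y / (1 - e)) / (e * d y / (1 + e)))^DIM('a) * bump (e * d y / (1 - e)) (x - y)"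
    unfolding kern_def
  proof (rule bump_radius_le)
    show "0 < e * d y / (1 + e)" using dy assms by simp
    show "e * d y / (1 + e) \<le> e * d x" using mult_left_mono[OF 1(1), of e] assms by simp
    show "e * d x \<le> e * d y / (1 - e)" using mult_left_mono[OF 1(2), of e] assms by simp
  qed
  also have "(e * d y / (1 - e)) / (e * d y / (1 + e)) = (1 + e) / (1 - e)"
    using dy assms by (simp add: field_simps)
  finally show ?thesis .
qed

definition mass_bound :: "real \<Rightarrow> real" where
  "mass_bound e = ((1 + e) / (1 - e))^DIM('a)"

lemma mass_bound_nonneg: "0 < e \<Longrightarrow> e < 1 \<Longrightarrow> mass_bound e \<ge> 0"
  unfolding mass_bound_def by simp

lemma mass_bound_tendsto: "(mass_bound \<longlongrightarrow> 1) (at_right 0)"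
proof -
  have "((\<lambda>e::real. ((1 + e) / (1 - e))^DIM('a)) \<longlongrightarrow> ((1 + 0) / (1 - 0))^DIM('a)) (at_right 0)"
    by (intro tendsto_intros) auto
  then show ?thesis by (simp add: mass_bound_def[abs_def])
qed

lemma nn_integral_kern_snd:
  assumes "0 < e" "e < 1"
  shows "(\<integral>\<^sup>+x. ennreal (kern e x y) \<partial>lebesgue_on \<Omega>) \<le> ennreal (mass_bound e)"
proof (cases "y \<in> \<Omega>")
  case True
  have "(\<integral>\<^sup>+x. ennreal (kern e x y) \<partial>lebesgue_on \<Omega>) = (\<integral>\<^sup>+x. ennreal (kern e x y) \<partial>lborel)"
    by (rule nn_integral_lebesgue_on_eq_lborel[OF \<Omega>_open]) (auto simp: kern_outside_fst assms less_imp_le)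
  also have "\<dots> \<le> (\<integral>\<^sup>+x. ennreal (mass_bound e) * ennreal (bump (e * d y / (1 - e)) (x - y)) \<partial>lborel)"
  proof (rule nn_integral_mono)
    fix x
    have "bump (e * d y / (1 - e)) (x - y) \<ge> 0" using assms d_nonneg[of y] by (intro bump_nonneg) auto
    then show "ennreal (kern e x y) \<le> ennreal (mass_bound e) * ennreal (bump (e * d y / (1 - e)) (x - y))"
      using kern_le_bump[OF assms True, of x] mass_bound_nonneg[OF assms]
      by (simp add: mass_bound_def ennreal_mult[symmetric])
  qed
  also have "\<dots> = ennreal (mass_bound e) * (\<integral>\<^sup>+x. ennreal (bump (e * d y / (1 - e)) (x - y)) \<partial>lborel)"
    by (rule nn_integral_cmult) (simp add: bump_def)
  also have "(\<integral>\<^sup>+x. ennreal (bump (e * d y / (1 - e)) (x - y)) \<partial>lborel) = 1"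
    by (rule nn_integral_bump) (use True assms d_pos in auto)
  finally show ?thesis by simp
next
  case False
  then show ?thesis using kern_outside[OF _ assms(2) False] assms by simp
qed

lemma compact_closure_\<Omega>: "compact (closure \<Omega>)"
  using \<Omega>_bounded by (simp add: compact_closure)

lemma finite_measure_\<Omega>: "finite_measure (lebesgue_on \<Omega>)"
  by (rule finite_measure_lebesgue_on) (simp add: bounded_set_imp_lmeasurable \<Omega>_bounded \<Omega>_open)

lemma borel_carrier_lebesgue: "borel_carrier (lebesgue_on \<Omega>) (closure \<Omega>)"
  by unfold_locales
    (auto intro: borel_lebesgue_on simp: \<Omega>_bounded closure_subset)

lemma borel_carrier_restrict:
  assumes "sets \<nu> = sets (restrict_space borel \<Omega>)"
  shows "borel_carrier \<nu> (closure \<Omega>)"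
proof unfold_locales
  have "(\<lambda>x. x) \<in> restrict_space borel \<Omega> \<rightarrow>\<^sub>M borel" by (rule measurable_restrict_space1) simp
  then show "(\<lambda>x. x) \<in> \<nu> \<rightarrow>\<^sub>M borel" by (simp add: measurable_cong_sets[OF assms refl])
  show "space \<nu> \<subseteq> closure \<Omega>"
    using sets_eq_imp_space_eq[OF assms] closure_subset by (auto simp: space_restrict_space)
qed (rule compact_closure_\<Omega>)

text \<open>Exchanging the integrals leaves the x-mass of the kernel. It is stated for a general M
  because M is later both Lebesgue measure and the singular measure.\<close>

lemma kern_tonelli:
  assumes e: "0 < e" "e < 1" and M: "sigma_finite_measure M" "borel_carrier M (closure \<Omega>)"
    and Z[measurable]: "Z \<in> borel_measurable M"
  shows "(\<integral>\<^sup>+x. (\<integral>\<^sup>+y. ennreal (kern e x y) * Z y \<partial>M) \<partial>lebesgue_on \<Omega>) \<le> ennreal (mass_bound e) * (\<integral>\<^sup>+y. Z y \<partial>M)"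
proof -
  interpret M: sigma_finite_measure M by (rule M)
  interpret L: finite_measure "lebesgue_on \<Omega>" by (rule finite_measure_\<Omega>)
  interpret P: pair_sigma_finite M "lebesgue_on \<Omega>" ..
  interpret borel_carrier M "closure \<Omega>" by (rule M)
  have [measurable]: "(\<lambda>x. x) \<in> lebesgue_on \<Omega> \<rightarrow>\<^sub>M borel" using borel_lebesgue_on[of "\<lambda>x. x"] by simp
  note [measurable] = ident_meas
  have 1: "(\<lambda>p. (snd p, fst p)) \<in> M \<Otimes>\<^sub>M lebesgue_on \<Omega> \<rightarrow>\<^sub>M borel \<Otimes>\<^sub>M borel"
    by measurable
  have "(\<lambda>p. kern e (snd p) (fst p)) \<in> borel_measurable (M \<Otimes>\<^sub>M lebesgue_on \<Omega>)"
    using measurable_compose[OF 1, of "\<lambda>(x, y). kern e x y"] kern_borel by (simp add: borel_prod)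
  then have m: "(\<lambda>p. ennreal (kern e (snd p) (fst p)) * Z (fst p)) \<in> borel_measurable (M \<Otimes>\<^sub>M lebesgue_on \<Omega>)"
    by measurable
  have "(\<integral>\<^sup>+x. (\<integral>\<^sup>+y. ennreal (kern e x y) * Z y \<partial>M) \<partial>lebesgue_on \<Omega>)
      = (\<integral>\<^sup>+y. (\<integral>\<^sup>+x. ennreal (kern e x y) * Z y \<partial>lebesgue_on \<Omega>) \<partial>M)"
    using P.Fubini'[of "\<lambda>y x. ennreal (kern e x y) * Z y"] m by (simp add: case_prod_beta)
  also have "\<dots> = (\<integral>\<^sup>+y. (\<integral>\<^sup>+x. ennreal (kern e x y) \<partial>lebesgue_on \<Omega>) * Z y \<partial>M)"
  proof (rule nn_integral_cong, rule nn_integral_multc)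
    show "(\<lambda>x. ennreal (kern e x y)) \<in> borel_measurable (lebesgue_on \<Omega>)" for y
      by (rule borel_lebesgue_on) measurable
  qed
  also have "\<dots> \<le> (\<integral>\<^sup>+y. ennreal (mass_bound e) * Z y \<partial>M)"
    by (intro nn_integral_mono mult_right_mono nn_integral_kern_snd e) simp
  also have "\<dots> = ennreal (mass_bound e) * (\<integral>\<^sup>+y. Z y \<partial>M)" by (rule nn_integral_cmult) measurable
  finally show ?thesis .
qed

text \<open>The reciprocal of the radius. With it the kernel becomes a product without quotients, so
  its derivatives are plain polynomial algebra in \<open>kern_rad\<close>, including outside
  \<Omega>, where it is zero.\<close>

definition kern_rad :: "real \<Rightarrow> 'a \<Rightarrow> real" where
  "kern_rad e x = inverse (e * d x)"

definition kern_scale :: "real \<Rightarrow> 'a \<Rightarrow> real" where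
  "kern_scale e x = (kern_rad e x)^DIM('a) * inverse (bump_mass TYPE('a))"

definition dprof :: "real \<Rightarrow> 'a \<Rightarrow> 'a \<Rightarrow> real" where
  "dprof e x y = 2 * max 0 (1 - ((x - y) \<bullet> (x - y)) * (kern_rad e x)\<^sup>2) * kern_scale e x"

definition dkern_y :: "real \<Rightarrow> 'a \<Rightarrow> 'a \<Rightarrow> 'a" where
  "dkern_y e x y = (2 * dprof e x y * (kern_rad e x)\<^sup>2) *\<^sub>R (x - y)"

definition dkern_x :: "real \<Rightarrow> 'a \<Rightarrow> 'a \<Rightarrow> 'a" where
  "dkern_x e x y = - dkern_y e x y
     + (kern_rad e x * ((x - y) \<bullet> dkern_y e x y - real DIM('a) * kern e x y)) *\<^sub>R (e *\<^sub>R dd x)"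

text \<open>The component along b of the field ((x - y) / radius) * kern. Its divergence in y is the
  derivative of the kernel with respect to the radius; \<open>dpsi\<close> is the y-gradient of one
  component.\<close>

definition psi :: "real \<Rightarrow> 'a \<Rightarrow> 'a \<Rightarrow> 'a \<Rightarrow> real" where
  "psi e b x y = kern_rad e x * ((x - y) \<bullet> b) * kern e x y"

definition dpsi :: "real \<Rightarrow> 'a \<Rightarrow> 'a \<Rightarrow> 'a \<Rightarrow> 'a" where
  "dpsi e b x y = kern_rad e x *\<^sub>R (((x - y) \<bullet> b) *\<^sub>R dkern_y e x y - kern e x y *\<^sub>R b)"

text \<open>Varying the radius transports mass, so the \<open>x\<close>-gradient of the kernel is minus its
  \<open>y\<close>-gradient up to a \<open>y\<close>-divergence; this moves all derivatives to the second variable.\<close>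

lemma dkern_x_eq: "dkern_x e x y = - dkern_y e x y + (\<Sum>b\<in>Basis. dpsi e b x y \<bullet> b) *\<^sub>R (e *\<^sub>R dd x)"
proof -
  have "(\<Sum>b\<in>Basis. dpsi e b x y \<bullet> b)
      = kern_rad e x * ((\<Sum>b\<in>Basis. ((x - y) \<bullet> b) * (dkern_y e x y \<bullet> b)) - (\<Sum>b\<in>(Basis :: 'a set). kern e x y * (b \<bullet> b)))"
  proof -
    have "dpsi e b x y \<bullet> b = kern_rad e x * (((x - y) \<bullet> b) * (dkern_y e x y \<bullet> b) - kern e x y * (b \<bullet> b))" for b
      unfolding dpsi_def by (simp only: inner_scaleR_left inner_diff_left[of "_ *\<^sub>R _"])
    then show ?thesis by (simp only: sum_distrib_left[symmetric] sum_subtractf)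
  qed
  also have "(\<Sum>b\<in>Basis. ((x - y) \<bullet> b) * (dkern_y e x y \<bullet> b)) = (x - y) \<bullet> dkern_y e x y"
    by (rule euclidean_inner[symmetric])
  also have "(\<Sum>b\<in>(Basis :: 'a set). kern e x y * (b \<bullet> b)) = real DIM('a) * kern e x y"
    by (simp add: inner_same_Basis)
  finally show ?thesis by (simp add: dkern_x_def)
qed

lemma kern_alt: "kern e x y = pos_sq (1 - ((x - y) \<bullet> (x - y)) * (kern_rad e x)\<^sup>2) * kern_scale e x"
  unfolding kern_def bump_def kern_rad_def kern_scale_def
  by (simp only: divide_inverse power_inverse inverse_mult_distrib power_mult_distrib mult_ac)

lemma kern_deriv_y: "(kern e x has_derivative (\<lambda>h. dkern_y e x y \<bullet> h)) (at y)"
  unfolding kern_alt[abs_def] dkern_y_def dprof_def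
  by (rule has_derivative_eq_rhs, (rule derivative_intros)+)
    (simp add: fun_eq_iff inner_commute algebra_simps add_divide_distrib)

lemma psi_deriv_y: "(psi e b x has_derivative (\<lambda>h. dpsi e b x y \<bullet> h)) (at y)"
  unfolding psi_def dpsi_def
  by (rule has_derivative_eq_rhs, (rule derivative_intros kern_deriv_y)+)
    (simp add: fun_eq_iff inner_commute inner_diff_left inner_diff_right algebra_simps)

lemma kern_deriv_x:
  assumes "e > 0" "x \<in> \<Omega>"
  shows "((\<lambda>x. kern e x y) has_derivative (\<lambda>h. dkern_x e x y \<bullet> h)) (at x)"
proof -
  let ?N = "DIM('a)" and ?m = "inverse (bump_mass TYPE('a))" and ?r = "kern_rad e x"
  have s: "e * d x \<noteq> 0" using assms d_pos[of x] by auto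
  \<comment> \<open>The derivative of the normalizing power contains the exponent DIM - 1, which is
    written n to avoid subtraction.\<close>
  obtain n where n: "?N = Suc n" using DIM_positive[where 'a='a] gr0_conv_Suc by blast
  have r': "(kern_rad e has_derivative (\<lambda>h. - (?r\<^sup>2 * (e * (dd x \<bullet> h))))) (at x)"
    unfolding kern_rad_def[abs_def]
    by (rule has_derivative_eq_rhs, rule Deriv.has_derivative_inverse[of "\<lambda>x. e * d x", OF s],
        rule derivative_intros, rule d_deriv) (simp add: power2_eq_square mult_ac)
  define q where "q = (x - y) \<bullet> (x - y)"
  define T where "T = 2 * max 0 (1 - q * ?r\<^sup>2)"
  have "((\<lambda>x. pos_sq (1 - ((x - y) \<bullet> (x - y)) * (kern_rad e x)\<^sup>2) * ((kern_rad e x)^?N * ?m)) has_derivative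
     (\<lambda>h. T * (- (2 * ((x - y) \<bullet> h)) * ?r\<^sup>2 + 2 * q * ?r * (?r\<^sup>2 * (e * (dd x \<bullet> h)))) * (?r^?N * ?m)
        - pos_sq (1 - q * ?r\<^sup>2) * (real ?N * ?r^n * (?r\<^sup>2 * (e * (dd x \<bullet> h))) * ?m))) (at x)"
    unfolding T_def q_def
    by (rule has_derivative_eq_rhs, (rule derivative_intros r')+)
      (simp add: fun_eq_iff n inner_commute algebra_simps power2_eq_square)
  moreover have "dkern_x e x y \<bullet> h = T * (- (2 * ((x - y) \<bullet> h)) * ?r\<^sup>2 + 2 * q * ?r * (?r\<^sup>2 * (e * (dd x \<bullet> h)))) * (?r^?N * ?m)
        - pos_sq (1 - q * ?r\<^sup>2) * (real ?N * ?r^n * (?r\<^sup>2 * (e * (dd x \<bullet> h))) * ?m)" for h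
    unfolding dkern_x_def dkern_y_def dprof_def kern_alt kern_scale_def T_def[symmetric] q_def[symmetric]
    by (simp add: n inner_add_left inner_diff_left algebra_simps power2_eq_square T_def q_def)
  ultimately show ?thesis unfolding kern_alt kern_scale_def by simp
qed

lemma kern_rad_cont: "e > 0 \<Longrightarrow> continuous_on (\<Omega> \<times> UNIV) (\<lambda>p. kern_rad e (fst p))"
  unfolding kern_rad_def
  by (intro continuous_intros continuous_on_compose2[OF d_cont]) (use d_pos in force)+

lemma kern_scale_cont: "e > 0 \<Longrightarrow> continuous_on (\<Omega> \<times> UNIV) (\<lambda>p. kern_scale e (fst p))"
  unfolding kern_scale_def by (intro continuous_intros kern_rad_cont)

lemma kern_cont: "e > 0 \<Longrightarrow> continuous_on (\<Omega> \<times> UNIV) (\<lambda>(x, y). kern e x y)"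
  unfolding kern_alt case_prod_beta by (intro continuous_intros kern_rad_cont kern_scale_cont)

lemma dprof_cont: "e > 0 \<Longrightarrow> continuous_on (\<Omega> \<times> UNIV) (\<lambda>p. dprof e (fst p) (snd p))"
  unfolding dprof_def by (intro continuous_intros kern_rad_cont kern_scale_cont)

lemma dkern_y_cont: "e > 0 \<Longrightarrow> continuous_on (\<Omega> \<times> UNIV) (\<lambda>p. dkern_y e (fst p) (snd p))"
  unfolding dkern_y_def by (intro continuous_intros kern_rad_cont dprof_cont)

lemma dkern_x_cont: "e > 0 \<Longrightarrow> continuous_on (\<Omega> \<times> UNIV) (\<lambda>(x, y). dkern_x e x y)"
  unfolding dkern_x_def case_prod_beta
  using kern_cont[unfolded case_prod_beta]
  by (intro continuous_intros kern_rad_cont dkern_y_cont continuous_on_compose2[OF dd_cont]) auto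

text \<open>For e < 1 the closed ball of radius e * d x lies in \<Omega>, so for fixed x both the
  kernel and the field are admissible in the definition of the distributional gradient.\<close>

lemma test_fun_kern:
  assumes e: "0 < e" "e < 1" and x: "x \<in> \<Omega>"
  shows "test_fun \<Omega> (kern e x) (dkern_y e x)" "test_fun \<Omega> (psi e b x) (dpsi e b x)"
proof -
  have K: "compact (cball x (e * d x))" "cball x (e * d x) \<subseteq> \<Omega>"
    using near_in_\<Omega>[of e x] e x by (auto simp: dist_norm)
  have z: "kern e x y = 0" if "y \<notin> cball x (e * d x)" for y
    using that kern_support(1)[of e x y] e by (force simp: dist_norm)
  have c: "continuous_on UNIV (dkern_y e x)" "continuous_on UNIV (kern e x)"
    unfolding dkern_y_def dprof_def kern_alt[abs_def] by (intro continuous_intros)+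
  show "test_fun \<Omega> (kern e x) (dkern_y e x)"
    unfolding test_fun_def using c kern_deriv_y K z by blast
  show "test_fun \<Omega> (psi e b x) (dpsi e b x)"
    unfolding test_fun_def
  proof (intro conjI allI exI[of _ "cball x (e * d x)"] impI psi_deriv_y K)
    show "continuous_on UNIV (dpsi e b x)" unfolding dpsi_def by (intro continuous_intros c)
    fix y assume "y \<notin> cball x (e * d x)"
    then show "psi e b x y = 0" using z by (simp add: psi_def)
  qed
qed

text \<open>The reciprocal radius would blow up at the boundary, but on the support of the kernel
  \<open>norm (x - y)\<close> is below the radius and compensates it.\<close>

lemma psi_le:
  assumes "e > 0" "norm b \<le> 1"
  shows "\<bar>psi e b x y\<bar> \<le> kern e x y"
proof (cases "kern e x y = 0")
  case True
  then show ?thesis by (simp add: psi_def)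
next
  case False
  note k = kern_support[OF _ False]
  have s: "e * d x > 0" using assms k(2) d_pos[of x] by simp
  have "\<bar>(x - y) \<bullet> b\<bar> \<le> norm (x - y) * norm b" by (rule Cauchy_Schwarz_ineq2)
  also have "\<dots> \<le> e * d x * 1" using k(1) assms s by (intro mult_mono) auto
  finally have "kern_rad e x * \<bar>(x - y) \<bullet> b\<bar> \<le> 1"
    using s by (simp add: kern_rad_def inverse_eq_divide divide_le_eq)
  moreover have "kern_rad e x \<ge> 0" using s unfolding kern_rad_def by (simp only: inverse_nonnegative_iff_nonnegative less_imp_le)
  ultimately have "kern_rad e x * \<bar>(x - y) \<bullet> b\<bar> * kern e x y \<le> 1 * kern e x y"
    using kern_nonneg[of e x y] assms by (intro mult_right_mono) auto
  then show ?thesis using \<open>kern_rad e x \<ge> 0\<close> kern_nonneg[of e x y] assms by (simp add: psi_def abs_mult)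
qed

end

section \<open>Mollification in \<open>L\<^sup>1\<close>\<close>

text \<open>Projection onto large balls truncates u with small error in \<open>L^1\<close>. A
  measurable function is an almost everywhere limit of continuous ones, and projecting these as well
  provides the bound for dominated convergence.\<close>

lemma continuous_dense_L1:
  fixes u :: "'a::euclidean_space \<Rightarrow> 'c::euclidean_space"
  assumes \<Omega>: "open \<Omega>" "bounded \<Omega>" and u: "integrable (lebesgue_on \<Omega>) u" and \<eta>: "\<eta> > 0"
  obtains \<phi> where "continuous_on UNIV \<phi>" "integrable (lebesgue_on \<Omega>) \<phi>"
    "(\<integral>x. norm (u x - \<phi> x) \<partial>lebesgue_on \<Omega>) < \<eta>"
proof -
  let ?L = "lebesgue_on \<Omega>"
  interpret L: finite_measure ?L
    using \<Omega> by (intro finite_measure_lebesgue_on) (simp add: bounded_set_imp_lmeasurable)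
  define P where "P n = closest_point (cball (0::'c) (real n))" for n
  have P_le: "norm (P n x) \<le> real n" for n x
    using closest_point_in_set[of "cball (0::'c) (real n)" x] by (simp add: P_def)
  have P_dist: "norm (x - P n x) \<le> norm x" for n x
    using closest_point_le[of "cball (0::'c) (real n)" 0 x] by (simp add: P_def dist_norm)
  have P_id: "P n x = x" if "norm x \<le> real n" for n x
    using that by (simp add: P_def closest_point_self)
  have P_cont: "continuous_on UNIV (P n)" for n
    unfolding P_def by (rule continuous_on_closest_point) auto
  then have [measurable]: "P n \<in> borel_measurable borel" for n by (rule borel_measurable_continuous_onI)
  note [measurable] = borel_measurable_integrable[OF u]
  have Pu: "integrable ?L (\<lambda>x. P n (u x))" for n
    by (rule L.integrable_const_bound[where B = n]) (use P_le in auto)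
  have "(\<lambda>n. \<integral>x. norm (u x - P n (u x)) \<partial>?L) \<longlonglongrightarrow> (\<integral>x. 0 \<partial>?L)"
  proof (rule integral_dominated_convergence[where w = "\<lambda>x. norm (u x)"])
    show "AE x in ?L. (\<lambda>n. norm (u x - P n (u x))) \<longlonglongrightarrow> 0"
    proof (rule AE_I2)
      fix x
      obtain m :: nat where "norm (u x) \<le> real m" using real_arch_simple by blast
      then have "\<forall>\<^sub>F n in sequentially. norm (u x - P n (u x)) = 0"
        by (intro eventually_sequentiallyI[of m]) (auto simp: P_id)
      then show "(\<lambda>n. norm (u x - P n (u x))) \<longlonglongrightarrow> 0" by (rule tendsto_eventually)
    qed
  qed (use u P_dist in auto)
  then have "\<forall>\<^sub>F n in sequentially. (\<integral>x. norm (u x - P n (u x)) \<partial>?L) < \<eta> / 2"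
    by (rule order_tendstoD) (use \<eta> in simp)
  then obtain n where n: "(\<integral>x. norm (u x - P n (u x)) \<partial>?L) < \<eta> / 2"
    using eventually_happens'[OF sequentially_bot] by blast
  have "(\<lambda>x. if x \<in> \<Omega> then u x else 0) measurable_on UNIV"
    by (rule lebesgue_measurable_imp_measurable_on) (use \<Omega> u in \<open>auto intro: borel_measurable_if_I\<close>)
  then obtain N g where N: "negligible N" and g: "\<And>k. continuous_on UNIV (g k)"
    "\<And>x. x \<notin> N \<Longrightarrow> (\<lambda>k. g k x) \<longlonglongrightarrow> (if x \<in> \<Omega> then u x else 0)"
    unfolding measurable_on_def by auto
  have gm: "g k \<in> borel_measurable ?L" for k
    using g(1) by (intro borel_lebesgue_on borel_measurable_continuous_onI)
  have "AE x in lebesgue. x \<notin> N"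
    using N by (intro AE_not_in) (simp add: negligible_iff_null_sets)
  then have AEN: "AE x in ?L. x \<notin> N"
    by (subst AE_restrict_space_iff) (use \<Omega> in auto)
  note [measurable] = gm
  have "(\<lambda>k. \<integral>x. norm (P n (u x) - P n (g k x)) \<partial>?L) \<longlonglongrightarrow> (\<integral>x. 0 \<partial>?L)"
  proof (rule integral_dominated_convergence[where w = "\<lambda>x. 2 * real n"])
    show "AE x in ?L. (\<lambda>k. norm (P n (u x) - P n (g k x))) \<longlonglongrightarrow> 0"
      using AEN
    proof (rule AE_mp, intro AE_I2 impI)
      fix x assume "x \<in> space ?L" "x \<notin> N"
      then have "(\<lambda>k. g k x) \<longlonglongrightarrow> u x" using g(2)[of x] by simp
      moreover have "isCont (P n) (u x)" using P_cont continuous_on_eq_continuous_at by blast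
      ultimately have "(\<lambda>k. P n (g k x)) \<longlonglongrightarrow> P n (u x)" by (rule isCont_tendsto_compose[rotated])
      then have "(\<lambda>k. norm (P n (u x) - P n (g k x))) \<longlonglongrightarrow> norm (P n (u x) - P n (u x))"
        by (intro tendsto_intros)
      then show "(\<lambda>k. norm (P n (u x) - P n (g k x))) \<longlonglongrightarrow> 0" by simp
    qed
    show "AE x in ?L. norm (norm (P n (u x) - P n (g k x))) \<le> 2 * real n" for k
    proof (rule AE_I2)
      fix x
      show "norm (norm (P n (u x) - P n (g k x))) \<le> 2 * real n"
        using norm_triangle_ineq4[of "P n (u x)" "P n (g k x)"] P_le[of n "u x"] P_le[of n "g k x"] by simp
    qed
  qed auto
  then have "\<forall>\<^sub>F k in sequentially. (\<integral>x. norm (P n (u x) - P n (g k x)) \<partial>?L) < \<eta> / 2"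
    by (rule order_tendstoD) (use \<eta> in simp)
  then obtain k where k: "(\<integral>x. norm (P n (u x) - P n (g k x)) \<partial>?L) < \<eta> / 2"
    using eventually_happens'[OF sequentially_bot] by blast
  have Pg: "integrable ?L (\<lambda>x. P n (g k x))"
    by (rule L.integrable_const_bound[where B = n]) (use P_le in auto)
  show ?thesis
  proof (rule that[of "\<lambda>x. P n (g k x)"])
    show "continuous_on UNIV (\<lambda>x. P n (g k x))"
      by (rule continuous_on_compose2[OF P_cont g(1)]) simp
    have "(\<integral>x. norm (u x - P n (g k x)) \<partial>?L) \<le> (\<integral>x. norm (u x - P n (u x)) + norm (P n (u x) - P n (g k x)) \<partial>?L)"
    proof (rule integral_mono)
      fix x
      show "norm (u x - P n (g k x)) \<le> norm (u x - P n (u x)) + norm (P n (u x) - P n (g k x))"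
        using norm_triangle_ineq[of "u x - P n (u x)" "P n (u x) - P n (g k x)"] by simp
    qed (use u Pu Pg in auto)
    also have "\<dots> = (\<integral>x. norm (u x - P n (u x)) \<partial>?L) + (\<integral>x. norm (P n (u x) - P n (g k x)) \<partial>?L)"
      using u Pu Pg by (intro Bochner_Integration.integral_add) auto
    finally show "(\<integral>x. norm (u x - P n (g k x)) \<partial>?L) < \<eta>" using n k by simp
  qed (rule Pg)
qed

context open_distance
begin

lemma kern_integral_bound:
  fixes z :: "'a \<Rightarrow> real"
  assumes e: "0 < e" "e < 1" and M: "sigma_finite_measure M" "borel_carrier M (closure \<Omega>)"
    and z: "integrable M z" "\<And>y. z y \<ge> 0"
  shows "integrable (lebesgue_on \<Omega>) (\<lambda>x. \<integral>y. kern e x y * z y \<partial>M)"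
    and "(\<integral>x. (\<integral>y. kern e x y * z y \<partial>M) \<partial>lebesgue_on \<Omega>) \<le> mass_bound e * (\<integral>y. z y \<partial>M)"
proof -
  interpret borel_carrier M "closure \<Omega>" by (rule M)
  let ?A = "\<lambda>x. \<integral>y. kern e x y * z y \<partial>M"
  have A0: "?A x \<ge> 0" for x
    using kern_nonneg[of e x] z(2) e by (intro integral_nonneg_AE AE_I2) auto
  have int: "integrable M (\<lambda>y. kern e x y * z y)" if "x \<in> \<Omega>" for x
    using integrable_continuous_scaleR[OF continuous_slice[OF kern_cont[OF e(1)] that] z(1)] by simp
  have "continuous_on \<Omega> ?A"
    using continuous_on_integral_param[OF \<Omega>_open kern_cont[OF e(1)] z(1)] by simp
  then have m: "?A \<in> borel_measurable (lebesgue_on \<Omega>)"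
    by (rule integrable_continuous_on_open[OF \<Omega>_open])
  have "(\<integral>\<^sup>+x. ennreal (?A x) \<partial>lebesgue_on \<Omega>) = (\<integral>\<^sup>+x. (\<integral>\<^sup>+y. ennreal (kern e x y) * ennreal (z y) \<partial>M) \<partial>lebesgue_on \<Omega>)"
  proof (rule nn_integral_cong)
    fix x assume "x \<in> space (lebesgue_on \<Omega>)"
    then have "x \<in> \<Omega>" by simp
    have "ennreal (?A x) = (\<integral>\<^sup>+y. ennreal (kern e x y * z y) \<partial>M)"
      using kern_nonneg[of e x] z(2) e by (intro nn_integral_eq_integral[symmetric] int \<open>x \<in> \<Omega>\<close>) auto
    then show "ennreal (?A x) = (\<integral>\<^sup>+y. ennreal (kern e x y) * ennreal (z y) \<partial>M)"
      using kern_nonneg[of e x] z(2) e by (simp add: ennreal_mult)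
  qed
  also have "\<dots> \<le> ennreal (mass_bound e) * (\<integral>\<^sup>+y. ennreal (z y) \<partial>M)"
    using borel_measurable_integrable[OF z(1)] by (intro kern_tonelli e M) measurable
  also have "(\<integral>\<^sup>+y. ennreal (z y) \<partial>M) = ennreal (\<integral>y. z y \<partial>M)"
    using z by (intro nn_integral_eq_integral) auto
  also have "ennreal (mass_bound e) * ennreal (\<integral>y. z y \<partial>M) = ennreal (mass_bound e * (\<integral>y. z y \<partial>M))"
    using mass_bound_nonneg[OF e] z by (simp add: ennreal_mult)
  finally have le: "(\<integral>\<^sup>+x. ennreal (?A x) \<partial>lebesgue_on \<Omega>) \<le> ennreal (mass_bound e * (\<integral>y. z y \<partial>M))" .
  show i: "integrable (lebesgue_on \<Omega>) ?A"
    by (rule integrableI_nonneg[OF m]) (use A0 le_less_trans[OF le ennreal_less_top] in auto)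
  have "ennreal (\<integral>x. ?A x \<partial>lebesgue_on \<Omega>) \<le> ennreal (mass_bound e * (\<integral>y. z y \<partial>M))"
    using le nn_integral_eq_integral[OF i] A0 by simp
  then show "(\<integral>x. ?A x \<partial>lebesgue_on \<Omega>) \<le> mass_bound e * (\<integral>y. z y \<partial>M)"
    using mass_bound_nonneg[OF e] z by (subst (asm) ennreal_le_iff) auto
qed

definition smooth :: "real \<Rightarrow> ('a \<Rightarrow> 'c::euclidean_space) \<Rightarrow> 'a \<Rightarrow> 'c" where
  "smooth e u x = (\<integral>y. kern e x y *\<^sub>R u y \<partial>lebesgue_on \<Omega>)"

lemma integrable_kern:
  fixes u :: "'a \<Rightarrow> 'c::euclidean_space"
  assumes "e > 0" "x \<in> \<Omega>" "borel_carrier M (closure \<Omega>)" "integrable M u"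
  shows "integrable M (\<lambda>y. kern e x y *\<^sub>R u y)"
proof -
  interpret borel_carrier M "closure \<Omega>" by fact
  show ?thesis by (rule integrable_continuous_scaleR[OF continuous_slice[OF kern_cont] assms(4)]) (use assms in auto)
qed

lemma norm_integral_kern_le:
  fixes u :: "'a \<Rightarrow> 'c::euclidean_space"
  assumes "e > 0" "x \<in> \<Omega>" "borel_carrier M (closure \<Omega>)" "integrable M u"
  shows "norm (\<integral>y. kern e x y *\<^sub>R u y \<partial>M) \<le> (\<integral>y. kern e x y * norm (u y) \<partial>M)"
  using kern_nonneg[of e x] assms integrable_kern[OF assms]
    integrable_kern[OF assms(1-3) integrable_norm[OF assms(4)]]
  by (intro Bochner_Integration.integral_norm_bound_integral) auto

lemma integral_kern:
  assumes "0 < e" "e < 1" "x \<in> \<Omega>"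
  shows "(\<integral>y. kern e x y \<partial>lebesgue_on \<Omega>) = 1"
  using nn_integral_kern_fst[OF assms] kern_nonneg[of e x] assms
  by (subst integral_eq_nn_integral) (auto intro: borel_lebesgue_on)

lemma smooth_integrable:
  fixes u :: "'a \<Rightarrow> 'c::euclidean_space"
  assumes e: "0 < e" "e < 1" and u: "integrable (lebesgue_on \<Omega>) u"
  shows "integrable (lebesgue_on \<Omega>) (smooth e u)"
    and "(\<integral>x. norm (smooth e u x) \<partial>lebesgue_on \<Omega>) \<le> mass_bound e * (\<integral>x. norm (u x) \<partial>lebesgue_on \<Omega>)"
proof -
  interpret L: finite_measure "lebesgue_on \<Omega>" by (rule finite_measure_\<Omega>)
  interpret borel_carrier "lebesgue_on \<Omega>" "closure \<Omega>" by (rule borel_carrier_lebesgue)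
  note B = kern_integral_bound[OF e L.sigma_finite_measure_axioms borel_carrier_lebesgue integrable_norm[OF u] norm_ge_zero]
  note le = norm_integral_kern_le[OF e(1) _ borel_carrier_lebesgue u]
  have "continuous_on \<Omega> (smooth e u)"
    unfolding smooth_def by (rule continuous_on_integral_param[OF \<Omega>_open kern_cont[OF e(1)] u])
  then have m: "smooth e u \<in> borel_measurable (lebesgue_on \<Omega>)"
    by (rule integrable_continuous_on_open[OF \<Omega>_open])
  show i: "integrable (lebesgue_on \<Omega>) (smooth e u)"
    by (rule Bochner_Integration.integrable_bound[OF B(1) m])
      (use le in \<open>auto intro!: AE_I2 simp: smooth_def intro: order_trans[OF _ abs_ge_self]\<close>)
  have "(\<integral>x. norm (smooth e u x) \<partial>lebesgue_on \<Omega>) \<le> (\<integral>x. (\<integral>y. kern e x y * norm (u y) \<partial>lebesgue_on \<Omega>) \<partial>lebesgue_on \<Omega>)"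
    by (rule integral_mono[OF integrable_norm[OF i] B(1)]) (use le in \<open>auto simp: smooth_def\<close>)
  then show "(\<integral>x. norm (smooth e u x) \<partial>lebesgue_on \<Omega>) \<le> mass_bound e * (\<integral>x. norm (u x) \<partial>lebesgue_on \<Omega>)"
    using B(2) by linarith
qed

lemma smooth_continuous_near:
  fixes \<phi> :: "'a \<Rightarrow> 'c::euclidean_space"
  assumes e: "0 < e" "e < 1" and x: "x \<in> \<Omega>" and \<phi>: "integrable (lebesgue_on \<Omega>) \<phi>"
    and near: "\<And>y. y \<in> \<Omega> \<Longrightarrow> norm (x - y) < e * d x \<Longrightarrow> norm (\<phi> y - \<phi> x) \<le> \<eta>"
  shows "norm (smooth e \<phi> x - \<phi> x) \<le> \<eta>"
proof -
  interpret L: finite_measure "lebesgue_on \<Omega>" by (rule finite_measure_\<Omega>)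
  have ik: "integrable (lebesgue_on \<Omega>) (kern e x)"
    using integrable_kern[OF e(1) x borel_carrier_lebesgue, of "\<lambda>_. 1 :: real"] by simp
  have i: "integrable (lebesgue_on \<Omega>) (\<lambda>y. kern e x y *\<^sub>R \<phi> y)"
    by (rule integrable_kern[OF e(1) x borel_carrier_lebesgue \<phi>])
  have "smooth e \<phi> x - \<phi> x = (\<integral>y. kern e x y *\<^sub>R \<phi> y \<partial>lebesgue_on \<Omega>) - (\<integral>y. kern e x y \<partial>lebesgue_on \<Omega>) *\<^sub>R \<phi> x"
    by (simp add: smooth_def integral_kern[OF e x])
  also have "\<dots> = (\<integral>y. kern e x y *\<^sub>R (\<phi> y - \<phi> x) \<partial>lebesgue_on \<Omega>)"
    using ik i by (simp add: scaleR_diff_right)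
  also have "norm \<dots> \<le> (\<integral>y. kern e x y * \<eta> \<partial>lebesgue_on \<Omega>)"
  proof (rule Bochner_Integration.integral_norm_bound_integral)
    show "integrable (lebesgue_on \<Omega>) (\<lambda>y. kern e x y *\<^sub>R (\<phi> y - \<phi> x))"
      using ik i by (simp add: scaleR_diff_right)
    fix y assume "y \<in> space (lebesgue_on \<Omega>)"
    then have y: "y \<in> \<Omega>" by simp
    show "norm (kern e x y *\<^sub>R (\<phi> y - \<phi> x)) \<le> kern e x y * \<eta>"
    proof (cases "kern e x y = 0")
      case False
      then have "norm (\<phi> y - \<phi> x) \<le> \<eta>" using kern_support(1)[of e x y] e by (intro near y) auto
      then show ?thesis using kern_nonneg[of e x y] e by (simp add: mult_left_mono)
    qed simp
  qed (use ik in simp)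
  also have "\<dots> = \<eta>" by (simp add: integral_kern[OF e x])
  finally show ?thesis .
qed

text \<open>The operators \<open>smooth e\<close> are bounded on \<open>L^1\<close> uniformly for
  small e, so it suffices to treat a dense class; for uniformly continuous functions the convergence
  is uniform because the radii are at most e times the maximum of d.\<close>

lemma smooth_L1_tendsto:
  fixes u :: "'a \<Rightarrow> 'c::euclidean_space"
  assumes u: "integrable (lebesgue_on \<Omega>) u"
  shows "((\<lambda>e. \<integral>x. norm (smooth e u x - u x) \<partial>lebesgue_on \<Omega>) \<longlongrightarrow> 0) (at_right 0)"
proof (rule tendstoI)
  fix \<eta> :: real assume \<eta>: "\<eta> > 0"
  let ?L = "lebesgue_on \<Omega>"
  interpret L: finite_measure ?L by (rule finite_measure_\<Omega>)
  define V where "V = measure ?L \<Omega>"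
  have V: "V \<ge> 0" by (simp add: V_def)
  obtain \<phi> where \<phi>: "continuous_on UNIV \<phi>" "integrable ?L \<phi>" "(\<integral>x. norm (u x - \<phi> x) \<partial>?L) < \<eta> / 4"
    using continuous_dense_L1[OF \<Omega>_open \<Omega>_bounded u, of "\<eta> / 4"] \<eta> by auto
  \<comment> \<open>The density error \<eta> / 4 is at most doubled by mollification, since
    \<open>mass_bound e < 2\<close>. It counts once more unmollified, and \<eta>' leaves the last
    quarter for the continuous function.\<close>
  define \<eta>' where "\<eta>' = \<eta> / (4 * (V + 1))"
  have \<eta>': "\<eta>' > 0" using \<eta> V by (simp add: \<eta>'_def)
  have "uniformly_continuous_on (closure \<Omega>) \<phi>"
    by (rule compact_uniformly_continuous[OF continuous_on_subset[OF \<phi>(1)] compact_closure_\<Omega>]) simp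
  then obtain \<delta> where \<delta>: "\<delta> > 0" "\<And>x y. x \<in> closure \<Omega> \<Longrightarrow> y \<in> closure \<Omega> \<Longrightarrow> dist y x < \<delta> \<Longrightarrow> dist (\<phi> y) (\<phi> x) < \<eta>'"
    unfolding uniformly_continuous_on_def using \<eta>' by metis
  have "compact (d ` closure \<Omega>)"
    using compact_continuous_image[OF continuous_on_subset[OF d_cont] compact_closure_\<Omega>] by simp
  from compact_imp_bounded[OF this] obtain D where "\<forall>z\<in>d ` closure \<Omega>. norm z \<le> D"
    unfolding bounded_iff by (elim exE)
  then have D: "d x \<le> D" if "x \<in> \<Omega>" for x
    using that closure_subset by fastforce
  define D' where "D' = max D 1"
  have D': "D' > 0" "\<And>x. x \<in> \<Omega> \<Longrightarrow> d x \<le> D'" using D by (auto simp: D'_def le_max_iff_disj)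
  have near: "norm (\<phi> y - \<phi> x) \<le> \<eta>'" if "0 < e" "e < \<delta> / D'" "x \<in> \<Omega>" "y \<in> \<Omega>" "norm (x - y) < e * d x" for e x y
  proof -
    have "e * d x \<le> e * D'" using D' that by (intro mult_left_mono) auto
    also have "\<dots> < \<delta>" using that(2) D' by (simp add: pos_less_divide_eq)
    finally have "dist y x < \<delta>" using that(5) by (simp add: dist_norm norm_minus_commute)
    then have "dist (\<phi> y) (\<phi> x) < \<eta>'" using \<delta>(2)[of x y] that closure_subset by blast
    then show ?thesis by (simp add: dist_norm)
  qed
  have mb: "\<forall>\<^sub>F e in at_right 0. mass_bound e < 2"
    by (rule order_tendstoD[OF mass_bound_tendsto]) simp
  have "\<forall>\<^sub>F e in at_right 0. 0 < e \<and> e < min 1 (\<delta> / D')"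
    unfolding eventually_at_right_field using \<delta>(1) D' by (intro exI[of _ "min 1 (\<delta> / D')"]) auto
  then show "\<forall>\<^sub>F e in at_right 0. dist (\<integral>x. norm (smooth e u x - u x) \<partial>?L) 0 < \<eta>"
    using mb
  proof eventually_elim
    case (elim e)
    then have e: "0 < e" "e < 1" "e < \<delta> / D'" by auto
    note su = smooth_integrable[OF e(1,2) u] and s\<phi> = smooth_integrable[OF e(1,2) \<phi>(2)]
    have u\<phi>: "integrable ?L (\<lambda>x. u x - \<phi> x)" using u \<phi>(2) by simp
    note sd = smooth_integrable[OF e(1,2) u\<phi>]
    have lin: "smooth e u x - smooth e \<phi> x = smooth e (\<lambda>x. u x - \<phi> x) x" if "x \<in> \<Omega>" for x
      unfolding smooth_def
      using integrable_kern[OF e(1) that borel_carrier_lebesgue u] integrable_kern[OF e(1) that borel_carrier_lebesgue \<phi>(2)]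
      by (simp add: scaleR_diff_right)
    have "(\<integral>x. norm (smooth e u x - u x) \<partial>?L)
        \<le> (\<integral>x. norm (smooth e (\<lambda>x. u x - \<phi> x) x) + \<eta>' + norm (u x - \<phi> x) \<partial>?L)"
    proof (rule integral_mono)
      fix x assume "x \<in> space ?L"
      then have x: "x \<in> \<Omega>" by simp
      have "norm (smooth e \<phi> x - \<phi> x) \<le> \<eta>'"
        by (rule smooth_continuous_near[OF e(1,2) x \<phi>(2)]) (use near e x in auto)
      moreover have "smooth e u x - u x = smooth e (\<lambda>x. u x - \<phi> x) x + (smooth e \<phi> x - \<phi> x) - (u x - \<phi> x)"
        using lin[OF x] by (simp add: algebra_simps)
      ultimately show "norm (smooth e u x - u x) \<le> norm (smooth e (\<lambda>x. u x - \<phi> x) x) + \<eta>' + norm (u x - \<phi> x)"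
        using norm_triangle_ineq4[of "smooth e (\<lambda>x. u x - \<phi> x) x + (smooth e \<phi> x - \<phi> x)" "u x - \<phi> x"]
          norm_triangle_ineq[of "smooth e (\<lambda>x. u x - \<phi> x) x" "smooth e \<phi> x - \<phi> x"] by simp
    qed (use su sd u \<phi>(2) in auto)
    also have "\<dots> = (\<integral>x. norm (smooth e (\<lambda>x. u x - \<phi> x) x) \<partial>?L) + V * \<eta>' + (\<integral>x. norm (u x - \<phi> x) \<partial>?L)"
      using sd u \<phi>(2) by (simp add: V_def)
    also have "\<dots> < \<eta> / 2 + V * \<eta>' + \<eta> / 4"
    proof -
      have "mass_bound e * (\<integral>x. norm (u x - \<phi> x) \<partial>?L) \<le> 2 * (\<eta> / 4)"
        using elim(2) \<phi>(3) mass_bound_nonneg[OF e(1,2)] by (intro mult_mono) auto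
      then show ?thesis using sd(2) \<phi>(3) by linarith
    qed
    also have "V * \<eta>' \<le> \<eta> / 4"
    proof -
      have "V * \<eta>' = \<eta> / 4 * (V / (V + 1))" by (simp add: \<eta>'_def)
      also have "\<dots> \<le> \<eta> / 4 * 1" using V \<eta> by (intro mult_left_mono) auto
      finally show ?thesis by simp
    qed
    finally show ?case by (simp add: abs_of_nonneg)
  qed
qed

end

section \<open>Gradients of mollified functions of bounded variation\<close>

text \<open>The weight k1 is a probability density, so the tangent plane at the mean a gives
  Jensen's inequality for g. The weight k2 has arbitrary mass; its part is added through
  \<open>F_add_le\<close>, with the subgradient at a + b bounded by the recession function.\<close>

lemma (in linear_growth_density) jensen_add:
  assumes "\<And>y. k1 y \<ge> 0" "integrable M1 k1" "(\<integral>y. k1 y \<partial>M1) = 1"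
    and i1: "integrable M1 (\<lambda>y. k1 y *\<^sub>R g y)" "integrable M1 (\<lambda>y. k1 y * F (g y))"
    and "\<And>y. k2 y \<ge> 0"
    and i2: "integrable M2 (\<lambda>y. k2 y *\<^sub>R h y)" "integrable M2 (\<lambda>y. k2 y * recession F (h y))"
  shows "F ((\<integral>y. k1 y *\<^sub>R g y \<partial>M1) + (\<integral>y. k2 y *\<^sub>R h y \<partial>M2))
    \<le> (\<integral>y. k1 y * F (g y) \<partial>M1) + (\<integral>y. k2 y * recession F (h y) \<partial>M2)"
proof -
  define a b where "a = (\<integral>y. k1 y *\<^sub>R g y \<partial>M1)" and "b = (\<integral>y. k2 y *\<^sub>R h y \<partial>M2)"
  have ii: "integrable M1 (\<lambda>y. DF a \<bullet> (k1 y *\<^sub>R g y))" "integrable M2 (\<lambda>y. DF (a + b) \<bullet> (k2 y *\<^sub>R h y))"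
    by (rule integrable_inner_right, use i1 i2 in simp)+
  have "DF a \<bullet> a = (\<integral>y. DF a \<bullet> (k1 y *\<^sub>R g y) \<partial>M1)"
    unfolding a_def by (rule integral_inner_right[symmetric]) (use i1 in simp)
  moreover have "F a - DF a \<bullet> a = (\<integral>y. (F a - DF a \<bullet> a) * k1 y \<partial>M1)" using assms by simp
  ultimately have "F a = (\<integral>y. (F a - DF a \<bullet> a) * k1 y \<partial>M1) + (\<integral>y. DF a \<bullet> (k1 y *\<^sub>R g y) \<partial>M1)"
    by linarith
  also have "(\<integral>y. (F a - DF a \<bullet> a) * k1 y \<partial>M1) + (\<integral>y. DF a \<bullet> (k1 y *\<^sub>R g y) \<partial>M1)
      = (\<integral>y. (F a - DF a \<bullet> a) * k1 y + DF a \<bullet> (k1 y *\<^sub>R g y) \<partial>M1)"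
    using assms ii by (intro Bochner_Integration.integral_add[symmetric]) auto
  also have "\<dots> \<le> (\<integral>y. k1 y * F (g y) \<partial>M1)"
  proof (rule integral_mono)
    fix y
    have "k1 y * (F a + DF a \<bullet> (g y - a)) \<le> k1 y * F (g y)"
      using assms F_subgradient by (intro mult_left_mono) auto
    then show "(F a - DF a \<bullet> a) * k1 y + DF a \<bullet> (k1 y *\<^sub>R g y) \<le> k1 y * F (g y)"
      by (simp add: inner_diff_right algebra_simps)
  qed (use assms ii in auto)
  finally have 1: "F a \<le> (\<integral>y. k1 y * F (g y) \<partial>M1)" .
  have "DF (a + b) \<bullet> b = (\<integral>y. DF (a + b) \<bullet> (k2 y *\<^sub>R h y) \<partial>M2)"
    unfolding b_def by (rule integral_inner_right[symmetric]) (use i2 in simp)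
  also have "\<dots> \<le> (\<integral>y. k2 y * recession F (h y) \<partial>M2)"
  proof (rule integral_mono)
    fix y show "DF (a + b) \<bullet> (k2 y *\<^sub>R h y) \<le> k2 y * recession F (h y)"
      using DF_le_recession[of "a + b" "h y"] assms by (simp add: mult_left_mono)
  qed (use i2 ii in auto)
  finally show ?thesis using 1 F_add_le[of a b] by (simp add: a_def b_def)
qed

locale open_distance_bv = open_distance \<Omega> d dd
  for \<Omega> :: "(real^'n) set" and d dd +
  fixes u :: "real^'n \<Rightarrow> real^'m" and g :: "real^'n \<Rightarrow> real^'n^'m" and \<nu> :: "(real^'n) measure"
    and h :: "real^'n \<Rightarrow> real^'n^'m"
  assumes u_int: "integrable (lebesgue_on \<Omega>) u" and repr: "bv_repr \<Omega> u (g, \<nu>, h)"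
begin

lemma g_int: "integrable (lebesgue_on \<Omega>) g" and h_int: "integrable \<nu> h"
  and \<nu>_sets: "sets \<nu> = sets (restrict_space borel \<Omega>)" and \<nu>_finite: "finite_measure \<nu>"
  using repr by (auto simp: bv_repr_def Lp_on_1)

lemma bcL: "borel_carrier (lebesgue_on \<Omega>) (closure \<Omega>)" and bc\<nu>: "borel_carrier \<nu> (closure \<Omega>)"
  by (rule borel_carrier_lebesgue, rule borel_carrier_restrict[OF \<nu>_sets])

lemma sfL: "sigma_finite_measure (lebesgue_on \<Omega>)" and sf\<nu>: "sigma_finite_measure \<nu>"
  using finite_measure_\<Omega> \<nu>_finite finite_measure.axioms(1) by auto

lemma bv_test:
  assumes "test_fun \<Omega> \<phi> d\<phi>"
  shows "(\<integral>x. u x $ k * d\<phi> x $ i \<partial>lebesgue_on \<Omega>)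
    = - ((\<integral>x. g x $ k $ i * \<phi> x \<partial>lebesgue_on \<Omega>) + (\<integral>x. h x $ k $ i * \<phi> x \<partial>\<nu>))"
  using repr assms unfolding bv_repr_def by blast

definition total_var :: real where
  "total_var = (\<integral>x. norm (g x) \<partial>lebesgue_on \<Omega>) + (\<integral>x. norm (h x) \<partial>\<nu>)"

definition smooth_var :: "real \<Rightarrow> real^'n \<Rightarrow> real" where
  "smooth_var e x = (\<integral>y. kern e x y * norm (g y) \<partial>lebesgue_on \<Omega>) + (\<integral>y. kern e x y * norm (h y) \<partial>\<nu>)"

definition smooth_measure :: "real \<Rightarrow> real^'n \<Rightarrow> real^'n^'m" where
  "smooth_measure e x = (\<integral>y. kern e x y *\<^sub>R g y \<partial>lebesgue_on \<Omega>) + (\<integral>y. kern e x y *\<^sub>R h y \<partial>\<nu>)"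

text \<open>The true gradient of the mollified function, as a matrix. It differs from
  \<open>smooth_measure\<close>, the mollified gradient measure, because the radius varies with
  x.\<close>

definition smooth_grad :: "real \<Rightarrow> real^'n \<Rightarrow> real^'n^'m" where
  "smooth_grad e x = (\<chi> k i. (\<integral>y. (dkern_x e x y \<bullet> axis i 1) *\<^sub>R u y \<partial>lebesgue_on \<Omega>) $ k)"

lemma total_var_nonneg: "total_var \<ge> 0"
  unfolding total_var_def by (intro add_nonneg_nonneg integral_nonneg_AE AE_I2) auto

lemma smooth_var_integral:
  assumes e: "0 < e" "e < 1"
  shows "integrable (lebesgue_on \<Omega>) (smooth_var e)"
    and "(\<integral>x. smooth_var e x \<partial>lebesgue_on \<Omega>) \<le> mass_bound e * total_var"
proof -
  note L = kern_integral_bound[OF e sfL bcL integrable_norm[OF g_int] norm_ge_zero]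
    and N = kern_integral_bound[OF e sf\<nu> bc\<nu> integrable_norm[OF h_int] norm_ge_zero]
  show "integrable (lebesgue_on \<Omega>) (smooth_var e)"
    unfolding smooth_var_def[abs_def] by (intro Bochner_Integration.integrable_add L N)
  have "(\<integral>x. smooth_var e x \<partial>lebesgue_on \<Omega>)
      = (\<integral>x. \<integral>y. kern e x y * norm (g y) \<partial>lebesgue_on \<Omega> \<partial>lebesgue_on \<Omega>)
        + (\<integral>x. \<integral>y. kern e x y * norm (h y) \<partial>\<nu> \<partial>lebesgue_on \<Omega>)"
    unfolding smooth_var_def by (rule Bochner_Integration.integral_add[OF L(1) N(1)])
  then show "(\<integral>x. smooth_var e x \<partial>lebesgue_on \<Omega>) \<le> mass_bound e * total_var"
    using L(2) N(2) by (simp add: total_var_def distrib_left)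
qed

lemma smooth_measure_le:
  assumes e: "0 < e" and x: "x \<in> \<Omega>"
  shows "norm (smooth_measure e x) \<le> smooth_var e x"
  unfolding smooth_measure_def smooth_var_def
  by (intro norm_triangle_le add_mono norm_integral_kern_le e x bcL bc\<nu> g_int h_int)

lemma smooth_deriv:
  assumes e: "0 < e" and x: "x \<in> \<Omega>"
  shows "(smooth e u has_derivative (\<lambda>z. smooth_grad e x *v z)) (at x)"
proof -
  interpret borel_carrier "lebesgue_on \<Omega>" "closure \<Omega>" by (rule bcL)
  define L where "L z = (\<integral>y. (dkern_x e x y \<bullet> z) *\<^sub>R u y \<partial>lebesgue_on \<Omega>)" for z
  have D: "(smooth e u has_derivative L) (at x)"
    unfolding smooth_def[abs_def] L_def
    by (rule has_derivative_integral_param[OF \<Omega>_open x kern_cont[OF e] dkern_x_cont[OF e] kern_deriv_x[OF e] u_int])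
  have "linear L" using D has_derivative_linear by blast
  then have "matrix L *v z = L z" for z
    by (simp add: matrix_works linear_matrix_vector_mul_eq)
  moreover have "smooth_grad e x = matrix L"
    by (simp add: smooth_grad_def matrix_def L_def)
  ultimately show ?thesis using D by simp
qed

lemma smooth_grad_cont:
  assumes e: "0 < e"
  shows "continuous_on \<Omega> (smooth_grad e)"
proof -
  interpret borel_carrier "lebesgue_on \<Omega>" "closure \<Omega>" by (rule bcL)
  have "continuous_on (\<Omega> \<times> UNIV) (\<lambda>(x, y). dkern_x e x y \<bullet> axis i 1)" for i
    using dkern_x_cont[OF e] unfolding case_prod_beta by (intro continuous_intros)
  from continuous_on_integral_param[OF \<Omega>_open this u_int] show ?thesis
    unfolding smooth_grad_def[abs_def] by (intro continuous_intros)
qed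

lemma kern_component_int:
  assumes e: "0 < e" "e < 1" and x: "x \<in> \<Omega>"
  shows "integrable (lebesgue_on \<Omega>) (\<lambda>y. u y $ k * (dkern_y e x y \<bullet> b))"
    and "integrable (lebesgue_on \<Omega>) (\<lambda>y. u y $ k * (dpsi e c x y \<bullet> b))"
  using integrable_test_fun_lebesgue_on(2)[OF test_fun_kern(1)[OF e x] integrable_vec_nth[OF u_int]]
    integrable_test_fun_lebesgue_on(2)[OF test_fun_kern(2)[OF e x] integrable_vec_nth[OF u_int]]
  by auto

text \<open>Tested with the field, the definition of the distributional gradient trades the
  derivative of \<open>psi\<close> for the gradient measure of u, and \<open>psi_le\<close> replaces
  \<open>psi\<close> by the kernel.\<close>

lemma psi_integral_le:
  assumes e: "0 < e" "e < 1" and x: "x \<in> \<Omega>" and b: "b \<in> Basis"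
  shows "\<bar>\<integral>y. u y $ k * (dpsi e b x y \<bullet> b) \<partial>lebesgue_on \<Omega>\<bar> \<le> smooth_var e x"
proof -
  obtain j where j: "b = axis j 1" using b by (auto simp: Basis_vec_def)
  have T: "test_fun \<Omega> (psi e b x) (dpsi e b x)" by (rule test_fun_kern(2)[OF e x])
  have le: "norm (f y $ k $ j * psi e b x y) \<le> kern e x y * norm (f y)" for f :: "real^'n \<Rightarrow> real^'n^'m" and y
  proof -
    have "\<bar>f y $ k $ j\<bar> \<le> norm (f y)"
      by (meson component_le_norm_cart Finite_Cartesian_Product.norm_nth_le order_trans)
    moreover have "\<bar>psi e b x y\<bar> \<le> kern e x y" using psi_le[of e b x y] e b by simp
    ultimately have "\<bar>f y $ k $ j\<bar> * \<bar>psi e b x y\<bar> \<le> norm (f y) * kern e x y"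
      by (intro mult_mono) auto
    then show ?thesis by (simp add: abs_mult mult.commute)
  qed
  have "\<bar>\<integral>y. g y $ k $ j * psi e b x y \<partial>lebesgue_on \<Omega>\<bar> \<le> (\<integral>y. kern e x y * norm (g y) \<partial>lebesgue_on \<Omega>)"
    using Bochner_Integration.integral_norm_bound_integral[of "lebesgue_on \<Omega>" "\<lambda>y. g y $ k $ j * psi e b x y" "\<lambda>y. kern e x y * norm (g y)"]
      integrable_test_fun_lebesgue_on(1)[OF T integrable_vec_nth[OF integrable_vec_nth[OF g_int]]]
      integrable_kern[OF e(1) x bcL integrable_norm[OF g_int]] le[of g] by simp
  moreover have "\<bar>\<integral>y. h y $ k $ j * psi e b x y \<partial>\<nu>\<bar> \<le> (\<integral>y. kern e x y * norm (h y) \<partial>\<nu>)"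
    using Bochner_Integration.integral_norm_bound_integral[of \<nu> "\<lambda>y. h y $ k $ j * psi e b x y" "\<lambda>y. kern e x y * norm (h y)"]
      integrable_test_fun_measure[OF T \<nu>_sets integrable_vec_nth[OF integrable_vec_nth[OF h_int]]]
      integrable_kern[OF e(1) x bc\<nu> integrable_norm[OF h_int]] le[of h] by simp
  moreover have "(\<integral>y. u y $ k * (dpsi e b x y \<bullet> b) \<partial>lebesgue_on \<Omega>)
      = - ((\<integral>y. g y $ k $ j * psi e b x y \<partial>lebesgue_on \<Omega>) + (\<integral>y. h y $ k $ j * psi e b x y \<partial>\<nu>))"
    using bv_test[OF T, of k j] by (simp add: j inner_axis)
  ultimately show ?thesis unfolding smooth_var_def by linarith
qed

text \<open>In \<open>dkern_x_eq\<close> the term \<open>- dkern_y\<close> reproduces the mollified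
  gradient measure exactly. What remains is e * dd x times one integral for each of the CARD('n)
  directions; summing over the CARD('m) * CARD('n) entries gives the constant.\<close>

lemma smooth_grad_near:
  assumes e: "0 < e" "e < 1" and x: "x \<in> \<Omega>"
  shows "norm (smooth_grad e x - smooth_measure e x) \<le> real (CARD('m) * CARD('n) * CARD('n)) * e * smooth_var e x"
proof -
  have comp: "\<bar>smooth_grad e x $ k $ i - smooth_measure e x $ k $ i\<bar> \<le> real CARD('n) * e * smooth_var e x" for k i
  proof -
    interpret borel_carrier "lebesgue_on \<Omega>" "closure \<Omega>" by (rule bcL)
    let ?b = "axis i 1 :: real^'n"
    have T: "test_fun \<Omega> (kern e x) (dkern_y e x)" by (rule test_fun_kern(1)[OF e x])
    have int: "integrable (lebesgue_on \<Omega>) (\<lambda>y. (dkern_x e x y \<bullet> ?b) *\<^sub>R u y)"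
      by (intro integrable_continuous_scaleR continuous_intros u_int continuous_slice[OF dkern_x_cont[OF e(1)] x])
    have "smooth_grad e x $ k $ i = (\<integral>y. ((dkern_x e x y \<bullet> ?b) *\<^sub>R u y) $ k \<partial>lebesgue_on \<Omega>)"
      unfolding smooth_grad_def by (simp add: integral_bounded_linear[OF bounded_linear_vec_nth int, symmetric])
    also have "\<dots> = (\<integral>y. - (u y $ k * (dkern_y e x y \<bullet> ?b))
        + (\<Sum>b\<in>Basis. u y $ k * (dpsi e b x y \<bullet> b)) * (e * (dd x \<bullet> ?b)) \<partial>lebesgue_on \<Omega>)"
      by (rule Bochner_Integration.integral_cong)
        (simp_all add: dkern_x_eq inner_add_left sum_distrib_left sum_distrib_right algebra_simps)
    also have "\<dots> = - (\<integral>y. u y $ k * (dkern_y e x y \<bullet> ?b) \<partial>lebesgue_on \<Omega>)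
        + (\<Sum>b\<in>Basis. (\<integral>y. u y $ k * (dpsi e b x y \<bullet> b) \<partial>lebesgue_on \<Omega>)) * (e * (dd x \<bullet> ?b))"
      using kern_component_int[OF e x] by (simp add: Bochner_Integration.integral_sum)
    also have "- (\<integral>y. u y $ k * (dkern_y e x y \<bullet> ?b) \<partial>lebesgue_on \<Omega>) = smooth_measure e x $ k $ i"
    proof -
      have c: "(\<integral>y. kern e x y *\<^sub>R f y \<partial>M) $ k $ i = (\<integral>y. f y $ k $ i * kern e x y \<partial>M)"
        if "integrable M (\<lambda>y. kern e x y *\<^sub>R f y)" for f :: "real^'n \<Rightarrow> real^'n^'m" and M
        using integral_bounded_linear[OF bounded_linear_vec_nth[of k] that]
          integral_bounded_linear[OF bounded_linear_vec_nth[of i] integrable_vec_nth[OF that, of k]]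
        by (simp add: mult.commute)
      show ?thesis
        using bv_test[OF T, of k i] c[OF integrable_kern[OF e(1) x bcL g_int]] c[OF integrable_kern[OF e(1) x bc\<nu> h_int]]
        by (simp add: smooth_measure_def inner_axis)
    qed
    finally have "smooth_grad e x $ k $ i - smooth_measure e x $ k $ i
        = (\<Sum>b\<in>Basis. (\<integral>y. u y $ k * (dpsi e b x y \<bullet> b) \<partial>lebesgue_on \<Omega>)) * (e * (dd x \<bullet> ?b))"
      by simp
    also have "\<bar>\<dots>\<bar> \<le> (real CARD('n) * smooth_var e x) * (e * 1)"
    proof -
      have "\<bar>\<Sum>b\<in>Basis. (\<integral>y. u y $ k * (dpsi e b x y \<bullet> b) \<partial>lebesgue_on \<Omega>)\<bar> \<le> (\<Sum>b\<in>(Basis :: (real^'n) set). smooth_var e x)"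
        by (rule order_trans[OF sum_abs]) (intro sum_mono psi_integral_le e x)
      moreover have "\<bar>dd x \<bullet> ?b\<bar> \<le> 1" using abs_inner_le[OF dd_le, of x ?b] by simp
      ultimately show ?thesis
        using e unfolding abs_mult by (intro mult_mono) auto
    qed
    finally show ?thesis by (simp add: mult_ac)
  qed
  have "norm (smooth_grad e x - smooth_measure e x) \<le> (\<Sum>k\<in>UNIV. norm ((smooth_grad e x - smooth_measure e x) $ k))"
    by (simp add: norm_vec_def L2_set_le_sum)
  also have "\<dots> \<le> (\<Sum>k\<in>(UNIV::'m set). \<Sum>i\<in>(UNIV::'n set). real CARD('n) * e * smooth_var e x)"
  proof (rule sum_mono)
    fix k
    have "norm ((smooth_grad e x - smooth_measure e x) $ k) \<le> (\<Sum>i\<in>UNIV. \<bar>(smooth_grad e x - smooth_measure e x) $ k $ i\<bar>)"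
      by (rule norm_le_l1_cart)
    also have "\<dots> \<le> (\<Sum>i\<in>(UNIV::'n set). real CARD('n) * e * smooth_var e x)"
      by (rule sum_mono) (use comp in simp)
    finally show "norm ((smooth_grad e x - smooth_measure e x) $ k) \<le> (\<Sum>i\<in>(UNIV::'n set). real CARD('n) * e * smooth_var e x)" .
  qed
  finally show ?thesis by (simp add: mult_ac)
qed

lemma smooth_grad_le:
  assumes e: "0 < e" "e < 1" and x: "x \<in> \<Omega>"
  shows "norm (smooth_grad e x) \<le> (1 + real (CARD('m) * CARD('n) * CARD('n)) * e) * smooth_var e x"
  using smooth_grad_near[OF e x] smooth_measure_le[OF e(1) x]
    norm_triangle_ineq[of "smooth_measure e x" "smooth_grad e x - smooth_measure e x"]
  by (simp add: algebra_simps)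

lemma smooth_grad_integral:
  assumes e: "0 < e" "e < 1"
  shows "integrable (lebesgue_on \<Omega>) (smooth_grad e)"
    and "(\<integral>x. norm (smooth_grad e x) \<partial>lebesgue_on \<Omega>) \<le> (1 + real (CARD('m) * CARD('n) * CARD('n)) * e) * (mass_bound e * total_var)"
proof -
  note V = smooth_var_integral[OF e]
  show i: "integrable (lebesgue_on \<Omega>) (smooth_grad e)"
    by (rule Bochner_Integration.integrable_bound[OF integrable_mult_right[OF V(1), of "1 + real (CARD('m) * CARD('n) * CARD('n)) * e"]
          integrable_continuous_on_open[OF \<Omega>_open smooth_grad_cont[OF e(1)]]])
      (use smooth_grad_le[OF e] in \<open>auto intro!: AE_I2 intro: order_trans[OF _ abs_ge_self]\<close>)
  have "(\<integral>x. norm (smooth_grad e x) \<partial>lebesgue_on \<Omega>) \<le> (\<integral>x. (1 + real (CARD('m) * CARD('n) * CARD('n)) * e) * smooth_var e x \<partial>lebesgue_on \<Omega>)"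
    by (rule integral_mono[OF integrable_norm[OF i] integrable_mult_right[OF V(1)]]) (use smooth_grad_le[OF e] in auto)
  also have "\<dots> = (1 + real (CARD('m) * CARD('n) * CARD('n)) * e) * (\<integral>x. smooth_var e x \<partial>lebesgue_on \<Omega>)" by simp
  also have "\<dots> \<le> (1 + real (CARD('m) * CARD('n) * CARD('n)) * e) * (mass_bound e * total_var)"
    using e by (intro mult_left_mono V(2)) auto
  finally show "(\<integral>x. norm (smooth_grad e x) \<partial>lebesgue_on \<Omega>) \<le> (1 + real (CARD('m) * CARD('n) * CARD('n)) * e) * (mass_bound e * total_var)" .
qed

text \<open>Jensen's inequality applies to the mollified measure, and the Lipschitz bound pays for
  passing from it to the true gradient. As e tends to 0 the right side tends to the gradient part of
  K.\<close>

lemma smooth_energy: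
  fixes F :: "real^'n^'m \<Rightarrow> real"
  assumes F: "linear_growth_density F DF \<nu>1 \<nu>2 \<nu>3" and e: "0 < e" "e < 1"
  shows "(\<integral>x. F (smooth_grad e x) \<partial>lebesgue_on \<Omega>)
    \<le> mass_bound e * ((\<integral>x. F (g x) \<partial>lebesgue_on \<Omega>) + (\<integral>x. recession F (h x) \<partial>\<nu>))
      + \<nu>1 * (real (CARD('m) * CARD('n) * CARD('n)) * e) * (mass_bound e * total_var)"
proof -
  interpret linear_growth_density F DF \<nu>1 \<nu>2 \<nu>3 by (rule F)
  interpret finite_measure "lebesgue_on \<Omega>" by (rule finite_measure_\<Omega>)
  have nu: "\<nu>1 \<ge> 0" using nu_pos by simp
  note [measurable] = borel_measurable_integrable[OF g_int] borel_measurable_integrable[OF h_int]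
  have Fg: "integrable (lebesgue_on \<Omega>) (\<lambda>x. F (g x))"
    by (rule Bochner_Integration.integrable_bound[OF integrable_mult_right[OF integrable_norm[OF g_int], of \<nu>1]])
      (use F_le_norm F_nonneg nu in auto)
  have Rh: "integrable \<nu> (\<lambda>x. recession F (h x))"
    by (rule Bochner_Integration.integrable_bound[OF integrable_mult_right[OF integrable_norm[OF h_int], of \<nu>1]])
      (use recession_le recession_nonneg nu in auto)
  note V = smooth_var_integral[OF e]
    and L = kern_integral_bound[OF e sfL bcL Fg F_nonneg] and N = kern_integral_bound[OF e sf\<nu> bc\<nu> Rh recession_nonneg]
  define B where "B x = (\<integral>y. kern e x y * F (g y) \<partial>lebesgue_on \<Omega>) + (\<integral>y. kern e x y * recession F (h y) \<partial>\<nu>)" for x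
  have pt: "F (smooth_grad e x) \<le> B x + \<nu>1 * (real (CARD('m) * CARD('n) * CARD('n)) * e) * smooth_var e x" if x: "x \<in> \<Omega>" for x
  proof -
    have "F (smooth_measure e x) \<le> B x"
      unfolding smooth_measure_def B_def
    proof (rule jensen_add)
      show "integrable (lebesgue_on \<Omega>) (kern e x)"
        using integrable_kern[OF e(1) x bcL, of "\<lambda>_. 1 :: real"] by simp
      show "integrable (lebesgue_on \<Omega>) (\<lambda>y. kern e x y * F (g y))"
        using integrable_kern[OF e(1) x bcL Fg] by simp
      show "integrable \<nu> (\<lambda>y. kern e x y * recession F (h y))"
        using integrable_kern[OF e(1) x bc\<nu> Rh] by simp
    qed (use e x in \<open>auto intro: kern_nonneg integral_kern integrable_kern bcL bc\<nu> g_int h_int\<close>)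
    moreover have "F (smooth_grad e x) - F (smooth_measure e x) \<le> \<nu>1 * ((real (CARD('m) * CARD('n) * CARD('n)) * e) * smooth_var e x)"
      using F_lipschitz[of "smooth_grad e x" "smooth_measure e x"]
        mult_left_mono[OF smooth_grad_near[OF e x] nu] by linarith
    ultimately show ?thesis by simp
  qed
  have iB: "integrable (lebesgue_on \<Omega>) B" unfolding B_def[abs_def] by (intro Bochner_Integration.integrable_add L N)
  have "(\<integral>x. F (smooth_grad e x) \<partial>lebesgue_on \<Omega>) \<le> (\<integral>x. B x + \<nu>1 * (real (CARD('m) * CARD('n) * CARD('n)) * e) * smooth_var e x \<partial>lebesgue_on \<Omega>)"
  proof (rule integral_mono)
    have [measurable]: "smooth_grad e \<in> borel_measurable (lebesgue_on \<Omega>)"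
      using smooth_grad_integral(1)[OF e] by simp
    show "integrable (lebesgue_on \<Omega>) (\<lambda>x. F (smooth_grad e x))"
      by (rule Bochner_Integration.integrable_bound[OF integrable_mult_right[OF integrable_norm[OF smooth_grad_integral(1)[OF e]], of \<nu>1]])
        (use F_le_norm F_nonneg nu in auto)
  qed (use pt iB V in auto)
  also have "\<dots> = (\<integral>x. B x \<partial>lebesgue_on \<Omega>) + \<nu>1 * (real (CARD('m) * CARD('n) * CARD('n)) * e) * (\<integral>x. smooth_var e x \<partial>lebesgue_on \<Omega>)"
    using iB V by simp
  also have "\<dots> \<le> mass_bound e * ((\<integral>x. F (g x) \<partial>lebesgue_on \<Omega>) + (\<integral>x. recession F (h x) \<partial>\<nu>))
      + \<nu>1 * (real (CARD('m) * CARD('n) * CARD('n)) * e) * (mass_bound e * total_var)"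
  proof (rule add_mono)
    show "(\<integral>x. B x \<partial>lebesgue_on \<Omega>) \<le> mass_bound e * ((\<integral>x. F (g x) \<partial>lebesgue_on \<Omega>) + (\<integral>x. recession F (h x) \<partial>\<nu>))"
      using L(2) N(2) Bochner_Integration.integral_add[OF L(1) N(1)] by (simp add: B_def distrib_left)
    show "\<nu>1 * (real (CARD('m) * CARD('n) * CARD('n)) * e) * (\<integral>x. smooth_var e x \<partial>lebesgue_on \<Omega>) \<le> \<nu>1 * (real (CARD('m) * CARD('n) * CARD('n)) * e) * (mass_bound e * total_var)"
      using e nu by (intro mult_left_mono V(2)) auto
  qed
  finally show ?thesis .
qed

end

section \<open>Approximation in energy\<close>

text \<open>Used twice with different dominants: \<open>norm (u x)\<close> when the truncation level
  grows, and a constant when truncated mollifications converge.\<close>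

lemma fidelity_tendsto:
  fixes w :: "nat \<Rightarrow> 'a::euclidean_space \<Rightarrow> 'c::euclidean_space"
  assumes p: "p > 0" and w: "\<And>j. w j \<in> borel_measurable (lebesgue_on S)" "v \<in> borel_measurable (lebesgue_on S)"
    and lim: "AE x in lebesgue_on S. (\<lambda>j. w j x) \<longlonglongrightarrow> v x"
    and b: "integrable (lebesgue_on S) (\<lambda>x. b x powr p)" "\<And>j x. x \<in> S \<Longrightarrow> norm (w j x) \<le> b x"
    and f: "f \<in> Lp_on p S"
  shows "(\<lambda>j. \<integral>x. norm (w j x - f x) powr p \<partial>lebesgue_on S) \<longlonglongrightarrow> (\<integral>x. norm (v x - f x) powr p \<partial>lebesgue_on S)"
proof (rule integral_dominated_convergence[where w = "\<lambda>x. 2 powr p * (b x powr p + norm (f x) powr p)"])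
  have fm[measurable]: "f \<in> borel_measurable (lebesgue_on S)"
    and fi: "integrable (lebesgue_on S) (\<lambda>x. norm (f x) powr p)"
    using f by (auto simp: Lp_on_def)
  note [measurable] = w
  show "(\<lambda>x. norm (v x - f x) powr p) \<in> borel_measurable (lebesgue_on S)"
    "(\<lambda>x. norm (w j x - f x) powr p) \<in> borel_measurable (lebesgue_on S)" for j by measurable
  show "integrable (lebesgue_on S) (\<lambda>x. 2 powr p * (b x powr p + norm (f x) powr p))" using b fi by simp
  show "AE x in lebesgue_on S. (\<lambda>j. norm (w j x - f x) powr p) \<longlonglongrightarrow> norm (v x - f x) powr p"
    using lim
  proof eventually_elim
    case (elim x)
    then have "(\<lambda>j. norm (w j x - f x)) \<longlonglongrightarrow> norm (v x - f x)" by (intro tendsto_intros)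
    then show ?case using p by (intro tendsto_powr') auto
  qed
  show "AE x in lebesgue_on S. norm (norm (w j x - f x) powr p) \<le> 2 powr p * (b x powr p + norm (f x) powr p)" for j
  proof (rule AE_I2)
    fix x assume "x \<in> space (lebesgue_on S)"
    then have "norm (w j x) powr p \<le> b x powr p" using b(2)[of x j] p by (intro powr_mono2) auto
    then have le: "2 powr p * (norm (w j x) powr p + norm (- f x) powr p) \<le> 2 powr p * (b x powr p + norm (f x) powr p)"
      by (intro mult_left_mono add_right_mono) auto
    have "norm (w j x + - f x) powr p \<le> 2 powr p * (norm (w j x) powr p + norm (- f x) powr p)"
      by (rule norm_add_powr_le) (use p in simp)
    from order_trans[OF this le]
    show "norm (norm (w j x - f x) powr p) \<le> 2 powr p * (b x powr p + norm (f x) powr p)" by simp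
  qed
qed

text \<open>A logarithmic cutoff: \<open>\<parallel>v\<parallel> \<parallel>D\<theta>(v)\<parallel>\<close> is uniformly small, so multiplying by \<open>\<theta>\<close> truncates
  \<open>v\<close> while changing its gradient, up to a small error, only by a scalar factor in \<open>[0, 1]\<close>.\<close>

definition log_cutoff :: "real \<Rightarrow> real \<Rightarrow> 'c::euclidean_space \<Rightarrow> real" where
  "log_cutoff \<delta> N v = pos_sq (1 - \<delta> * ln (1 + (v \<bullet> v) / N\<^sup>2))"

definition log_cutoff_grad :: "real \<Rightarrow> real \<Rightarrow> 'c::euclidean_space \<Rightarrow> 'c" where
  "log_cutoff_grad \<delta> N v =
    (- (4 * \<delta> * max 0 (1 - \<delta> * ln (1 + (v \<bullet> v) / N\<^sup>2)) / (N\<^sup>2 + v \<bullet> v))) *\<^sub>R v"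

context
  fixes \<delta> N :: real
  assumes \<delta>: "\<delta> > 0" and N: "N > 0"
begin

lemma log_cutoff_arg_pos: "1 + (v \<bullet> v) / N\<^sup>2 > 0" for v :: "'c::euclidean_space"
  by (rule add_pos_nonneg) auto

lemma log_cutoff_max_le: "max 0 (1 - \<delta> * ln (1 + (v \<bullet> v) / N\<^sup>2)) \<le> 1" for v :: "'c::euclidean_space"
proof -
  have "ln (1 + (v \<bullet> v) / N\<^sup>2) \<ge> 0" by (rule ln_ge_zero) simp
  then show ?thesis using \<delta> by simp
qed

lemma log_cutoff_bounds: "log_cutoff \<delta> N v \<ge> 0" "log_cutoff \<delta> N v \<le> 1" for v :: "'c::euclidean_space"
  using log_cutoff_max_le[of v] unfolding log_cutoff_def pos_sq_def by (auto intro: power_le_one)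

lemma log_cutoff_deriv:
  "(log_cutoff \<delta> N has_derivative (\<lambda>z. log_cutoff_grad \<delta> N v \<bullet> z)) (at v)" for v :: "'c::euclidean_space"
proof -
  have a: "1 + (v \<bullet> v) / N\<^sup>2 > 0" by (rule log_cutoff_arg_pos)
  have "((\<lambda>v. v \<bullet> v) has_derivative (\<lambda>z. 2 * (v \<bullet> z))) (at v)"
    by (auto intro!: derivative_eq_intros simp: inner_commute)
  from bounded_linear.has_derivative[OF bounded_linear_divide this, of "N\<^sup>2"]
  have "((\<lambda>v. (v \<bullet> v) / N\<^sup>2) has_derivative (\<lambda>z. 2 * (v \<bullet> z) / N\<^sup>2)) (at v)" .
  from has_derivative_add[OF has_derivative_const[of 1] this]
  have "((\<lambda>v. 1 + (v \<bullet> v) / N\<^sup>2) has_derivative (\<lambda>z. 2 * (v \<bullet> z) / N\<^sup>2)) (at v)" by simp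
  from has_derivative_mult_right[OF has_derivative_ln[OF a this], of \<delta>]
  have "((\<lambda>v. \<delta> * ln (1 + (v \<bullet> v) / N\<^sup>2)) has_derivative
      (\<lambda>z. \<delta> * (2 * (v \<bullet> z) / N\<^sup>2 * inverse (1 + (v \<bullet> v) / N\<^sup>2)))) (at v)" .
  from has_derivative_diff[OF has_derivative_const[of 1] this]
  have "((\<lambda>v. 1 - \<delta> * ln (1 + (v \<bullet> v) / N\<^sup>2)) has_derivative
      (\<lambda>z. - (\<delta> * (2 * (v \<bullet> z) / N\<^sup>2 * inverse (1 + (v \<bullet> v) / N\<^sup>2))))) (at v)" by simp
  from pos_sq_has_derivative[OF this]
  have "((\<lambda>v. pos_sq (1 - \<delta> * ln (1 + (v \<bullet> v) / N\<^sup>2))) has_derivative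
      (\<lambda>z. 2 * max 0 (1 - \<delta> * ln (1 + (v \<bullet> v) / N\<^sup>2)) * - (\<delta> * (2 * (v \<bullet> z) / N\<^sup>2 * inverse (1 + (v \<bullet> v) / N\<^sup>2))))) (at v)" .
  moreover have "2 * max 0 (1 - \<delta> * ln (1 + (v \<bullet> v) / N\<^sup>2)) * - (\<delta> * (2 * (v \<bullet> z) / N\<^sup>2 * inverse (1 + (v \<bullet> v) / N\<^sup>2)))
      = log_cutoff_grad \<delta> N v \<bullet> z" for z
  proof -
    define A m where "A = 1 + (v \<bullet> v) / N\<^sup>2" and "m = max 0 (1 - \<delta> * ln (1 + (v \<bullet> v) / N\<^sup>2))"
    have "N\<^sup>2 + v \<bullet> v = N\<^sup>2 * A" using N by (simp add: A_def field_simps)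
    moreover have "A \<noteq> 0" using a by (simp add: A_def)
    ultimately have "2 * m * - (\<delta> * (2 * (v \<bullet> z) / N\<^sup>2 * inverse A)) = - (4 * \<delta> * m / (N\<^sup>2 + v \<bullet> v)) * (v \<bullet> z)"
      using N by (simp add: divide_inverse mult_ac)
    then show ?thesis by (simp add: A_def m_def log_cutoff_grad_def)
  qed
  ultimately show ?thesis unfolding log_cutoff_def[abs_def] by simp
qed

lemma log_cutoff_cont: "continuous_on UNIV (log_cutoff \<delta> N :: 'c::euclidean_space \<Rightarrow> real)"
  by (rule continuous_at_imp_continuous_on) (use log_cutoff_deriv has_derivative_continuous in blast)

lemma log_cutoff_grad_cont: "continuous_on UNIV (log_cutoff_grad \<delta> N :: 'c::euclidean_space \<Rightarrow> 'c)"
proof -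
  have 1: "1 + (v \<bullet> v) / N\<^sup>2 \<noteq> 0" for v :: 'c using log_cutoff_arg_pos[of v] by linarith
  have 2: "N\<^sup>2 + v \<bullet> v \<noteq> 0" for v :: 'c
    using N by (metis add_pos_nonneg inner_ge_zero less_irrefl zero_less_power)
  show ?thesis unfolding log_cutoff_grad_def[abs_def] using 1 2 N by (intro continuous_intros) auto
qed

text \<open>The logarithm makes the derivative decay like 1 / |v|. As the bound does not involve N,
  \<delta> can be fixed first and the truncation level afterwards.\<close>

lemma log_cutoff_grad_le: "norm v * norm (log_cutoff_grad \<delta> N v) \<le> 4 * \<delta>" for v :: "'c::euclidean_space"
proof -
  have p: "N\<^sup>2 + v \<bullet> v > 0" using N by (intro add_pos_nonneg) auto
  let ?m = "max 0 (1 - \<delta> * ln (1 + (v \<bullet> v) / N\<^sup>2))"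
  have "norm v * norm (log_cutoff_grad \<delta> N v) = 4 * \<delta> * ?m * ((v \<bullet> v) / (N\<^sup>2 + v \<bullet> v))"
    using p \<delta> by (simp add: log_cutoff_grad_def abs_mult dot_square_norm power2_eq_square)
  also have "\<dots> \<le> 4 * \<delta> * 1 * 1"
    using p \<delta> log_cutoff_max_le[of v] by (intro mult_mono) (auto simp: divide_le_eq)
  finally show ?thesis by simp
qed

lemma log_cutoff_trunc_bounded:
  obtains B where "B \<ge> 0" "\<And>v :: 'c::euclidean_space. norm (log_cutoff \<delta> N v *\<^sub>R v) \<le> B"
\<comment> \<open>The cutoff vanishes once the logarithm reaches 1 / \<delta>. Half the exponent
  would do; the larger bound avoids a square root.\<close>
proof (rule that[of "N * exp (1 / \<delta>)"])
  show "N * exp (1 / \<delta>) \<ge> 0" using N by simp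
  fix v :: 'c
  show "norm (log_cutoff \<delta> N v *\<^sub>R v) \<le> N * exp (1 / \<delta>)"
  proof (cases "log_cutoff \<delta> N v = 0")
    case True
    then show ?thesis using N by simp
  next
    case False
    then have "\<delta> * ln (1 + (v \<bullet> v) / N\<^sup>2) < 1" by (simp add: log_cutoff_def)
    then have "ln (1 + (v \<bullet> v) / N\<^sup>2) < 1 / \<delta>" using \<delta> by (simp add: pos_less_divide_eq mult.commute)
    then have "1 + (v \<bullet> v) / N\<^sup>2 < exp (1 / \<delta>)"
      using log_cutoff_arg_pos[of v] by (metis exp_less_cancel_iff exp_ln)
    then have "(v \<bullet> v) / N\<^sup>2 \<le> exp (1 / \<delta>)" by linarith
    also have "\<dots> \<le> (exp (1 / \<delta>))\<^sup>2" using \<delta> by (simp add: power2_eq_square mult_le_cancel_left1)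
    finally have "(norm v)\<^sup>2 \<le> (N * exp (1 / \<delta>))\<^sup>2"
      using N by (simp add: divide_le_eq dot_square_norm power_mult_distrib mult.commute)
    then have "norm v \<le> N * exp (1 / \<delta>)" by (rule power2_le_imp_le) (use N in simp)
    moreover have "norm (log_cutoff \<delta> N v *\<^sub>R v) \<le> 1 * norm v"
      unfolding norm_scaleR using log_cutoff_bounds[of v] by (intro mult_right_mono) auto
    ultimately show ?thesis by simp
  qed
qed

lemma log_cutoff_norm_le: "norm (log_cutoff \<delta> N v *\<^sub>R v) \<le> norm v" for v :: "'c::euclidean_space"
proof -
  have "norm (log_cutoff \<delta> N v *\<^sub>R v) \<le> 1 * norm v"
    unfolding norm_scaleR using log_cutoff_bounds[of v] by (intro mult_right_mono) auto
  then show ?thesis by simp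
qed

end

lemma log_cutoff_tendsto: "(\<lambda>n. log_cutoff \<delta> (real (Suc n)) v) \<longlonglongrightarrow> 1"
proof -
  have "filterlim (\<lambda>n. (real (Suc n))\<^sup>2) at_top sequentially"
    by (rule filterlim_pow_at_top) (use filterlim_real_sequentially filterlim_sequentially_Suc in \<open>auto simp del: of_nat_Suc\<close>)
  then have z: "(\<lambda>n. (v \<bullet> v) / (real (Suc n))\<^sup>2) \<longlonglongrightarrow> 0"
    by (rule tendsto_divide_0[OF tendsto_const filterlim_at_top_imp_at_infinity])
  have "(\<lambda>n. 1 - \<delta> * ln (1 + (v \<bullet> v) / (real (Suc n))\<^sup>2)) \<longlonglongrightarrow> 1 - \<delta> * ln (1 + 0)"
    by (intro tendsto_intros z) simp
  from tendsto_power[OF tendsto_max[OF tendsto_const[of 0] this], of 2]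
  have "(\<lambda>n. (max 0 (1 - \<delta> * ln (1 + (v \<bullet> v) / (real (Suc n))\<^sup>2)))\<^sup>2) \<longlonglongrightarrow> (max 0 (1 - \<delta> * ln (1 + 0)))\<^sup>2" .
  then show ?thesis by (simp add: log_cutoff_def pos_sq_def)
qed

text \<open>The product rule for \<theta>(v) v when v has Jacobian G: besides the scaled G there is
  the rank-one matrix with rows v_k times the transpose of G applied to the gradient of \<theta> at
  v.\<close>

definition cutoff_grad :: "real \<Rightarrow> real \<Rightarrow> real^'m \<Rightarrow> real^'n^'m \<Rightarrow> real^'n^'m" where
  "cutoff_grad \<delta> N v G = log_cutoff \<delta> N v *\<^sub>R G + (\<chi> k. v $ k *\<^sub>R (\<Sum>l\<in>UNIV. log_cutoff_grad \<delta> N v $ l *\<^sub>R G $ l))"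

lemma cutoff_grad_deriv:
  fixes v :: "real^'n \<Rightarrow> real^'m"
  assumes \<delta>: "\<delta> > 0" and N: "N > 0" and v: "(v has_derivative (\<lambda>z. G *v z)) (at x)"
  shows "((\<lambda>x. log_cutoff \<delta> N (v x) *\<^sub>R v x) has_derivative (\<lambda>z. cutoff_grad \<delta> N (v x) G *v z)) (at x)"
proof -
  have "((\<lambda>x. log_cutoff \<delta> N (v x)) has_derivative (\<lambda>z. log_cutoff_grad \<delta> N (v x) \<bullet> (G *v z))) (at x)"
    by (rule has_derivative_compose[OF v log_cutoff_deriv[OF \<delta> N]])
  from has_derivative_scaleR[OF this v]
  have "((\<lambda>x. log_cutoff \<delta> N (v x) *\<^sub>R v x) has_derivative
      (\<lambda>z. log_cutoff \<delta> N (v x) *\<^sub>R (G *v z) + (log_cutoff_grad \<delta> N (v x) \<bullet> (G *v z)) *\<^sub>R v x)) (at x)" .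
  moreover have "log_cutoff \<delta> N (v x) *\<^sub>R (G *v z) + (log_cutoff_grad \<delta> N (v x) \<bullet> (G *v z)) *\<^sub>R v x
      = cutoff_grad \<delta> N (v x) G *v z" for z
    by (simp add: vec_eq_iff cutoff_grad_def matrix_vector_mul_component inner_add_left inner_sum_left
        inner_vec_def[of "log_cutoff_grad _ _ _"] mult.commute)
  ultimately show ?thesis by simp
qed

lemma cutoff_grad_near:
  fixes v :: "real^'m" and G :: "real^'n^'m"
  assumes \<delta>: "\<delta> > 0" and N: "N > 0"
  shows "norm (cutoff_grad \<delta> N v G - log_cutoff \<delta> N v *\<^sub>R G) \<le> real CARD('m) * (4 * \<delta>) * norm G"
proof -
  let ?D = "log_cutoff_grad \<delta> N v"
  define q where "q = (\<Sum>l\<in>UNIV. ?D $ l *\<^sub>R G $ l)"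
  have "norm q \<le> (\<Sum>l\<in>(UNIV::'m set). norm ?D * norm G)"
    unfolding q_def
  proof (rule order_trans[OF norm_sum], rule sum_mono)
    fix l show "norm (?D $ l *\<^sub>R G $ l) \<le> norm ?D * norm G"
      unfolding norm_scaleR by (intro mult_mono component_le_norm_cart Finite_Cartesian_Product.norm_nth_le) auto
  qed
  then have q: "norm q \<le> real CARD('m) * (norm ?D * norm G)" by simp
  have "norm (\<chi> k. v $ k *\<^sub>R q) = norm v * norm q"
  proof -
    have "norm (\<chi> k. v $ k *\<^sub>R q) = L2_set (\<lambda>k. norm (v $ k) * norm q) UNIV"
      by (subst norm_vec_def) simp
    also have "\<dots> = norm v * norm q"
      unfolding norm_vec_def[of v] by (rule L2_set_left_distrib[symmetric]) simp
    finally show ?thesis .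
  qed
  also have "\<dots> \<le> norm v * (real CARD('m) * (norm ?D * norm G))"
    by (intro mult_left_mono q) simp
  also have "\<dots> = real CARD('m) * (norm v * norm ?D) * norm G" by simp
  also have "\<dots> \<le> real CARD('m) * (4 * \<delta>) * norm G"
    by (intro mult_right_mono mult_left_mono log_cutoff_grad_le[OF \<delta> N]) auto
  finally show ?thesis by (simp add: cutoff_grad_def q_def)
qed

lemma cutoff_grad_cont:
  fixes v :: "real^'n \<Rightarrow> real^'m"
  assumes "\<delta> > 0" "N > 0" "continuous_on S v" "continuous_on S G"
  shows "continuous_on S (\<lambda>x. cutoff_grad \<delta> N (v x) (G x))"
  unfolding cutoff_grad_def
  by (intro continuous_intros assms continuous_on_compose2[OF log_cutoff_cont[OF assms(1,2)] assms(3)]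
      continuous_on_compose2[OF log_cutoff_grad_cont[OF assms(1,2)] assms(3)]) auto

context open_distance_bv
begin

lemma cutoff_smooth_W11:
  assumes e: "0 < e" "e < 1" and \<delta>: "\<delta> > 0" and N: "N > 0"
  shows "integrable (lebesgue_on \<Omega>) (\<lambda>x. log_cutoff \<delta> N (smooth e u x) *\<^sub>R smooth e u x)"
    and "integrable (lebesgue_on \<Omega>) (\<lambda>x. cutoff_grad \<delta> N (smooth e u x) (smooth_grad e x))"
    and "weak_grad \<Omega> (\<lambda>x. log_cutoff \<delta> N (smooth e u x) *\<^sub>R smooth e u x)
      (\<lambda>x. cutoff_grad \<delta> N (smooth e u x) (smooth_grad e x))"
proof -
  let ?w = "\<lambda>x. log_cutoff \<delta> N (smooth e u x) *\<^sub>R smooth e u x"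
  let ?G = "\<lambda>x. cutoff_grad \<delta> N (smooth e u x) (smooth_grad e x)"
  have vc: "continuous_on \<Omega> (smooth e u)"
    using smooth_deriv[OF e(1)] by (intro continuous_at_imp_continuous_on) (auto dest: has_derivative_continuous)
  have Gc: "continuous_on \<Omega> ?G"
    by (rule cutoff_grad_cont[OF \<delta> N vc smooth_grad_cont[OF e(1)]])
  have wc: "continuous_on \<Omega> ?w"
    by (intro continuous_intros vc continuous_on_compose2[OF log_cutoff_cont[OF \<delta> N] vc]) auto
  show wi: "integrable (lebesgue_on \<Omega>) ?w"
    by (rule Bochner_Integration.integrable_bound[OF smooth_integrable(1)[OF e u_int] integrable_continuous_on_open[OF \<Omega>_open wc]])
      (use log_cutoff_norm_le[OF \<delta> N] in auto)
  let ?C = "1 + real CARD('m) * (4 * \<delta>)"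
  have le: "norm (?G x) \<le> ?C * norm (smooth_grad e x)" for x
    using cutoff_grad_near[OF \<delta> N, of "smooth e u x" "smooth_grad e x"]
      norm_triangle_ineq[of "log_cutoff \<delta> N (smooth e u x) *\<^sub>R smooth_grad e x" "?G x - log_cutoff \<delta> N (smooth e u x) *\<^sub>R smooth_grad e x"]
      mult_right_mono[OF log_cutoff_bounds(2)[OF \<delta> N] norm_ge_zero, of "smooth e u x" "smooth_grad e x"] log_cutoff_bounds(1)[OF \<delta> N, of "smooth e u x"]
    by (simp add: algebra_simps)
  show Gi: "integrable (lebesgue_on \<Omega>) ?G"
    by (rule Bochner_Integration.integrable_bound[OF integrable_mult_right[OF integrable_norm[OF smooth_grad_integral(1)[OF e]], of ?C]
          integrable_continuous_on_open[OF \<Omega>_open Gc]])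
      (use le in \<open>auto intro!: AE_I2 intro: order_trans[OF _ abs_ge_self]\<close>)
  show "weak_grad \<Omega> ?w ?G"
    by (rule weak_grad_classical[OF \<Omega>_open cutoff_grad_deriv[OF \<delta> N smooth_deriv[OF e(1)]] Gc wi Gi])
qed

text \<open>Scaling the gradient by a factor in [0, 1] does not increase F; only the rank-one term
  costs energy, at most \<nu>1 times its norm, which is small with \<delta> for every N.\<close>

lemma cutoff_smooth_energy:
  fixes F :: "real^'n^'m \<Rightarrow> real"
  assumes F: "linear_growth_density F DF \<nu>1 \<nu>2 \<nu>3" and e: "0 < e" "e < 1" and \<delta>: "\<delta> > 0" and N: "N > 0"
  shows "(\<integral>x. F (cutoff_grad \<delta> N (smooth e u x) (smooth_grad e x)) \<partial>lebesgue_on \<Omega>)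
    \<le> (\<integral>x. F (smooth_grad e x) \<partial>lebesgue_on \<Omega>) + \<nu>1 * (real CARD('m) * (4 * \<delta>)) * (\<integral>x. norm (smooth_grad e x) \<partial>lebesgue_on \<Omega>)"
proof -
  interpret linear_growth_density F DF \<nu>1 \<nu>2 \<nu>3 by (rule F)
  have nu: "\<nu>1 \<ge> 0" using nu_pos by simp
  have Fi: "integrable (lebesgue_on \<Omega>) (\<lambda>x. F (G x))" if "integrable (lebesgue_on \<Omega>) G" for G
    using borel_measurable_integrable[OF that]
    by (intro Bochner_Integration.integrable_bound[OF integrable_mult_right[OF integrable_norm[OF that], of \<nu>1]])
      (use F_le_norm F_nonneg nu in auto)
  note Gi = smooth_grad_integral(1)[OF e]
  have "(\<integral>x. F (cutoff_grad \<delta> N (smooth e u x) (smooth_grad e x)) \<partial>lebesgue_on \<Omega>)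
      \<le> (\<integral>x. F (smooth_grad e x) + \<nu>1 * (real CARD('m) * (4 * \<delta>)) * norm (smooth_grad e x) \<partial>lebesgue_on \<Omega>)"
  proof (rule integral_mono[OF Fi[OF cutoff_smooth_W11(2)[OF e \<delta> N]]])
    show "integrable (lebesgue_on \<Omega>) (\<lambda>x. F (smooth_grad e x) + \<nu>1 * (real CARD('m) * (4 * \<delta>)) * norm (smooth_grad e x))"
      using Fi[OF Gi] Gi by simp
    fix x
    let ?G = "smooth_grad e x" and ?v = "smooth e u x"
    let ?t = "log_cutoff \<delta> N ?v"
    have t: "0 \<le> ?t" "?t \<le> 1" by (rule log_cutoff_bounds[OF \<delta> N])+
    have "F (cutoff_grad \<delta> N ?v ?G) \<le> F (?t *\<^sub>R ?G) + \<nu>1 * norm (cutoff_grad \<delta> N ?v ?G - ?t *\<^sub>R ?G)"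
      using F_lipschitz[of "cutoff_grad \<delta> N ?v ?G" "?t *\<^sub>R ?G"] by linarith
    also have "F (?t *\<^sub>R ?G) \<le> ?t * F ?G" by (rule F_scale_le[OF t])
    also have "\<dots> \<le> 1 * F ?G" by (rule mult_right_mono[OF t(2) F_nonneg])
    also have "\<nu>1 * norm (cutoff_grad \<delta> N ?v ?G - ?t *\<^sub>R ?G) \<le> \<nu>1 * (real CARD('m) * (4 * \<delta>) * norm ?G)"
      by (rule mult_left_mono[OF cutoff_grad_near[OF \<delta> N] nu])
    finally show "F (cutoff_grad \<delta> N ?v ?G) \<le> F ?G + \<nu>1 * (real CARD('m) * (4 * \<delta>)) * norm ?G" by simp
  qed
  also have "\<dots> = (\<integral>x. F (smooth_grad e x) \<partial>lebesgue_on \<Omega>) + \<nu>1 * (real CARD('m) * (4 * \<delta>)) * (\<integral>x. norm (smooth_grad e x) \<partial>lebesgue_on \<Omega>)"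
    using Fi[OF Gi] Gi by simp
  finally show ?thesis .
qed

text \<open>Mollification alone converges in \<open>L^1\<close>, too weak for the power p of the
  fidelity term, and near D the kernel mixes in values of u that are merely integrable. Truncation
  makes the functions bounded, so almost everywhere convergence suffices. The parameters are fixed
  in the order \<delta>, N, e.\<close>

theorem approximation:
  fixes F :: "real^'n^'m \<Rightarrow> real" and f :: "real^'n \<Rightarrow> real^'m"
  assumes F: "linear_growth_density F DF \<nu>1 \<nu>2 \<nu>3"
    and S: "S \<in> sets lebesgue" "S \<subseteq> \<Omega>" and p: "p > 1" and c: "c \<ge> 0"
    and u: "u \<in> Lp_on p S" and f: "f \<in> Lp_on p S" and \<eta>: "\<eta> > 0"
  obtains w W where "weak_grad \<Omega> w W" "w \<in> Lp_on 1 \<Omega>" "w \<in> Lp_on p S"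
    "(\<integral>x. F (W x) \<partial>lebesgue_on \<Omega>) + c * (\<integral>x. norm (w x - f x) powr p \<partial>lebesgue_on S)
      \<le> (\<integral>x. F (g x) \<partial>lebesgue_on \<Omega>) + (\<integral>x. recession F (h x) \<partial>\<nu>)
        + c * (\<integral>x. norm (u x - f x) powr p \<partial>lebesgue_on S) + \<eta>"
proof -
  interpret linear_growth_density F DF \<nu>1 \<nu>2 \<nu>3 by (rule F)
  interpret L: finite_measure "lebesgue_on \<Omega>" by (rule finite_measure_\<Omega>)
  have "S \<in> lmeasurable"
    using S \<Omega>_bounded bounded_subset bounded_set_imp_lmeasurable by blast
  then interpret S: finite_measure "lebesgue_on S" by (rule finite_measure_lebesgue_on)
  define E where "E = (\<integral>x. F (g x) \<partial>lebesgue_on \<Omega>) + (\<integral>x. recession F (h x) \<partial>\<nu>)"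
  define fid where "fid w = (\<integral>x. norm (w x - f x) powr p \<partial>lebesgue_on S)" for w
  define C where "C = real CARD('m)"
  have C: "C > 0" by (simp add: C_def)
  \<comment> \<open>Chosen so that the rank-one error is exactly \<eta> / 4. The summand 1 keeps the
    denominator positive and leaves room for the factors by which the mollified gradient may exceed
    the total variation.\<close>
  define \<delta> where "\<delta> = \<eta> / (4 * (\<nu>1 * C * 4 * (total_var + 1)))"
  have tv: "total_var + 1 > 0" using total_var_nonneg by linarith
  have \<delta>: "\<delta> > 0" unfolding \<delta>_def using \<eta> nu_pos C tv by (intro divide_pos_pos mult_pos_pos) auto
  have \<delta>_eq: "\<nu>1 * (C * (4 * \<delta>)) * (total_var + 1) = \<eta> / 4"
  proof -
    define q where "q = \<nu>1 * C * 4 * (total_var + 1)"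
    have "q > 0" unfolding q_def using nu_pos C tv by (intro mult_pos_pos) auto
    moreover have "\<nu>1 * (C * (4 * \<delta>)) * (total_var + 1) = q * \<delta>" by (simp add: q_def)
    moreover have "\<delta> = \<eta> / (4 * q)" by (simp add: \<delta>_def q_def)
    ultimately show ?thesis by simp
  qed
  have um: "u \<in> borel_measurable (lebesgue_on S)" using u by (simp add: Lp_on_def)
  define T where "T N v = log_cutoff \<delta> N v *\<^sub>R v" for N and v :: "real^'m"
  have Tb: "T N \<in> borel_measurable borel" if "N > 0" for N
    unfolding T_def by (intro borel_measurable_continuous_onI continuous_intros log_cutoff_cont[OF \<delta> that])
  have "(\<lambda>n. fid (\<lambda>x. T (real (Suc n)) (u x))) \<longlonglongrightarrow> fid u"
    unfolding fid_def
  proof (rule fidelity_tendsto[where b = "\<lambda>x. norm (u x)"])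
    show "AE x in lebesgue_on S. (\<lambda>n. T (real (Suc n)) (u x)) \<longlonglongrightarrow> u x"
      using tendsto_scaleR[OF log_cutoff_tendsto tendsto_const] by (intro AE_I2) (simp add: T_def)
    show "(\<lambda>x. T (real (Suc j)) (u x)) \<in> borel_measurable (lebesgue_on S)" for j
      by (rule measurable_compose[OF um Tb]) simp
    show "norm (T (real (Suc j)) (u x)) \<le> norm (u x)" for j x
      unfolding T_def by (rule log_cutoff_norm_le[OF \<delta>]) simp
  qed (use p u um f in \<open>auto simp: Lp_on_def\<close>)
  then have "(\<lambda>n. c * fid (\<lambda>x. T (real (Suc n)) (u x))) \<longlonglongrightarrow> c * fid u" by (intro tendsto_intros)
  then have "\<forall>\<^sub>F n in sequentially. c * fid (\<lambda>x. T (real (Suc n)) (u x)) < c * fid u + \<eta> / 4"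
    by (rule order_tendstoD) (use \<eta> in simp)
  then obtain n where n: "c * fid (\<lambda>x. T (real (Suc n)) (u x)) < c * fid u + \<eta> / 4"
    using eventually_happens'[OF sequentially_bot] by blast
  define N where "N = real (Suc n)"
  have N: "N > 0" by (simp add: N_def)
  \<comment> \<open>The shift by 2 keeps e strictly between 0 and 1.\<close>
  define e where "e j = 1 / real (j + 2)" for j
  have e: "0 < e j" "e j < 1" for j by (auto simp: e_def)
  have "e \<longlonglongrightarrow> 0"
    unfolding e_def using LIMSEQ_ignore_initial_segment[OF lim_1_over_n, of 2] by simp
  then have e_lim: "filterlim e (at_right 0) sequentially"
    unfolding filterlim_at using e(1) by (auto intro!: always_eventually simp: less_imp_neq[symmetric])
  have sm: "integrable (lebesgue_on \<Omega>) (smooth (e j) u)" for j by (rule smooth_integrable(1)[OF e u_int])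
  have "(\<lambda>j. \<integral>x. norm (smooth (e j) u x - u x) \<partial>lebesgue_on \<Omega>) \<longlonglongrightarrow> 0"
    by (rule filterlim_compose[OF smooth_L1_tendsto[OF u_int] e_lim])
  \<comment> \<open>Convergence in \<open>L^1\<close> gives pointwise convergence only along a
    subsequence, which is all that is needed here.\<close>
  then obtain r :: "nat \<Rightarrow> nat" where r: "strict_mono r"
    "AE x in lebesgue_on \<Omega>. (\<lambda>j. smooth (e (r j)) u x - u x) \<longlonglongrightarrow> 0"
    using tendsto_L1_AE_subseq[of "lebesgue_on \<Omega>" "\<lambda>j x. smooth (e j) u x - u x"] sm u_int by auto
  have r_lim: "filterlim (\<lambda>j. e (r j)) (at_right 0) sequentially"
    using filterlim_compose[OF e_lim filterlim_subseq[OF r(1)]] .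
  define w where "w j x = T N (smooth (e (r j)) u x)" for j x
  have W11: "weak_grad \<Omega> (w j) (\<lambda>x. cutoff_grad \<delta> N (smooth (e (r j)) u x) (smooth_grad (e (r j)) x))"
    "integrable (lebesgue_on \<Omega>) (w j)" for j
    using cutoff_smooth_W11[OF e \<delta> N, of "r j"] by (simp_all add: w_def[abs_def] T_def)
  obtain B where B: "B \<ge> 0" "\<And>v :: real^'m. norm (T N v) \<le> B"
    unfolding T_def by (rule log_cutoff_trunc_bounded[OF \<delta> N]) blast
  have wm: "w j \<in> borel_measurable (lebesgue_on S)" for j
    by (rule measurable_restrict_mono[OF borel_measurable_integrable[OF W11(2)] S(2)])
  have wLp: "w j \<in> Lp_on p S" for j
  proof -
    have "norm (w j x) powr p \<le> B powr p" for x
      using B p by (intro powr_mono2) (auto simp: w_def)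
    then have "integrable (lebesgue_on S) (\<lambda>x. norm (w j x) powr p)"
      using wm[of j] by (intro S.integrable_const_bound[where B = "B powr p"]) auto
    then show ?thesis using wm by (simp add: Lp_on_def)
  qed
  have "(\<lambda>j. fid (w j)) \<longlonglongrightarrow> fid (\<lambda>x. T N (u x))"
    unfolding fid_def
  proof (rule fidelity_tendsto[where b = "\<lambda>x. B"])
    have "AE x in lebesgue. x \<in> \<Omega> \<longrightarrow> (\<lambda>j. smooth (e (r j)) u x - u x) \<longlonglongrightarrow> 0"
      using r(2) by (subst (asm) AE_restrict_space_iff) (use \<Omega>_open in auto)
    then have "AE x in lebesgue_on S. (\<lambda>j. smooth (e (r j)) u x - u x) \<longlonglongrightarrow> 0"
      using S by (subst AE_restrict_space_iff) auto
    then show "AE x in lebesgue_on S. (\<lambda>j. w j x) \<longlonglongrightarrow> T N (u x)"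
    proof eventually_elim
      case (elim x)
      then have "(\<lambda>j. smooth (e (r j)) u x) \<longlonglongrightarrow> u x" by (simp add: LIM_zero_iff)
      moreover have "isCont (T N) (u x)"
      proof -
        have "continuous_on UNIV (T N)" unfolding T_def by (intro continuous_intros log_cutoff_cont[OF \<delta> N])
        then show ?thesis using continuous_on_eq_continuous_at by blast
      qed
      ultimately show ?case unfolding w_def by (rule isCont_tendsto_compose[rotated])
    qed
    show "(\<lambda>x. T N (u x)) \<in> borel_measurable (lebesgue_on S)" by (rule measurable_compose[OF um Tb[OF N]])
    show "norm (w j x) \<le> B" for j x unfolding w_def by (rule B(2))
  qed (use p wm f in auto)
  then have "(\<lambda>j. c * fid (w j)) \<longlonglongrightarrow> c * fid (\<lambda>x. T N (u x))" by (intro tendsto_intros)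
  then have ev1: "\<forall>\<^sub>F j in sequentially. c * fid (w j) < c * fid u + \<eta> / 4"
    by (rule order_tendstoD) (use n in \<open>simp add: N_def\<close>)
  let ?K = "real (CARD('m) * CARD('n) * CARD('n))"
  have idlim: "((\<lambda>e::real. e) \<longlongrightarrow> 0) (at_right 0)" by (rule tendsto_ident_at)
  have "((\<lambda>e. mass_bound e * E + \<nu>1 * (?K * e) * (mass_bound e * total_var)) \<longlongrightarrow> 1 * E + \<nu>1 * (?K * 0) * (1 * total_var)) (at_right 0)"
    by (intro tendsto_intros mass_bound_tendsto idlim)
  then have "\<forall>\<^sub>F e in at_right 0. mass_bound e * E + \<nu>1 * (?K * e) * (mass_bound e * total_var) < E + \<eta> / 4"
    by (rule order_tendstoD) (use \<eta> in simp)
  then have ev2: "\<forall>\<^sub>F j in sequentially. mass_bound (e (r j)) * E + \<nu>1 * (?K * e (r j)) * (mass_bound (e (r j)) * total_var) < E + \<eta> / 4"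
    using r_lim by (rule eventually_compose_filterlim)
  have "((\<lambda>e. (1 + ?K * e) * (mass_bound e * total_var)) \<longlongrightarrow> (1 + ?K * 0) * (1 * total_var)) (at_right 0)"
    by (intro tendsto_intros mass_bound_tendsto idlim)
  then have "\<forall>\<^sub>F e in at_right 0. (1 + ?K * e) * (mass_bound e * total_var) < total_var + 1"
    by (rule order_tendstoD) simp
  then have ev3: "\<forall>\<^sub>F j in sequentially. (1 + ?K * e (r j)) * (mass_bound (e (r j)) * total_var) < total_var + 1"
    using r_lim by (rule eventually_compose_filterlim)
  from eventually_happens'[OF sequentially_bot eventually_conj[OF ev1 eventually_conj[OF ev2 ev3]]]
  obtain j where j: "c * fid (w j) < c * fid u + \<eta> / 4"
    "mass_bound (e (r j)) * E + \<nu>1 * (?K * e (r j)) * (mass_bound (e (r j)) * total_var) < E + \<eta> / 4"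
    "(1 + ?K * e (r j)) * (mass_bound (e (r j)) * total_var) < total_var + 1"
    by blast
  let ?e = "e (r j)"
  have "(\<integral>x. F (cutoff_grad \<delta> N (smooth ?e u x) (smooth_grad ?e x)) \<partial>lebesgue_on \<Omega>)
      \<le> (\<integral>x. F (smooth_grad ?e x) \<partial>lebesgue_on \<Omega>) + \<nu>1 * (C * (4 * \<delta>)) * (\<integral>x. norm (smooth_grad ?e x) \<partial>lebesgue_on \<Omega>)"
    unfolding C_def by (rule cutoff_smooth_energy[OF F e \<delta> N])
  moreover have "(\<integral>x. F (smooth_grad ?e x) \<partial>lebesgue_on \<Omega>) \<le> E + \<eta> / 4"
    using smooth_energy[OF F e, of "r j"] j(2) by (simp add: E_def)
  moreover have "\<nu>1 * (C * (4 * \<delta>)) * (\<integral>x. norm (smooth_grad ?e x) \<partial>lebesgue_on \<Omega>) \<le> \<nu>1 * (C * (4 * \<delta>)) * (total_var + 1)"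
    using smooth_grad_integral(2)[OF e, of "r j"] j(3) nu_pos C \<delta> by (intro mult_left_mono) auto
  ultimately have "(\<integral>x. F (cutoff_grad \<delta> N (smooth ?e u x) (smooth_grad ?e x)) \<partial>lebesgue_on \<Omega>) + c * fid (w j)
      \<le> E + c * fid u + \<eta>"
    using j(1) \<delta>_eq \<eta> by linarith
  then show ?thesis
    using that[OF W11(1)[of j] _ wLp[of j]] W11(2)[of j] by (simp add: Lp_on_1 E_def fid_def)
qed

end

section \<open>The primal and the dual problem\<close>

lemma fatou_real:
  fixes f :: "nat \<Rightarrow> 'a \<Rightarrow> real"
  assumes f: "\<And>j. integrable M (f j)" "\<And>j. AE x in M. f j x \<ge> 0"
    and g: "g \<in> borel_measurable M" and lim: "AE x in M. (\<lambda>j. f j x) \<longlonglongrightarrow> g x"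
    and c: "\<And>j. (\<integral>x. f j x \<partial>M) \<le> c j" "c \<longlonglongrightarrow> C"
  shows "AE x in M. g x \<ge> 0" "integrable M g" "(\<integral>x. g x \<partial>M) \<le> C"
proof -
  note [measurable] = g
  have fm[measurable]: "f j \<in> borel_measurable M" for j using f(1) by simp
  have nn: "AE x in M. \<forall>j. f j x \<ge> 0" using f(2) by (simp add: AE_all_countable)
  show g0: "AE x in M. g x \<ge> 0"
    using lim nn by eventually_elim (auto intro: LIMSEQ_le_const)
  have "C \<ge> 0"
  proof (rule LIMSEQ_le_const[OF c(2)], intro exI allI impI)
    fix j show "0 \<le> c j" by (rule order_trans[OF integral_nonneg_AE[OF f(2)[of j]] c(1)])
  qed
  have "(\<integral>\<^sup>+x. ennreal (g x) \<partial>M) = (\<integral>\<^sup>+x. liminf (\<lambda>j. ennreal (f j x)) \<partial>M)"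
  proof (rule nn_integral_cong_AE)
    show "AE x in M. ennreal (g x) = liminf (\<lambda>j. ennreal (f j x))"
      using lim
    proof eventually_elim
      case (elim x)
      then have "(\<lambda>j. ennreal (f j x)) \<longlonglongrightarrow> ennreal (g x)" by (rule tendsto_ennrealI)
      then show ?case by (simp add: lim_imp_Liminf)
    qed
  qed
  also have "\<dots> \<le> liminf (\<lambda>j. \<integral>\<^sup>+x. ennreal (f j x) \<partial>M)" by (rule nn_integral_liminf) measurable
  also have "\<dots> \<le> liminf (\<lambda>j. ennreal (c j))"
  proof (rule Liminf_mono, rule always_eventually, rule allI)
    fix j
    have "(\<integral>\<^sup>+x. ennreal (f j x) \<partial>M) = ennreal (\<integral>x. f j x \<partial>M)"
      by (rule nn_integral_eq_integral[OF f])
    then show "(\<integral>\<^sup>+x. ennreal (f j x) \<partial>M) \<le> ennreal (c j)" using c(1) by (simp add: ennreal_leI)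
  qed
  also have "\<dots> = ennreal C" using tendsto_ennrealI[OF c(2)] by (simp add: lim_imp_Liminf)
  finally have le: "(\<integral>\<^sup>+x. ennreal (g x) \<partial>M) \<le> ennreal C" .
  show i: "integrable M g"
    by (rule integrableI_nonneg[OF g g0]) (use le_less_trans[OF le ennreal_less_top] in simp)
  have "ennreal (\<integral>x. g x \<partial>M) \<le> ennreal C" using le nn_integral_eq_integral[OF i g0] by simp
  then show "(\<integral>x. g x \<partial>M) \<le> C" using \<open>C \<ge> 0\<close> by (simp add: ennreal_le_iff)
qed

text \<open>The sum of the series has finite integral, so it is finite almost everywhere and its
  terms tend to zero there.\<close>

lemma summable_integrals_tendsto_0:
  fixes s :: "nat \<Rightarrow> 'a \<Rightarrow> real"
  assumes s: "\<And>j. integrable M (s j)" "\<And>j x. s j x \<ge> 0"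
    and c: "\<And>j. (\<integral>x. s j x \<partial>M) \<le> c j" "summable c"
  shows "AE x in M. (\<lambda>j. s j x) \<longlonglongrightarrow> 0"
proof -
  have [measurable]: "s j \<in> borel_measurable M" for j using s(1) by simp
  have c0: "c j \<ge> 0" for j
    by (rule order_trans[OF integral_nonneg_AE c(1)]) (simp add: s)
  have "(\<integral>\<^sup>+x. (\<Sum>j. ennreal (s j x)) \<partial>M) = (\<Sum>j. \<integral>\<^sup>+x. ennreal (s j x) \<partial>M)"
    by (rule nn_integral_suminf) measurable
  also have "\<dots> \<le> (\<Sum>j. ennreal (c j))"
  proof (rule suminf_le)
    fix j
    have "(\<integral>\<^sup>+x. ennreal (s j x) \<partial>M) = ennreal (\<integral>x. s j x \<partial>M)"
      by (rule nn_integral_eq_integral) (use s in auto)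
    then show "(\<integral>\<^sup>+x. ennreal (s j x) \<partial>M) \<le> ennreal (c j)" using c(1) by (simp add: ennreal_leI)
  qed auto
  also have "\<dots> = ennreal (suminf c)" by (rule suminf_ennreal2[OF c0 c(2)])
  finally have "(\<integral>\<^sup>+x. (\<Sum>j. ennreal (s j x)) \<partial>M) \<noteq> \<infinity>"
    using ennreal_less_top le_less_trans by (metis infinity_ennreal_def less_irrefl)
  then have "AE x in M. (\<Sum>j. ennreal (s j x)) \<noteq> \<infinity>"
    by (rule nn_integral_noteq_infinite[rotated]) measurable
  then show ?thesis
  proof eventually_elim
    case (elim x)
    then have "summable (\<lambda>j. s j x)" using s(2) by (intro summable_suminf_not_top) (auto simp: top_ennreal_def[symmetric])
    then show ?case by (rule summable_LIMSEQ_zero)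
  qed
qed

lemma convergent_of_geometric_steps:
  fixes P :: "nat \<Rightarrow> 'a::banach"
  assumes "\<forall>\<^sub>F j in sequentially. norm (P j - P (Suc j)) \<le> (1/2)^j"
  shows "convergent P"
proof -
  have "summable (\<lambda>j. P (Suc j) - P j)"
  proof (rule summable_comparison_test_ev)
    show "\<forall>\<^sub>F j in sequentially. norm (P (Suc j) - P j) \<le> (1/2::real)^j"
      using assms by (simp add: norm_minus_commute)
  qed (simp add: summable_geometric)
  then have "(\<lambda>n. \<Sum>j<n. P (Suc j) - P j) \<longlonglongrightarrow> (\<Sum>j. P (Suc j) - P j)" by (rule summable_LIMSEQ)
  then have "(\<lambda>n. P n - P 0) \<longlonglongrightarrow> (\<Sum>j. P (Suc j) - P j)" by (simp add: sum_lessThan_telescope)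
  from tendsto_add[OF this tendsto_const[of "P 0"]] show ?thesis by (auto simp: convergent_def)
qed

lemma integrable_inner_Linf:
  assumes "\<kappa> \<in> Linf_on \<Omega>" "integrable (lebesgue_on \<Omega>) P"
  shows "integrable (lebesgue_on \<Omega>) (\<lambda>x. \<kappa> x \<bullet> P x)"
proof -
  obtain C where C: "AE x in lebesgue_on \<Omega>. norm (\<kappa> x) \<le> C" and [measurable]: "\<kappa> \<in> borel_measurable (lebesgue_on \<Omega>)"
    using assms(1) by (auto simp: Linf_on_def)
  note [measurable] = borel_measurable_integrable[OF assms(2)]
  show ?thesis
  proof (rule Bochner_Integration.integrable_bound[OF integrable_mult_right[OF integrable_norm[OF assms(2)], of C]])
    show "AE x in lebesgue_on \<Omega>. norm (\<kappa> x \<bullet> P x) \<le> norm (C * norm (P x))"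
      using C by eventually_elim (use abs_inner_le in \<open>force intro: order_trans[OF _ abs_ge_self]\<close>)
  qed measurable
qed

section \<open>Admissible functions, energy and minimizing sequences\<close>

locale inpainting = linear_growth_density F DF \<nu>1 \<nu>2 \<nu>3
  for F :: "real^'n^'m \<Rightarrow> real" and DF \<nu>1 \<nu>2 \<nu>3 +
  fixes \<Omega> D :: "(real^'n) set" and f :: "real^'n \<Rightarrow> real^'m" and \<zeta> lam :: real
  assumes \<Omega>_open: "open \<Omega>" and \<Omega>_bounded: "bounded \<Omega>" and D_meas: "D \<in> sets lebesgue"
    and \<zeta>: "\<zeta> > 1" and lam: "lam > 0" and f: "f \<in> Lp_on \<zeta> (\<Omega> - D)"
begin

abbreviation "L \<equiv> lebesgue_on \<Omega>"

definition adm :: "(real^'n \<Rightarrow> real^'m) set" where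
  "adm = W11 \<Omega> \<inter> Lp_on \<zeta> (\<Omega> - D)"

definition fid :: "(real^'n \<Rightarrow> real^'m) \<Rightarrow> real" where
  "fid w = lam / \<zeta> * (\<integral>x. norm (w x - f x) powr \<zeta> \<partial>lebesgue_on (\<Omega> - D))"

definition energy :: "(real^'n \<Rightarrow> real^'m) \<Rightarrow> real" where
  "energy w = (\<integral>x. F (W11_grad \<Omega> w x) \<partial>L) + fid w"

definition min_energy :: real where
  "min_energy = (INF w\<in>adm. energy w)"

definition conj_int :: "(real^'n \<Rightarrow> real^'n^'m) \<Rightarrow> ennreal" where
  "conj_int \<kappa> = (\<integral>\<^sup>+x. e2ennreal (conj_fun F (\<kappa> x)) \<partial>L)"

abbreviation R :: "(real^'n \<Rightarrow> real^'n^'m) \<Rightarrow> ereal" where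
  "R \<equiv> R_fun F lam \<zeta> \<Omega> D f"

lemma R_eq: "R \<kappa> = (INF w\<in>adm. ereal (\<integral>x. \<kappa> x \<bullet> W11_grad \<Omega> w x \<partial>L) - enn2ereal (conj_int \<kappa>) + ereal (fid w))"
  unfolding R_fun_def adm_def conj_int_def fid_def ..

lemma finite_L: "finite_measure L"
  by (rule finite_measure_lebesgue_on) (simp add: bounded_set_imp_lmeasurable \<Omega>_bounded \<Omega>_open)

lemma nu1_nonneg: "\<nu>1 \<ge> 0" using nu_pos by simp

lemma integrable_F:
  assumes "integrable M P"
  shows "integrable M (\<lambda>x. F (P x))"
  using F_le_norm F_nonneg nu1_nonneg borel_measurable_integrable[OF assms]
  by (intro Bochner_Integration.integrable_bound[OF integrable_mult_right[OF integrable_norm[OF assms], of \<nu>1]]) auto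

lemma DF_Linf: "P \<in> borel_measurable L \<Longrightarrow> (\<lambda>x. DF (P x)) \<in> Linf_on \<Omega>"
  using DF_bound by (auto simp: Linf_on_def)

lemma adm_grad:
  assumes "w \<in> adm"
  shows "weak_grad \<Omega> w (W11_grad \<Omega> w)" "integrable L (W11_grad \<Omega> w)" "integrable L w" "w \<in> Lp_on \<zeta> (\<Omega> - D)"
proof -
  show 1: "weak_grad \<Omega> w (W11_grad \<Omega> w)"
    using assms someI_ex[of "weak_grad \<Omega> w"] unfolding adm_def W11_def W11_grad_def by blast
  then show "integrable L (W11_grad \<Omega> w)" by (simp add: weak_grad_def Lp_on_1)
  show "integrable L w" "w \<in> Lp_on \<zeta> (\<Omega> - D)" using assms by (auto simp: adm_def W11_def Lp_on_1)
qed

text \<open>\<open>W11_grad\<close> is an arbitrary choice, so it agrees with a gradient constructed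
  by hand only almost everywhere.\<close>

lemma admI:
  assumes "weak_grad \<Omega> w G" "integrable L w" "w \<in> Lp_on \<zeta> (\<Omega> - D)"
  shows "w \<in> adm" "AE x in L. W11_grad \<Omega> w x = G x"
proof -
  show w: "w \<in> adm" using assms by (auto simp: adm_def W11_def Lp_on_1)
  show "AE x in L. W11_grad \<Omega> w x = G x"
    by (rule weak_grad_unique[OF \<Omega>_open \<Omega>_bounded adm_grad(1)[OF w] assms(1)])
qed

lemma Lp_on_convex:
  assumes "v \<in> Lp_on \<zeta> (\<Omega> - D)" "w \<in> Lp_on \<zeta> (\<Omega> - D)"
  shows "(\<lambda>x. a *\<^sub>R v x + b *\<^sub>R w x) \<in> Lp_on \<zeta> (\<Omega> - D)"
  using assms \<zeta> by (intro Lp_on_add Lp_on_scaleR) auto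

lemma adm_convex:
  assumes "v \<in> adm" "w \<in> adm"
  shows "(\<lambda>x. a *\<^sub>R v x + b *\<^sub>R w x) \<in> adm"
    and "AE x in L. W11_grad \<Omega> (\<lambda>x. a *\<^sub>R v x + b *\<^sub>R w x) x = a *\<^sub>R W11_grad \<Omega> v x + b *\<^sub>R W11_grad \<Omega> w x"
proof -
  note v = adm_grad[OF assms(1)] and w = adm_grad[OF assms(2)]
  have "weak_grad \<Omega> (\<lambda>x. a *\<^sub>R v x + b *\<^sub>R w x) (\<lambda>x. a *\<^sub>R W11_grad \<Omega> v x + b *\<^sub>R W11_grad \<Omega> w x)"
    by (rule weak_grad_lincomb) (use v w in \<open>auto simp: Lp_on_1\<close>)
  from admI[OF this _ Lp_on_convex[OF v(4) w(4)]] v(3) w(3)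
  show "(\<lambda>x. a *\<^sub>R v x + b *\<^sub>R w x) \<in> adm"
    "AE x in L. W11_grad \<Omega> (\<lambda>x. a *\<^sub>R v x + b *\<^sub>R w x) x = a *\<^sub>R W11_grad \<Omega> v x + b *\<^sub>R W11_grad \<Omega> w x"
    by simp_all
qed

lemma adm_nonempty: "adm \<noteq> {}"
proof -
  have "weak_grad \<Omega> (\<lambda>_. 0) (\<lambda>_. 0)" by (simp add: weak_grad_def Lp_on_1)
  then have "(\<lambda>_. 0) \<in> adm" using \<zeta> by (intro admI(1)) (auto simp: Lp_on_def)
  then show ?thesis by blast
qed

lemma fid_nonneg: "fid w \<ge> 0"
  unfolding fid_def using lam \<zeta> by (intro mult_nonneg_nonneg integral_nonneg_AE AE_I2) auto

lemma fid_integrable: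
  assumes "w \<in> Lp_on \<zeta> (\<Omega> - D)"
  shows "integrable (lebesgue_on (\<Omega> - D)) (\<lambda>x. norm (w x - f x) powr \<zeta>)"
proof -
  have "(\<lambda>x. w x + (-1) *\<^sub>R f x) \<in> Lp_on \<zeta> (\<Omega> - D)"
    using \<zeta> by (intro Lp_on_add Lp_on_scaleR assms f) auto
  then show ?thesis by (simp add: Lp_on_def)
qed

lemma fid_convex:
  assumes v: "v \<in> Lp_on \<zeta> (\<Omega> - D)" and w: "w \<in> Lp_on \<zeta> (\<Omega> - D)" and t: "0 \<le> t" "t \<le> 1"
  shows "fid (\<lambda>x. (1 - t) *\<^sub>R v x + t *\<^sub>R w x) \<le> (1 - t) * fid v + t * fid w"
proof -
  let ?S = "lebesgue_on (\<Omega> - D)"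
  note iv = fid_integrable[OF v] and iw = fid_integrable[OF w]
  have "(\<integral>x. norm ((1 - t) *\<^sub>R v x + t *\<^sub>R w x - f x) powr \<zeta> \<partial>?S)
      \<le> (\<integral>x. (1 - t) * norm (v x - f x) powr \<zeta> + t * norm (w x - f x) powr \<zeta> \<partial>?S)"
  proof (rule integral_mono[OF fid_integrable[OF Lp_on_convex[OF v w]]])
    fix x
    have "(1 - t) *\<^sub>R v x + t *\<^sub>R w x - f x = (1 - t) *\<^sub>R (v x - f x) + t *\<^sub>R (w x - f x)"
      by (simp add: algebra_simps)
    then show "norm ((1 - t) *\<^sub>R v x + t *\<^sub>R w x - f x) powr \<zeta> \<le> (1 - t) * norm (v x - f x) powr \<zeta> + t * norm (w x - f x) powr \<zeta>"
      using norm_convex_powr[of \<zeta> t "v x - f x" "w x - f x"] t \<zeta> by simp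
  qed (use iv iw in simp)
  also have "\<dots> = (1 - t) * (\<integral>x. norm (v x - f x) powr \<zeta> \<partial>?S) + t * (\<integral>x. norm (w x - f x) powr \<zeta> \<partial>?S)"
    using iv iw by simp
  finally have "lam / \<zeta> * (\<integral>x. norm ((1 - t) *\<^sub>R v x + t *\<^sub>R w x - f x) powr \<zeta> \<partial>?S)
      \<le> lam / \<zeta> * ((1 - t) * (\<integral>x. norm (v x - f x) powr \<zeta> \<partial>?S) + t * (\<integral>x. norm (w x - f x) powr \<zeta> \<partial>?S))"
    using lam \<zeta> by (intro mult_left_mono) auto
  then show ?thesis unfolding fid_def by (simp only: distrib_left mult.left_commute)
qed

text \<open>Convexity is spent on the fidelity term alone. F stays at the combined gradient, so that
  the midpoint gap and the first variation can still be read off.\<close>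

lemma energy_convex_le:
  assumes v: "v \<in> adm" and w: "w \<in> adm" and t: "0 \<le> t" "t \<le> 1"
  shows "energy (\<lambda>x. (1 - t) *\<^sub>R v x + t *\<^sub>R w x)
    \<le> (\<integral>x. F ((1 - t) *\<^sub>R W11_grad \<Omega> v x + t *\<^sub>R W11_grad \<Omega> w x) \<partial>L) + (1 - t) * fid v + t * fid w"
proof -
  note c = adm_convex[OF v w, of "1 - t" t]
  have "(\<integral>x. F (W11_grad \<Omega> (\<lambda>x. (1 - t) *\<^sub>R v x + t *\<^sub>R w x) x) \<partial>L)
      = (\<integral>x. F ((1 - t) *\<^sub>R W11_grad \<Omega> v x + t *\<^sub>R W11_grad \<Omega> w x) \<partial>L)"
  proof (rule integral_cong_AE)
    show "AE x in L. F (W11_grad \<Omega> (\<lambda>x. (1 - t) *\<^sub>R v x + t *\<^sub>R w x) x)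
        = F ((1 - t) *\<^sub>R W11_grad \<Omega> v x + t *\<^sub>R W11_grad \<Omega> w x)"
      using c(2) by eventually_elim simp
  qed (use adm_grad(2)[OF c(1)] adm_grad(2)[OF v] adm_grad(2)[OF w] in \<open>auto intro!: borel_measurable_integrable[OF integrable_F]\<close>)
  then show ?thesis
    using fid_convex[OF adm_grad(4)[OF v] adm_grad(4)[OF w] t] by (simp add: energy_def)
qed

lemma energy_nonneg: "energy w \<ge> 0"
  unfolding energy_def by (intro add_nonneg_nonneg fid_nonneg integral_nonneg_AE AE_I2 F_nonneg)

lemma min_energy_le: "w \<in> adm \<Longrightarrow> min_energy \<le> energy w"
  unfolding min_energy_def by (rule cINF_lower) (use energy_nonneg in \<open>auto intro!: bdd_belowI\<close>)

lemma near_minimizer: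
  assumes "\<epsilon> > 0"
  obtains w where "w \<in> adm" "energy w < min_energy + \<epsilon>"
proof -
  have "bdd_below (energy ` adm)" using energy_nonneg by (auto intro!: bdd_belowI)
  then show ?thesis
    using that cINF_less_iff[OF adm_nonempty, of energy "min_energy + \<epsilon>"] assms by (auto simp: min_energy_def)
qed

lemma grad_L1_bound:
  assumes "w \<in> adm"
  shows "(\<integral>x. norm (W11_grad \<Omega> w x) \<partial>L) \<le> (energy w + \<bar>\<nu>3\<bar> * measure L \<Omega>) / \<nu>2"
proof -
  interpret finite_measure L by (rule finite_L)
  note i = adm_grad(2)[OF assms]
  have "\<nu>2 * (\<integral>x. norm (W11_grad \<Omega> w x) \<partial>L) = (\<integral>x. \<nu>2 * norm (W11_grad \<Omega> w x) \<partial>L)" by simp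
  also have "\<dots> \<le> (\<integral>x. F (W11_grad \<Omega> w x) + \<bar>\<nu>3\<bar> \<partial>L)"
  proof (rule integral_mono)
    fix x show "\<nu>2 * norm (W11_grad \<Omega> w x) \<le> F (W11_grad \<Omega> w x) + \<bar>\<nu>3\<bar>"
      using F_growth[of "W11_grad \<Omega> w x"] by linarith
  qed (use i integrable_F[OF i] in auto)
  also have "\<dots> = (\<integral>x. F (W11_grad \<Omega> w x) \<partial>L) + \<bar>\<nu>3\<bar> * measure L \<Omega>"
    using integrable_F[OF i] by simp
  also have "\<dots> \<le> energy w + \<bar>\<nu>3\<bar> * measure L \<Omega>" using fid_nonneg[of w] by (simp add: energy_def)
  finally show ?thesis using nu_pos by (simp add: pos_le_divide_eq mult.commute)
qed

text \<open>Strict convexity forces the gradients of a fast minimizing sequence to converge almost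
  everywhere: the midpoint gaps have small integrals, and they control the distance of the
  gradients wherever these are not too large.\<close>

lemma minimizing_sequence:
  obtains w g where "\<And>k. w k \<in> adm" "(\<lambda>k. energy (w k)) \<longlonglongrightarrow> min_energy"
    "integrable L g" "AE x in L. (\<lambda>k. W11_grad \<Omega> (w k) x) \<longlonglongrightarrow> g x"
proof -
  interpret finite_measure L by (rule finite_L)
  define gap where "gap P Q = F P / 2 + F Q / 2 - F ((1/2) *\<^sub>R P + (1/2) *\<^sub>R Q)" for P Q
  have gap_nonneg: "gap P Q \<ge> 0" for P Q
    using F_convex_le[of "1/2" P Q] by (simp add: gap_def)
  \<comment> \<open>At stage j the gradients may have norm up to 2^j, while distances must fall
    below (1/2)^j: the first bound eventually covers almost every point, the second is
    summable.\<close>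
  have "\<exists>\<eta>>0. \<forall>P Q. norm P \<le> 2^j \<longrightarrow> norm Q \<le> 2^j \<longrightarrow> norm (P - Q) \<ge> (1/2)^j \<longrightarrow> gap P Q \<ge> \<eta>" for j :: nat
    unfolding gap_def using midpoint_gap_uniform[of "(1/2)^j" "2^j"] by (metis zero_less_power half_gt_zero zero_less_one)
  then obtain \<eta> where \<eta>: "\<And>j. \<eta> j > 0" "\<And>j P Q. norm P \<le> 2^j \<Longrightarrow> norm Q \<le> 2^j \<Longrightarrow> norm (P - Q) \<ge> (1/2)^j \<Longrightarrow> gap P Q \<ge> \<eta> j"
    by metis
  \<comment> \<open>The minimum over all i \<le> j lets the gap between stages j and j + 1 be
    bounded through \<eta> j for both functions. The factor \<open>min (\<eta> i) 1\<close> keeps m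
    below (1/2)^j, so the energies converge.\<close>
  define m where "m j = Min ((\<lambda>i. (1/2)^i * min (\<eta> i) 1) ` {..j})" for j :: nat
  have m_pos: "m j > 0" for j unfolding m_def using \<eta>(1) by (subst Min_gr_iff) auto
  have m_le: "m j \<le> (1/2)^i * min (\<eta> i) 1" if "i \<le> j" for i j unfolding m_def using that by (intro Min_le) auto
  have "\<exists>w. w \<in> adm \<and> energy w < min_energy + m j" for j using near_minimizer[OF m_pos] by metis
  then obtain w where w: "\<And>j. w j \<in> adm" "\<And>j. energy (w j) < min_energy + m j" by metis
  define P where "P j = W11_grad \<Omega> (w j)" for j
  have Pi: "integrable L (P j)" for j unfolding P_def by (rule adm_grad(2)[OF w(1)])
  have [measurable]: "P j \<in> borel_measurable L" for j using Pi by simp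
  have half: "(1/2)^i * min (\<eta> i) 1 \<le> (1/2)^i" for i by (simp add: mult_le_cancel_left1)
  have e_lim: "(\<lambda>k. energy (w k)) \<longlonglongrightarrow> min_energy"
  proof (rule tendsto_sandwich[of "\<lambda>_. min_energy" _ _ "\<lambda>k. min_energy + (1/2)^k"])
    show "\<forall>\<^sub>F k in sequentially. energy (w k) \<le> min_energy + (1/2)^k"
      using w(2) m_le[of k k for k] half by (intro always_eventually allI) (smt (verit) order_refl)
    have "(\<lambda>k. min_energy + (1/2::real)^k) \<longlonglongrightarrow> min_energy + 0" by (intro tendsto_intros LIMSEQ_power_zero) simp
    then show "(\<lambda>k. min_energy + (1/2::real)^k) \<longlonglongrightarrow> min_energy" by simp
  qed (use min_energy_le[OF w(1)] in auto)
  define C where "C = (min_energy + 1 + \<bar>\<nu>3\<bar> * measure L \<Omega>) / \<nu>2"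
  have PC: "(\<integral>x. norm (P j x) \<partial>L) \<le> C" for j
  proof -
    have "m j \<le> 1" using m_le[of 0 j] by simp
    then have "(energy (w j) + \<bar>\<nu>3\<bar> * measure L \<Omega>) / \<nu>2 \<le> C"
      unfolding C_def using w(2)[of j] nu_pos by (intro divide_right_mono) auto
    then show ?thesis using grad_L1_bound[OF w(1)[of j]] by (simp add: P_def)
  qed
  have gap_int: "integrable L (\<lambda>x. gap (P j x) (P (Suc j) x))"
    and gap_le: "(\<integral>x. gap (P j x) (P (Suc j) x) \<partial>L) \<le> (1/2)^j * \<eta> j" for j
  proof -
    note i = integrable_F[OF Pi]
    have im: "integrable L (\<lambda>x. F ((1/2) *\<^sub>R P j x + (1/2) *\<^sub>R P (Suc j) x))" using Pi by (intro integrable_F) simp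
    show "integrable L (\<lambda>x. gap (P j x) (P (Suc j) x))" unfolding gap_def using i im by simp
    have "min_energy \<le> energy (\<lambda>x. (1/2) *\<^sub>R w j x + (1/2) *\<^sub>R w (Suc j) x)"
      using adm_convex(1)[OF w(1) w(1)] by (rule min_energy_le)
    also have "\<dots> \<le> (\<integral>x. F ((1/2) *\<^sub>R P j x + (1/2) *\<^sub>R P (Suc j) x) \<partial>L) + 1/2 * fid (w j) + 1/2 * fid (w (Suc j))"
      using energy_convex_le[OF w(1) w(1), of "1/2" j "Suc j"] by (simp add: P_def)
    finally have "(\<integral>x. gap (P j x) (P (Suc j) x) \<partial>L) \<le> energy (w j) / 2 + energy (w (Suc j)) / 2 - min_energy"
      unfolding gap_def using i im by (simp add: energy_def P_def add_divide_distrib)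
    also have "\<dots> \<le> (1/2)^j * min (\<eta> j) 1"
      using w(2)[of j] w(2)[of "Suc j"] m_le[of j j] m_le[of j "Suc j"] by simp
    also have "\<dots> \<le> (1/2)^j * \<eta> j" by (intro mult_left_mono) auto
    finally show "(\<integral>x. gap (P j x) (P (Suc j) x) \<partial>L) \<le> (1/2)^j * \<eta> j" .
  qed
  \<comment> \<open>One quantity for three conditions: s < 1 forces both gradients below 2^j and the
    gap below \<eta> j, hence their distance below (1/2)^j. Its integral decays
    geometrically.\<close>
  define s where "s j x = (norm (P j x) + norm (P (Suc j) x)) * (1/2)^j + gap (P j x) (P (Suc j) x) / \<eta> j" for j x
  have s_ge: "s j x \<ge> norm (P j x) * (1/2)^j" "s j x \<ge> norm (P (Suc j) x) * (1/2)^j" "s j x \<ge> gap (P j x) (P (Suc j) x) / \<eta> j" for j x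
    using gap_nonneg[of "P j x" "P (Suc j) x"] \<eta>(1)[of j] by (auto simp: s_def distrib_right)
  have "AE x in L. (\<lambda>j. s j x) \<longlonglongrightarrow> 0"
  proof (rule summable_integrals_tendsto_0)
    show "integrable L (s j)" for j unfolding s_def using Pi gap_int by simp
    show "s j x \<ge> 0" for j x using s_ge(1)[of j x] by (meson mult_nonneg_nonneg norm_ge_zero order_trans zero_le_power zero_le_divide_1_iff zero_le_numeral)
    show "(\<integral>x. s j x \<partial>L) \<le> (2 * C + 1) * (1/2)^j" for j
    proof -
      have "(\<integral>x. s j x \<partial>L) = ((\<integral>x. norm (P j x) \<partial>L) + (\<integral>x. norm (P (Suc j) x) \<partial>L)) * (1/2)^j + (\<integral>x. gap (P j x) (P (Suc j) x) \<partial>L) / \<eta> j"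
        unfolding s_def using Pi gap_int by simp
      also have "\<dots> \<le> (C + C) * (1/2)^j + ((1/2)^j * \<eta> j) / \<eta> j"
        using \<eta>(1)[of j] by (intro add_mono mult_right_mono divide_right_mono PC gap_le) auto
      also have "\<dots> = (2 * C + 1) * (1/2)^j" using \<eta>(1)[of j] by (simp add: algebra_simps)
      finally show ?thesis .
    qed
    show "summable (\<lambda>j. (2 * C + 1) * (1/2)^j)" by (intro summable_mult summable_geometric) simp
  qed
  then have conv: "AE x in L. convergent (\<lambda>j. P j x)"
  proof eventually_elim
    case (elim x)
    then have "\<forall>\<^sub>F j in sequentially. s j x < 1" by (rule order_tendstoD) simp
    then have "\<forall>\<^sub>F j in sequentially. norm (P j x - P (Suc j) x) \<le> (1/2)^j"
    proof eventually_elim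
      case (elim j)
      have *: "norm p \<le> 2^j" if "norm p * (1/2)^j \<le> s j x" for p :: "real^'n^'m"
      proof -
        have "norm p * (1/2)^j < 1" using that elim by linarith
        then show ?thesis by (simp add: power_one_over divide_less_eq)
      qed
      have "gap (P j x) (P (Suc j) x) / \<eta> j < 1" using s_ge(3)[of j x] elim by linarith
      then have "gap (P j x) (P (Suc j) x) < \<eta> j" using \<eta>(1)[of j] by (simp add: divide_less_eq)
      then show ?case
        using \<eta>(2)[OF *[OF s_ge(1)] *[OF s_ge(2)]] by (meson not_le less_imp_le)
    qed
    then show ?case by (rule convergent_of_geometric_steps)
  qed
  \<comment> \<open>Where the sequence diverges this value is arbitrary, which happens on a null set
    only.\<close>
  define g where "g x = lim (\<lambda>j. P j x)" for x
  have gm[measurable]: "g \<in> borel_measurable L" unfolding g_def by (rule borel_measurable_lim_metric) measurable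
  have g_lim: "AE x in L. (\<lambda>j. P j x) \<longlonglongrightarrow> g x"
    using conv by eventually_elim (simp add: g_def convergent_LIMSEQ_iff)
  have "AE x in L. (\<lambda>j. norm (P j x)) \<longlonglongrightarrow> norm (g x)" using g_lim by eventually_elim (rule tendsto_norm)
  then have "integrable L (\<lambda>x. norm (g x))"
    by (rule fatou_real(2)[of L "\<lambda>j x. norm (P j x)" "\<lambda>x. norm (g x)" "\<lambda>_. C" C, rotated 3])
      (simp_all add: Pi PC)
  then have "integrable L g" using gm by (simp add: integrable_norm_iff)
  from that[OF w(1) e_lim this g_lim[unfolded P_def]] show ?thesis .
qed

lemma R_le_energy:
  assumes \<kappa>: "\<kappa> \<in> Linf_on \<Omega>" and w: "w \<in> adm"
  shows "R \<kappa> \<le> ereal (energy w)"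
proof -
  let ?P = "W11_grad \<Omega> w"
  note i = adm_grad(2)[OF w]
  have iq: "integrable L (\<lambda>x. \<kappa> x \<bullet> ?P x - F (?P x))"
    using integrable_inner_Linf[OF \<kappa> i] integrable_F[OF i] by simp
  have "ereal (\<integral>x. \<kappa> x \<bullet> ?P x \<partial>L) - enn2ereal (conj_int \<kappa>) + ereal (fid w) \<le> ereal (energy w)"
  \<comment> \<open>If the conjugate integral is infinite, the left side is -\<infinity>.\<close>
  proof (cases "conj_int \<kappa>")
    case (real c)
    \<comment> \<open>The integrand may be negative, whereas the conjugate integral is one of
      nonnegative functions, so its positive part is compared.\<close>
    have "ennreal (\<integral>x. \<kappa> x \<bullet> ?P x - F (?P x) \<partial>L) \<le> ennreal (\<integral>x. max 0 (\<kappa> x \<bullet> ?P x - F (?P x)) \<partial>L)"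
      using iq by (intro ennreal_leI integral_mono) auto
    also have "\<dots> = (\<integral>\<^sup>+x. ennreal (max 0 (\<kappa> x \<bullet> ?P x - F (?P x))) \<partial>L)"
      using iq by (intro nn_integral_eq_integral[symmetric]) auto
    also have "\<dots> \<le> conj_int \<kappa>"
      unfolding conj_int_def
    proof (rule nn_integral_mono)
      fix x
      have "ennreal (max 0 (\<kappa> x \<bullet> ?P x - F (?P x))) = e2ennreal (ereal (?P x \<bullet> \<kappa> x - F (?P x)))"
        by (auto simp: inner_commute max_def e2ennreal_ereal ennreal_neg)
      also have "\<dots> \<le> e2ennreal (conj_fun F (\<kappa> x))" by (rule e2ennreal_mono[OF fenchel_young])
      finally show "ennreal (max 0 (\<kappa> x \<bullet> ?P x - F (?P x))) \<le> e2ennreal (conj_fun F (\<kappa> x))" .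
    qed
    finally have "(\<integral>x. \<kappa> x \<bullet> ?P x - F (?P x) \<partial>L) \<le> c" using real by (simp add: ennreal_le_iff)
    then have "(\<integral>x. \<kappa> x \<bullet> ?P x \<partial>L) - (\<integral>x. F (?P x) \<partial>L) \<le> c"
      using integrable_inner_Linf[OF \<kappa> i] integrable_F[OF i] by simp
    then show ?thesis using real by (simp add: energy_def enn2ereal_ennreal)
  qed simp
  then show ?thesis unfolding R_eq by (rule INF_lower2[OF w])
qed

lemma R_le_min_energy:
  assumes "\<kappa> \<in> Linf_on \<Omega>"
  shows "R \<kappa> \<le> ereal min_energy"
proof (rule ereal_le_epsilon2)
  fix \<epsilon> :: real assume "\<epsilon> > 0"
  then obtain w where "w \<in> adm" "energy w < min_energy + \<epsilon>" by (rule near_minimizer)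
  then show "R \<kappa> \<le> ereal min_energy + ereal \<epsilon>"
    using R_le_energy[OF assms, of w] by (auto intro: order_trans)
qed

text \<open>First variation: the hypothesis compares the energy along the segment from \<open>q\<close> to the
  gradient of \<open>w\<close> with its value at \<open>q\<close>; differentiating at \<open>t = 0\<close> gives the bound.\<close>

lemma R_DF_ge:
  assumes q: "integrable L q"
    and seg: "\<And>w t. w \<in> adm \<Longrightarrow> 0 < t \<Longrightarrow> t < 1 \<Longrightarrow>
      (\<integral>x. F (q x) \<partial>L) + t * (c0 - (\<integral>x. F (q x) \<partial>L))
        \<le> (\<integral>x. F ((1 - t) *\<^sub>R q x + t *\<^sub>R W11_grad \<Omega> w x) \<partial>L) + t * fid w"
  shows "R (\<lambda>x. DF (q x)) \<ge> ereal c0"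
  unfolding R_eq
proof (rule INF_greatest)
  fix w assume w: "w \<in> adm"
  let ?G = "W11_grad \<Omega> w"
  note iG = adm_grad(2)[OF w]
  note [measurable] = borel_measurable_integrable[OF q] borel_measurable_integrable[OF iG]
  have DFq: "(\<lambda>x. DF (q x)) \<in> Linf_on \<Omega>" by (rule DF_Linf) measurable
  note iF = integrable_F[OF q] and iDG = integrable_inner_Linf[OF DFq iG] and iDq = integrable_inner_Linf[OF DFq q]
  define t where "t j = 1 / real (j + 2)" for j
  have t: "0 < t j" "t j < 1" for j by (auto simp: t_def)
  have "t \<longlonglongrightarrow> 0" unfolding t_def using LIMSEQ_ignore_initial_segment[OF lim_1_over_n, of 2] by simp
  then have t_lim: "filterlim t (at_right 0) sequentially"
    unfolding filterlim_at using t(1) by (auto intro!: always_eventually simp: less_imp_neq[symmetric])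
  define Q where "Q j x = (F (q x + t j *\<^sub>R (?G x - q x)) - F (q x)) / t j" for j x
  have seg_eq: "(1 - s) *\<^sub>R q x + s *\<^sub>R ?G x = q x + s *\<^sub>R (?G x - q x)" for s x by (simp add: algebra_simps)
  have "(\<lambda>j. (\<integral>x. Q j x \<partial>L)) \<longlonglongrightarrow> (\<integral>x. DF (q x) \<bullet> (?G x - q x) \<partial>L)"
  proof (rule integral_dominated_convergence[where w = "\<lambda>x. \<nu>1 * norm (?G x - q x)"])
    show "AE x in L. (\<lambda>j. Q j x) \<longlonglongrightarrow> DF (q x) \<bullet> (?G x - q x)"
      unfolding Q_def by (intro AE_I2 filterlim_compose[OF F_difference_quotient t_lim])
    show "AE x in L. norm (Q j x) \<le> \<nu>1 * norm (?G x - q x)" for j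
    proof (rule AE_I2)
      fix x
      have "\<bar>F (q x + t j *\<^sub>R (?G x - q x)) - F (q x)\<bar> \<le> t j * (\<nu>1 * norm (?G x - q x))"
        using F_lipschitz[of "q x + t j *\<^sub>R (?G x - q x)" "q x"] t(1)[of j] by (simp add: mult_ac)
      then show "norm (Q j x) \<le> \<nu>1 * norm (?G x - q x)"
        using t(1)[of j] by (simp add: Q_def divide_le_eq mult.commute)
    qed
  qed (use q iG in \<open>auto simp: Q_def\<close>)
  moreover have "c0 - (\<integral>x. F (q x) \<partial>L) - fid w \<le> (\<integral>x. Q j x \<partial>L)" for j
  proof -
    have iF': "integrable L (\<lambda>x. F (q x + t j *\<^sub>R (?G x - q x)))" using q iG by (intro integrable_F) simp
    have "t j * (c0 - (\<integral>x. F (q x) \<partial>L) - fid w) \<le> (\<integral>x. F (q x + t j *\<^sub>R (?G x - q x)) \<partial>L) - (\<integral>x. F (q x) \<partial>L)"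
      using seg[OF w t, of j] by (simp add: seg_eq algebra_simps)
    also have "\<dots> = t j * (\<integral>x. Q j x \<partial>L)" unfolding Q_def using iF iF' t(1)[of j] by simp
    finally show ?thesis using t(1)[of j] by (simp add: mult_le_cancel_left_pos)
  qed
  ultimately have "c0 - (\<integral>x. F (q x) \<partial>L) - fid w \<le> (\<integral>x. DF (q x) \<bullet> (?G x - q x) \<partial>L)"
    by (intro LIMSEQ_le_const) auto
  \<comment> \<open>DF q . q - F q is the conjugate of F at DF q, so regrouping turns the first
    variation into the dual integrand.\<close>
  then have main: "c0 \<le> (\<integral>x. DF (q x) \<bullet> ?G x \<partial>L) - (\<integral>x. DF (q x) \<bullet> q x - F (q x) \<partial>L) + fid w"
    using iDG iDq iF by (simp add: inner_diff_right)
  have nn: "DF P \<bullet> P - F P \<ge> 0" for P using F_subgradient[of P 0] F_0 by simp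
  have "conj_int (\<lambda>x. DF (q x)) = (\<integral>\<^sup>+x. ennreal (DF (q x) \<bullet> q x - F (q x)) \<partial>L)"
    unfolding conj_int_def by (simp add: conj_fun_DF e2ennreal_ereal)
  also have "\<dots> = ennreal (\<integral>x. DF (q x) \<bullet> q x - F (q x) \<partial>L)"
    using iDq iF nn by (intro nn_integral_eq_integral) auto
  finally have "enn2ereal (conj_int (\<lambda>x. DF (q x))) = ereal (\<integral>x. DF (q x) \<bullet> q x - F (q x) \<partial>L)"
    using nn by (simp add: enn2ereal_ennreal)
  then show "ereal c0 \<le> ereal (\<integral>x. DF (q x) \<bullet> ?G x \<partial>L) - enn2ereal (conj_int (\<lambda>x. DF (q x))) + ereal (fid w)"
    using main by simp
qed

text \<open>The gradients of a minimizing sequence may concentrate, so the energy of \<open>g\<close> may drop below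
  the limit; the part lost is nonnegative and is dealt with by Fatou's lemma.\<close>

lemma R_limit_ge:
  assumes w: "\<And>k. w k \<in> adm" and e_lim: "(\<lambda>k. energy (w k)) \<longlonglongrightarrow> min_energy"
    and g: "integrable L g" and g_lim: "AE x in L. (\<lambda>k. W11_grad \<Omega> (w k) x) \<longlonglongrightarrow> g x"
  shows "R (\<lambda>x. DF (g x)) \<ge> ereal min_energy"
proof (rule R_DF_ge[OF g])
  fix v t assume v: "v \<in> adm" and t: "0 < t" "t < (1::real)"
  let ?G = "W11_grad \<Omega> v" and ?P = "\<lambda>k. W11_grad \<Omega> (w k)"
  have t': "0 \<le> t" "t \<le> 1" using t by auto
  note iG = adm_grad(2)[OF v] and iP = adm_grad(2)[OF w]
  note [measurable] = borel_measurable_integrable[OF g] borel_measurable_integrable[OF iG] borel_measurable_integrable[OF iP]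
  have isum: "integrable L (\<lambda>x. F ((1 - t) *\<^sub>R p x + t *\<^sub>R ?G x))" "integrable L (\<lambda>x. F ((1 - t) *\<^sub>R p x))" if "integrable L p" for p
    using that iG by (auto intro!: integrable_F)
  have Fc: "isCont F P" for P using F_continuous continuous_on_eq_continuous_at by blast
  \<comment> \<open>The energy density along the segment is (1 - t) F p - A + B. The increment B is
    Lipschitz-bounded by the fixed function \<nu>1 t |?G| and passes to the limit; A is nonnegative
    and enters minimality on the side where Fatou's lemma suffices.\<close>
  define A where "A p x = (1 - t) * F (p x) - F ((1 - t) *\<^sub>R p x)" for p :: "real^'n \<Rightarrow> real^'n^'m" and x
  define B where "B p x = F ((1 - t) *\<^sub>R p x + t *\<^sub>R ?G x) - F ((1 - t) *\<^sub>R p x)" for p :: "real^'n \<Rightarrow> real^'n^'m" and x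
  have Ai: "integrable L (A p)" and Bi: "integrable L (B p)" if "integrable L p" for p
    unfolding A_def B_def using isum[OF that] integrable_F[OF that] by simp_all
  have A0: "A p x \<ge> 0" for p x using F_scale_le[of "1 - t" "p x"] t by (simp add: A_def)
  have B_lim: "(\<lambda>k. \<integral>x. B (?P k) x \<partial>L) \<longlonglongrightarrow> (\<integral>x. B g x \<partial>L)"
  proof (rule integral_dominated_convergence[where w = "\<lambda>x. \<nu>1 * norm (t *\<^sub>R ?G x)"])
    show "AE x in L. (\<lambda>k. B (?P k) x) \<longlonglongrightarrow> B g x"
      using g_lim
    proof eventually_elim
      case (elim x)
      show ?case unfolding B_def
        by (intro tendsto_intros isCont_tendsto_compose[OF Fc] elim)
    qed
    show "AE x in L. norm (B (?P k) x) \<le> \<nu>1 * norm (t *\<^sub>R ?G x)" for k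
    proof (rule AE_I2)
      fix x show "norm (B (?P k) x) \<le> \<nu>1 * norm (t *\<^sub>R ?G x)"
        using F_lipschitz[of "(1 - t) *\<^sub>R ?P k x + t *\<^sub>R ?G x" "(1 - t) *\<^sub>R ?P k x"] by (simp add: B_def)
    qed
  qed (use iG Bi[OF g] Bi[OF iP] in auto)
  define c where "c k = (\<integral>x. B (?P k) x \<partial>L) + t * fid v - min_energy + (1 - t) * energy (w k)" for k
  have "(\<integral>x. A g x \<partial>L) \<le> (\<integral>x. B g x \<partial>L) + t * fid v - min_energy + (1 - t) * min_energy"
  proof (rule fatou_real(3)[of L "\<lambda>k. A (?P k)" _ c])
    show "c \<longlonglongrightarrow> (\<integral>x. B g x \<partial>L) + t * fid v - min_energy + (1 - t) * min_energy"
      unfolding c_def by (intro tendsto_intros B_lim e_lim)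
    show "AE x in L. (\<lambda>k. A (?P k) x) \<longlonglongrightarrow> A g x"
      using g_lim
    proof eventually_elim
      case (elim x)
      show ?case unfolding A_def
        by (intro tendsto_intros isCont_tendsto_compose[OF Fc] elim)
    qed
    show "(\<integral>x. A (?P k) x \<partial>L) \<le> c k" for k
    proof -
      have "min_energy \<le> energy (\<lambda>x. (1 - t) *\<^sub>R w k x + t *\<^sub>R v x)"
        by (rule min_energy_le[OF adm_convex(1)[OF w v]])
      also have "\<dots> \<le> (\<integral>x. F ((1 - t) *\<^sub>R ?P k x + t *\<^sub>R ?G x) \<partial>L) + (1 - t) * fid (w k) + t * fid v"
        by (rule energy_convex_le[OF w v t'])
      finally have "min_energy \<le> (\<integral>x. F ((1 - t) *\<^sub>R ?P k x + t *\<^sub>R ?G x) \<partial>L) + (1 - t) * fid (w k) + t * fid v" .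
      then show ?thesis
        unfolding c_def A_def B_def energy_def using isum[OF iP, of k] integrable_F[OF iP, of k]
        by (simp add: algebra_simps)
    qed
  qed (use A0 Ai[OF iP] Ai[OF g] in auto)
  then show "(\<integral>x. F (g x) \<partial>L) + t * (min_energy - (\<integral>x. F (g x) \<partial>L))
      \<le> (\<integral>x. F ((1 - t) *\<^sub>R g x + t *\<^sub>R ?G x) \<partial>L) + t * fid v"
    unfolding A_def B_def using isum[OF g] integrable_F[OF g] by (simp add: algebra_simps)
qed

text \<open>Fenchel--Young deficits of a maximizer along the minimizing sequence tend to zero in \<open>L\<^sup>1\<close>.\<close>

lemma R_maximizer_eq:
  assumes w: "\<And>k. w k \<in> adm" and e_lim: "(\<lambda>k. energy (w k)) \<longlonglongrightarrow> min_energy"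
    and g: "integrable L g" and g_lim: "AE x in L. (\<lambda>k. W11_grad \<Omega> (w k) x) \<longlonglongrightarrow> g x"
    and \<tau>: "\<tau> \<in> Linf_on \<Omega>" and max: "R \<tau> \<ge> ereal min_energy"
  shows "AE x in L. \<tau> x = DF (g x)"
proof -
  let ?P = "\<lambda>k. W11_grad \<Omega> (w k)"
  note iP = adm_grad(2)[OF w]
  have \<tau>m[measurable]: "\<tau> \<in> borel_measurable L" using \<tau> by (simp add: Linf_on_def)
  note [measurable] = borel_measurable_integrable[OF g] borel_measurable_integrable[OF iP]
  have tm: "ereal min_energy \<le> ereal (\<integral>x. \<tau> x \<bullet> ?P k x \<partial>L) - enn2ereal (conj_int \<tau>) + ereal (fid (w k))" for k
    using max w unfolding R_eq by (meson INF_lower order_trans)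
  \<comment> \<open>An infinite value would force R \<tau> to be -\<infinity>, against the real
    lower bound \<open>min_energy\<close>.\<close>
  have fin: "conj_int \<tau> \<noteq> \<infinity>"
  proof
    assume "conj_int \<tau> = \<infinity>"
    then show False using tm[of 0] by simp
  qed
  \<comment> \<open>An infinite conjugate is turned into 0 here, but only on a null set, since its
    integral is finite.\<close>
  define \<Phi> where "\<Phi> x = real_of_ereal (conj_fun F (\<tau> x))" for x
  have \<Phi>m[measurable]: "\<Phi> \<in> borel_measurable L" unfolding \<Phi>_def by measurable
  have \<Phi>0: "\<Phi> x \<ge> 0" for x unfolding \<Phi>_def by (rule real_of_ereal_pos[OF conj_fun_nonneg])
  have "AE x in L. e2ennreal (conj_fun F (\<tau> x)) \<noteq> \<infinity>"
    using fin unfolding conj_int_def by (intro nn_integral_noteq_infinite) measurable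
  then have ae\<Phi>: "AE x in L. conj_fun F (\<tau> x) = ereal (\<Phi> x)"
  proof eventually_elim
    case (elim x)
    then show ?case unfolding \<Phi>_def using conj_fun_nonneg[of "\<tau> x"]
      by (cases "conj_fun F (\<tau> x)") (auto simp: e2ennreal_infty)
  qed
  have "conj_int \<tau> = (\<integral>\<^sup>+x. ennreal (\<Phi> x) \<partial>L)"
    unfolding conj_int_def by (rule nn_integral_cong_AE, use ae\<Phi> in eventually_elim) (simp add: e2ennreal_ereal)
  moreover from this fin have \<Phi>i: "integrable L \<Phi>"
    using \<Phi>0 by (intro integrableI_nonneg) (auto simp: top.not_eq_extremum)
  ultimately have cint: "conj_int \<tau> = ennreal (\<integral>x. \<Phi> x \<partial>L)"
    using nn_integral_eq_integral[OF \<Phi>i] \<Phi>0 by simp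
  define s where "s p x = \<Phi> x - (\<tau> x \<bullet> p x - F (p x))" for p :: "real^'n \<Rightarrow> real^'n^'m" and x
  have s0: "AE x in L. s p x \<ge> 0" for p
    using ae\<Phi>
  proof eventually_elim
    case (elim x)
    then show ?case using fenchel_young[of "p x" "\<tau> x"] by (simp add: s_def inner_commute)
  qed
  have si: "integrable L (s p)" if "integrable L p" for p
    unfolding s_def using \<Phi>i integrable_inner_Linf[OF \<tau> that] integrable_F[OF that] by simp
  have Fc: "isCont F P" for P using F_continuous continuous_on_eq_continuous_at by blast
  have "(\<integral>x. s g x \<partial>L) \<le> 0"
  proof (rule fatou_real(3)[of L "\<lambda>k. s (?P k)" _ "\<lambda>k. energy (w k) - min_energy"])
    show "(\<lambda>k. energy (w k) - min_energy) \<longlonglongrightarrow> 0" using e_lim by (simp add: LIM_zero)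
    show "AE x in L. (\<lambda>k. s (?P k) x) \<longlonglongrightarrow> s g x"
      using g_lim
    proof eventually_elim
      case (elim x)
      show ?case unfolding s_def by (intro tendsto_intros isCont_tendsto_compose[OF Fc] elim)
    qed
    show "(\<integral>x. s (?P k) x \<partial>L) \<le> energy (w k) - min_energy" for k
    proof -
      \<comment> \<open>Maximality bounds the dual integrand at \<open>w k\<close> below by
        \<open>min_energy\<close>; subtracting it from the energy leaves precisely the integrated
        deficit, as the fidelity terms cancel.\<close>
      have "min_energy \<le> (\<integral>x. \<tau> x \<bullet> ?P k x \<partial>L) - (\<integral>x. \<Phi> x \<partial>L) + fid (w k)"
        using tm[of k] \<Phi>0 by (simp add: cint enn2ereal_ennreal)
      then show ?thesis
        unfolding s_def energy_def using \<Phi>i integrable_inner_Linf[OF \<tau> iP[of k]] integrable_F[OF iP[of k]] by simp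
    qed
  qed (use s0 si[OF iP] si[OF g] in auto)
  then have "(\<integral>x. s g x \<partial>L) = 0" using integral_nonneg_AE[OF s0] by (simp add: antisym)
  then have "AE x in L. s g x = 0" using integral_nonneg_eq_0_iff_AE[OF si[OF g] s0] by simp
  then show ?thesis
    using ae\<Phi>
  proof eventually_elim
    case (elim x)
    then show ?case by (intro fenchel_young_equality) (simp add: s_def inner_commute)
  qed
qed

section \<open>Functions of bounded variation and minimizers of K\<close>

abbreviation K :: "(real^'n \<Rightarrow> real^'m) \<Rightarrow> real" where
  "K \<equiv> K_fun F lam \<zeta> \<Omega> D f"

text \<open>Frees K from the arbitrary \<open>bv_choice\<close>: the absolutely continuous parts
  agree almost everywhere, and the singular integrals agree by homogeneity of the recession
  function.\<close>

lemma K_eq: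
  assumes "bv_repr \<Omega> w (g, \<nu>, h)"
  shows "K w = (\<integral>x. F (g x) \<partial>L) + (\<integral>x. recession F (h x) \<partial>\<nu>) + fid w"
proof -
  obtain g' \<nu>' h' where c: "bv_choice \<Omega> w = (g', \<nu>', h')" by (metis prod_cases3)
  have r: "bv_repr \<Omega> w (g', \<nu>', h')" unfolding c[symmetric] bv_choice_def using assms by (rule someI)
  have i: "integrable L g" "integrable L g'" using assms r by (auto simp: bv_repr_def Lp_on_1)
  note u = bv_repr_unique[OF \<Omega>_open \<Omega>_bounded r assms]
  have "(\<integral>x. F (g' x) \<partial>L) = (\<integral>x. F (g x) \<partial>L)"
  proof (rule integral_cong_AE)
    show "AE x in L. F (g' x) = F (g x)" using u(1) by eventually_elim simp
  qed (use i in \<open>auto intro!: borel_measurable_integrable[OF integrable_F]\<close>)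
  moreover have "(\<integral>x. recession F (h' x) \<partial>\<nu>') = (\<integral>x. recession F (h x) \<partial>\<nu>)"
    by (rule u(2)[OF recession_borel recession_scaleR_nonneg])
  ultimately show ?thesis by (simp add: K_fun_def c recession_polar fid_def)
qed

lemma bv_repr_grad_a:
  assumes "u \<in> BV \<Omega>"
  obtains \<nu> h where "bv_repr \<Omega> u (grad_a \<Omega> u, \<nu>, h)"
proof -
  have "bv_repr \<Omega> u (bv_choice \<Omega> u)"
    using assms unfolding BV_def bv_choice_def by (auto intro: someI)
  then show ?thesis using that unfolding grad_a_def by (metis prod.collapse)
qed

text \<open>Excludes a relaxation gap: up to any \<eta>, the energy of a BV function is matched by
  an admissible Sobolev function.\<close>

lemma K_ge_min_energy:
  assumes "u \<in> BV \<Omega> \<inter> Lp_on \<zeta> (\<Omega> - D)"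
  shows "min_energy \<le> K u"
proof (rule field_le_epsilon)
  fix \<eta> :: real assume \<eta>: "\<eta> > 0"
  have u: "integrable L u" "u \<in> Lp_on \<zeta> (\<Omega> - D)" using assms by (auto simp: BV_def Lp_on_1)
  obtain \<nu> h where r: "bv_repr \<Omega> u (grad_a \<Omega> u, \<nu>, h)" using bv_repr_grad_a assms by blast
  obtain d dd where d: "\<And>x. (d has_derivative (\<lambda>h. dd x \<bullet> h)) (at x)" "continuous_on UNIV dd"
    "\<And>x. d x \<ge> 0" "\<And>x. d x > 0 \<longleftrightarrow> x \<in> \<Omega>" "\<And>x. norm (dd x) \<le> 1" "\<And>x y. \<bar>d x - d y\<bar> \<le> norm (x - y)"
    by (rule smooth_distance[OF \<Omega>_open]) blast
  interpret open_distance_bv \<Omega> d dd u "grad_a \<Omega> u" \<nu> h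
    by unfold_locales (use \<Omega>_open \<Omega>_bounded d u r in auto)
  have "linear_growth_density F DF \<nu>1 \<nu>2 \<nu>3" by unfold_locales
  moreover have "\<Omega> - D \<in> sets lebesgue" using \<Omega>_open D_meas by (intro sets.Diff) auto
  moreover have "lam / \<zeta> \<ge> 0" using lam \<zeta> by simp
  ultimately obtain w W where w: "weak_grad \<Omega> w W" "w \<in> Lp_on 1 \<Omega>" "w \<in> Lp_on \<zeta> (\<Omega> - D)"
    "(\<integral>x. F (W x) \<partial>L) + lam / \<zeta> * (\<integral>x. norm (w x - f x) powr \<zeta> \<partial>lebesgue_on (\<Omega> - D))
      \<le> (\<integral>x. F (grad_a \<Omega> u x) \<partial>L) + (\<integral>x. recession F (h x) \<partial>\<nu>)
        + lam / \<zeta> * (\<integral>x. norm (u x - f x) powr \<zeta> \<partial>lebesgue_on (\<Omega> - D)) + \<eta>"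
    using approximation[of F DF \<nu>1 \<nu>2 \<nu>3 "\<Omega> - D" \<zeta> "lam / \<zeta>" f \<eta>] u(2) f \<zeta> \<eta> by auto
  have wa: "w \<in> adm" "AE x in L. W11_grad \<Omega> w x = W x"
    by (rule admI[OF w(1) _ w(3)], use w(2) in \<open>simp add: Lp_on_1\<close>)+
  have Wi: "integrable L W" using w(1) by (simp add: weak_grad_def Lp_on_1)
  have "(\<integral>x. F (W11_grad \<Omega> w x) \<partial>L) = (\<integral>x. F (W x) \<partial>L)"
  proof (rule integral_cong_AE)
    show "AE x in L. F (W11_grad \<Omega> w x) = F (W x)" using wa(2) by eventually_elim simp
  qed (use Wi adm_grad(2)[OF wa(1)] in \<open>auto intro!: borel_measurable_integrable[OF integrable_F]\<close>)
  then have "energy w \<le> K u + \<eta>" using w(4) by (simp add: energy_def K_eq[OF r] fid_def)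
  then show "min_energy \<le> K u + \<eta>" using min_energy_le[OF wa(1)] by linarith
qed

text \<open>Moving from u towards a Sobolev function multiplies the singular density by 1 - t, and
  homogeneity turns this into a factor of its energy. Minimality therefore becomes the hypothesis of
  \<open>R_DF_ge\<close> with c0 = K u, singular energy included.\<close>

lemma R_DF_minimizer_ge:
  assumes u: "u \<in> BV \<Omega> \<inter> Lp_on \<zeta> (\<Omega> - D)"
    and min: "\<And>w. w \<in> BV \<Omega> \<inter> Lp_on \<zeta> (\<Omega> - D) \<Longrightarrow> K u \<le> K w"
  shows "R (\<lambda>x. DF (grad_a \<Omega> u x)) \<ge> ereal (K u)"
proof -
  obtain \<nu> h where r: "bv_repr \<Omega> u (grad_a \<Omega> u, \<nu>, h)" using bv_repr_grad_a u by blast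
  have ui: "u \<in> Lp_on 1 \<Omega>" "u \<in> Lp_on \<zeta> (\<Omega> - D)" using u by (auto simp: BV_def)
  have gi: "integrable L (grad_a \<Omega> u)" using r by (simp add: bv_repr_def Lp_on_1)
  show ?thesis
  proof (rule R_DF_ge[OF gi])
    fix w t assume w: "w \<in> adm" and t: "0 < t" "t < (1::real)"
    have t': "0 \<le> t" "t \<le> 1" using t by auto
    let ?v = "\<lambda>x. (1 - t) *\<^sub>R u x + t *\<^sub>R w x"
    have w1: "w \<in> Lp_on 1 \<Omega>" using adm_grad(3)[OF w] by (simp add: Lp_on_1)
    have rv: "bv_repr \<Omega> ?v (\<lambda>x. (1 - t) *\<^sub>R grad_a \<Omega> u x + t *\<^sub>R W11_grad \<Omega> w x, \<nu>, \<lambda>x. (1 - t) *\<^sub>R h x)"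
      by (rule bv_repr_lincomb[OF r ui(1) adm_grad(1)[OF w] w1])
    have "?v \<in> Lp_on 1 \<Omega>" using ui(1) w1 by (simp add: Lp_on_1)
    then have "?v \<in> BV \<Omega> \<inter> Lp_on \<zeta> (\<Omega> - D)"
      using rv Lp_on_convex[OF ui(2) adm_grad(4)[OF w], of "1 - t" t] by (auto simp: BV_def)
    then have "K u \<le> K ?v" by (rule min)
    also have "\<dots> = (\<integral>x. F ((1 - t) *\<^sub>R grad_a \<Omega> u x + t *\<^sub>R W11_grad \<Omega> w x) \<partial>L)
        + (1 - t) * (\<integral>x. recession F (h x) \<partial>\<nu>) + fid ?v"
      unfolding K_eq[OF rv] using t by (simp add: recession_scaleR_nonneg)
    also have "\<dots> \<le> (\<integral>x. F ((1 - t) *\<^sub>R grad_a \<Omega> u x + t *\<^sub>R W11_grad \<Omega> w x) \<partial>L)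
        + (1 - t) * (\<integral>x. recession F (h x) \<partial>\<nu>) + ((1 - t) * fid u + t * fid w)"
      by (intro add_left_mono fid_convex[OF ui(2) adm_grad(4)[OF w] t'])
    finally show "(\<integral>x. F (grad_a \<Omega> u x) \<partial>L) + t * (K u - (\<integral>x. F (grad_a \<Omega> u x) \<partial>L))
        \<le> (\<integral>x. F ((1 - t) *\<^sub>R grad_a \<Omega> u x + t *\<^sub>R W11_grad \<Omega> w x) \<partial>L) + t * fid w"
      by (simp add: K_eq[OF r] algebra_simps)
  qed
qed

text \<open>The solution is built from a minimizing sequence, not from a minimizer of K, so its
  existence stands on its own. For each minimizer u, \<open>DF (grad_a \<Omega> u x)\<close> also
  reaches \<open>min_energy\<close>, and uniqueness identifies the two, whichever u was
  taken.\<close>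

lemma dual_solution:
  "\<exists>\<sigma> \<in> Linf_on \<Omega>.
     (\<forall>\<kappa> \<in> Linf_on \<Omega>. R \<kappa> \<le> R \<sigma>) \<and>
     (\<forall>\<tau> \<in> Linf_on \<Omega>. (\<forall>\<kappa> \<in> Linf_on \<Omega>. R \<kappa> \<le> R \<tau>) \<longrightarrow> (AE x in L. \<tau> x = \<sigma> x)) \<and>
     (\<forall>u \<in> BV \<Omega> \<inter> Lp_on \<zeta> (\<Omega> - D).
        (\<forall>w \<in> BV \<Omega> \<inter> Lp_on \<zeta> (\<Omega> - D). K u \<le> K w) \<longrightarrow> (AE x in L. \<sigma> x = DF (grad_a \<Omega> u x)))"
proof -
  obtain w g where w: "\<And>k. w k \<in> adm" "(\<lambda>k. energy (w k)) \<longlonglongrightarrow> min_energy"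
    "integrable L g" "AE x in L. (\<lambda>k. W11_grad \<Omega> (w k) x) \<longlonglongrightarrow> g x"
    using minimizing_sequence by blast
  let ?\<sigma> = "\<lambda>x. DF (g x)"
  have \<sigma>: "?\<sigma> \<in> Linf_on \<Omega>" by (rule DF_Linf) (use w(3) in simp)
  have ge: "ereal min_energy \<le> R ?\<sigma>" by (rule R_limit_ge[OF w])
  show ?thesis
  proof (intro bexI[OF _ \<sigma>] conjI ballI impI)
    show "R \<kappa> \<le> R ?\<sigma>" if "\<kappa> \<in> Linf_on \<Omega>" for \<kappa>
      using R_le_min_energy[OF that] ge by (rule order_trans)
    show "AE x in L. \<tau> x = DF (g x)" if "\<tau> \<in> Linf_on \<Omega>" "\<forall>\<kappa>\<in>Linf_on \<Omega>. R \<kappa> \<le> R \<tau>" for \<tau>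
      using that \<sigma> by (intro R_maximizer_eq[OF w]) (auto intro: order_trans[OF ge])
    fix u assume u: "u \<in> BV \<Omega> \<inter> Lp_on \<zeta> (\<Omega> - D)"
      and min: "\<forall>w \<in> BV \<Omega> \<inter> Lp_on \<zeta> (\<Omega> - D). K u \<le> K w"
    obtain \<nu> h where "bv_repr \<Omega> u (grad_a \<Omega> u, \<nu>, h)" using bv_repr_grad_a u by blast
    then have "grad_a \<Omega> u \<in> borel_measurable L" by (auto simp: bv_repr_def Lp_on_def)
    then have "(\<lambda>x. DF (grad_a \<Omega> u x)) \<in> Linf_on \<Omega>" by (rule DF_Linf)
    moreover have "ereal min_energy \<le> R (\<lambda>x. DF (grad_a \<Omega> u x))"
      using K_ge_min_energy[OF u] R_DF_minimizer_ge[OF u] min by (meson ereal_less_eq(3) order_trans)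
    ultimately have "AE x in L. DF (grad_a \<Omega> u x) = DF (g x)" by (rule R_maximizer_eq[OF w])
    then show "AE x in L. DF (g x) = DF (grad_a \<Omega> u x)" by eventually_elim simp
  qed
qed

end

theorem theorem1p3:
  fixes \<Omega> D :: "(real^'n) set"
    and f :: "real^'n \<Rightarrow> real^'m"
    and F :: "real^'n^'m \<Rightarrow> real"
    and DF :: "real^'n^'m \<Rightarrow> real^'n^'m"
    and \<zeta> lam \<nu>1 \<nu>2 \<nu>3 :: real
  assumes n2: "CARD('n) \<ge> 2"
    and dom: "lipschitz_domain \<Omega>"
    and Dsub: "D \<subseteq> \<Omega>" and Dmeas: "D \<in> sets lebesgue"
    and Dlt: "emeasure lebesgue D < emeasure lebesgue \<Omega>"
    and zeta: "\<zeta> > 1" and lam: "lam > 0"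
    and f: "f \<in> Lp_on \<zeta> (\<Omega> - D)"
    and Fnn: "\<And>P. F P \<ge> 0"
    and Fderiv: "\<And>P. (F has_derivative (\<lambda>H. DF P \<bullet> H)) (at P)"
    and DFcont: "continuous_on UNIV DF"
    and Fconv: "strictly_convex F"
    and F0: "F 0 = 0"
    and nu: "\<nu>1 > 0" "\<nu>2 > 0"
    and DFbd: "\<And>P. norm (DF P) \<le> \<nu>1"
    and Fgrowth: "\<And>P. F P \<ge> \<nu>2 * norm P - \<nu>3"
  shows "\<exists>\<sigma> \<in> Linf_on \<Omega>.
           (\<forall>\<kappa> \<in> Linf_on \<Omega>. R_fun F lam \<zeta> \<Omega> D f \<kappa> \<le> R_fun F lam \<zeta> \<Omega> D f \<sigma>) \<and>
           (\<forall>\<tau> \<in> Linf_on \<Omega>. (\<forall>\<kappa> \<in> Linf_on \<Omega>. R_fun F lam \<zeta> \<Omega> D f \<kappa> \<le> R_fun F lam \<zeta> \<Omega> D f \<tau>)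
               \<longrightarrow> (AE x in lebesgue_on \<Omega>. \<tau> x = \<sigma> x)) \<and>
           (\<forall>u \<in> BV \<Omega> \<inter> Lp_on \<zeta> (\<Omega> - D).
               (\<forall>w \<in> BV \<Omega> \<inter> Lp_on \<zeta> (\<Omega> - D). K_fun F lam \<zeta> \<Omega> D f u \<le> K_fun F lam \<zeta> \<Omega> D f w)
               \<longrightarrow> (AE x in lebesgue_on \<Omega>. \<sigma> x = DF (grad_a \<Omega> u x)))"
proof -
  interpret inpainting F DF \<nu>1 \<nu>2 \<nu>3 \<Omega> D f \<zeta> lam
    by unfold_locales (use assms in \<open>auto simp: lipschitz_domain_def\<close>)
  show ?thesis by (rule dual_solution)
qed

end
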